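(* Let $A$ be a Young function for which there exists a positive constant $c$ such that $$\int_0^t\frac{A(s)}{s^2}\,ds\le\frac{A(ct)}{t}\qquad\text{for all } t>0.$$ Then $f$ belongs to the Sobolev--Orlicz space $W^1L^A(\mathbb{R}^n)$ if and only if $f\in L^A(\mathbb{R}^n)$ and there exists a non-negative function $g\in L^A(\mathbb{R}^n)$ such that the inequality $$|f(x)-f(y)|\le|x-y|\,(g(x)+g(y))$$ holds for a.e. $x,y\in\mathbb{R}^n$, i.e. for all $x,y\in\mathbb{R}^n\setminus S$ with some set $S$ of Lebesgue measure zero.
   Context: A Young function is a convex, left-continuous, non-constant function $A\colon[0,\infty)\to[0,\infty]$ with $A(0)=0$. The Orlicz space $L^A(\mathbb{R}^n)$ consists of all measurable $f$ on $\mathbb{R}^n$ with $\|f\|_{L^A}=\inf\{\lambda>0:\int_{\mathbb{R}^n}A(|f(x)|/\lambda)\,dx\le1\}<\infty$. $W^1L^A(\mathbb{R}^n)$ is the space of functions $f\in L^A(\mathbb{R}^n)$ having a weak gradient $\nabla f$ with $|\nabla f|\in L^A(\mathbb{R}^n)$. *)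

theory Defs
  imports "HOL-Analysis.Analysis"
begin

(* A Young function A : [0, infinity) -> [0, infinity] is a function on all reals of which only
   the values on {0..} matter.  In the convexity condition ennreal multiplication has
   0 * top = 0, so the endpoints u = 0 and v = 0 are harmless. *)
definition young_function :: "(real \<Rightarrow> ennreal) \<Rightarrow> bool" where
  "young_function A \<longleftrightarrow>
     A 0 = 0 \<and>
     (\<forall>s\<ge>0. \<forall>t\<ge>0. \<forall>u\<ge>0. \<forall>v\<ge>0. u + v = 1 \<longrightarrow>
        A (u * s + v * t) \<le> ennreal u * A s + ennreal v * A t) \<and>
     (\<forall>t>0. continuous (at_left t) A) \<and>
     \<not> A constant_on {0..}"

definition luxemburg_norm :: "(real \<Rightarrow> ennreal) \<Rightarrow> ('a::euclidean_space \<Rightarrow> real) \<Rightarrow> ennreal" where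
  "luxemburg_norm A f =
     Inf {ennreal l | l. 0 < l \<and> (\<integral>\<^sup>+ x. A (\<bar>f x\<bar> / l) \<partial>lebesgue) \<le> 1}"

definition orlicz_space :: "(real \<Rightarrow> ennreal) \<Rightarrow> ('a::euclidean_space \<Rightarrow> real) set" where
  "orlicz_space A = {f \<in> borel_measurable lebesgue. luxemburg_norm A f < \<infinity>}"

primrec C_diff :: "nat \<Rightarrow> ('a::euclidean_space \<Rightarrow> real) \<Rightarrow> bool" where
  "C_diff 0 f \<longleftrightarrow> continuous_on UNIV f"
| "C_diff (Suc k) f \<longleftrightarrow> f differentiable_on UNIV \<and>
     (\<forall>b\<in>Basis. C_diff k (\<lambda>x. frechet_derivative f (at x) b))"

definition test_function :: "('a::euclidean_space \<Rightarrow> real) \<Rightarrow> bool" where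
  "test_function \<phi> \<longleftrightarrow> (\<forall>k. C_diff k \<phi>) \<and> compact (closure {x. \<phi> x \<noteq> 0})"

definition locally_integrable ::
    "('a::euclidean_space \<Rightarrow> 'b::euclidean_space) \<Rightarrow> bool" where
  "locally_integrable f \<longleftrightarrow> (\<forall>K. compact K \<longrightarrow> f absolutely_integrable_on K)"

definition weak_gradient :: "('a::euclidean_space \<Rightarrow> real) \<Rightarrow> ('a \<Rightarrow> 'a) \<Rightarrow> bool" where
  "weak_gradient f G \<longleftrightarrow> locally_integrable f \<and> locally_integrable G \<and>
     (\<forall>\<phi>. test_function \<phi> \<longrightarrow> (\<forall>b\<in>Basis.
        (LINT x|lebesgue. f x * frechet_derivative \<phi> (at x) b)
          = - (LINT x|lebesgue. (G x \<bullet> b) * \<phi> x)))"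

definition sobolev_orlicz_space ::
    "(real \<Rightarrow> ennreal) \<Rightarrow> ('a::euclidean_space \<Rightarrow> real) set" where
  "sobolev_orlicz_space A =
     {f \<in> orlicz_space A. \<exists>G. weak_gradient f G \<and> (\<lambda>x. norm (G x)) \<in> orlicz_space A}"

end

theory Submission
  imports Defs
begin

text \<open>
  The two directions use the same dictionary between \<open>g\<close> and the gradient \<open>G\<close>: the function
  \<open>g\<close> can be a multiple of the Hardy--Littlewood maximal function of \<open>|G|\<close>, and conversely
  \<open>|G|\<close> can be bounded by a multiple of \<open>g\<close>.

  \<^emph>\<open>Sobolev functions satisfy the inequality.\<close> Let \<open>f\<^sub>r(x)\<close> be the average of \<open>f\<close> against a
  smooth product kernel supported in the cube with corner \<open>x\<close> and side \<open>r\<close>. All these kernels have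
  the same mass, so the difference of two of them is a sum of partial derivatives of test functions,
  one for each coordinate. Integrating by parts, for \<open>|x - y| \<le> r\<close> and \<open>r / 2 \<le> s \<le> r\<close> the difference
  \<open>f\<^sub>r(x) - f\<^sub>s(y)\<close> is at most \<open>r\<close> times an average of \<open>|G|\<close> over a ball around \<open>x\<close> with radius
  comparable to \<open>r\<close>, hence at most \<open>C r M|G|(x)\<close> (\<open>average_diff\<close>). With \<open>x = y\<close> and repeated halving
  this compares \<open>f\<^sub>r(x)\<close> with averages at arbitrarily small scales, hence with \<open>f(x)\<close> for almost every
  \<open>x\<close> (\<open>average_approximates_AE\<close>); with \<open>r = s = |x - y|\<close> it compares the averages at \<open>x\<close> and
  \<open>y\<close>. This gives the inequality with \<open>g = C M|G|\<close> (\<open>pointwise_estimate\<close>).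

  It remains to see that the maximal operator preserves the Orlicz space
  (\<open>maximal_function_modular\<close>). The function \<open>D(t) = \<integral>\<^sub>0\<^sup>t A(s)/s ds\<close> satisfies \<open>A(t) \<le> D(2t)\<close>
  and has an explicit derivative. Writing \<open>\<integral> D(2 M u)\<close> by the layer-cake formula and inserting the
  weak-type estimate for \<open>M\<close>, which comes from Vitali's covering lemma, one is left with
  \<open>\<integral> u(x) \<integral>\<^sub>0\<^bsup>4u(x)\<^esup> A(s)/s\<^sup>2 ds dx\<close>, and the hypothesis on \<open>A\<close> is exactly what bounds this by
  \<open>\<integral> A(4 c u)\<close>.

  \<^emph>\<open>The inequality produces a weak gradient.\<close> The difference quotients of \<open>f\<close> with step \<open>t\<close> in a
  coordinate direction \<open>b\<close> are bounded by \<open>g(x) + g(x + t b)\<close>. Translations are continuous in the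
  mean, so up to an error that vanishes in the mean they are bounded by \<open>2 g\<close> and can be written
  \<open>2 g u\<^sub>t\<close> with \<open>|u\<^sub>t| \<le> 1\<close>. Tested against smooth functions they converge to the
  distributional derivative. Bounded sequences have convex combinations that converge almost
  everywhere: this is the minimal-norm argument in a Hilbert space (\<open>midpoint_hull_convergent\<close>). The
  limit \<open>u\<close> of such combinations makes \<open>2 g u\<close> the weak derivative, by dominated convergence
  (\<open>pointwise_imp_weak_derivative\<close>). So \<open>|G|\<close> is dominated by a multiple of \<open>g\<close>.
\<close>

section \<open>Young functions and Orlicz spaces\<close>

lemma young_function_scale:
  assumes "young_function A" "0 \<le> \<theta>" "\<theta> \<le> 1" "0 \<le> s"
  shows "A (\<theta> * s) \<le> ennreal \<theta> * A s"
proof -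
  have "A (\<theta> * s + (1 - \<theta>) * 0) \<le> ennreal \<theta> * A s + ennreal (1 - \<theta>) * A 0"
    using assms unfolding young_function_def by (meson diff_ge_0_iff_ge le_add_diff_inverse order_refl)
  then show ?thesis
    using assms by (simp add: young_function_def)
qed

lemma young_function_mono:
  assumes "young_function A" "0 \<le> s" "s \<le> t"
  shows "A s \<le> A t"
proof (cases "t = 0")
  case False
  then have "A (s / t * t) \<le> ennreal (s / t) * A t"
    using assms by (intro young_function_scale) auto
  also have "\<dots> \<le> 1 * A t"
    using assms False by (intro mult_right_mono) (auto simp: ennreal_le_1 divide_le_eq_1)
  finally show ?thesis using False by simp
qed (use assms in auto)

lemma young_function_ge_secant:
  assumes "young_function A" "0 < t" "t \<le> s"
  shows "ennreal (s / t) * A t \<le> A s"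
proof -
  have "A (t / s * s) \<le> ennreal (t / s) * A s"
    using assms by (intro young_function_scale) auto
  then have "ennreal (s / t) * A t \<le> ennreal (s / t) * (ennreal (t / s) * A s)"
    using assms by (intro mult_left_mono) auto
  also have "\<dots> = A s"
    using assms by (simp flip: mult.assoc ennreal_mult)
  finally show ?thesis .
qed

text \<open>Some value of a non-constant Young function is positive, and beyond that point convexity forces
  at least linear growth. The minimum with one in the proof covers an infinite value.\<close>

lemma young_function_linear_minorant:
  assumes "young_function A"
  obtains a b where "0 < a" "0 \<le> b" "\<And>s. 0 \<le> s \<Longrightarrow> ennreal (a * s) \<le> A s + ennreal b"
proof -
  obtain t where t: "0 \<le> t" "A t \<noteq> 0"
    using assms unfolding young_function_def constant_on_def by (metis atLeast_iff)
  have "t > 0" using t assms by (cases "t = 0") (auto simp: young_function_def)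
  define e where "e = enn2real (min (A t) 1)"
  have e: "ennreal e = min (A t) 1"
    unfolding e_def by (intro ennreal_enn2real) (auto simp: min_less_iff_disj)
  have "e > 0"
    using t(2) e by (metis ennreal_0 enn2real_nonneg e_def less_eq_real_def min_def zero_neq_one)
  show thesis
  proof (rule that[of "e / t" e])
    fix s :: real assume "0 \<le> s"
    show "ennreal (e / t * s) \<le> A s + ennreal e"
    proof (cases "s \<le> t")
      case True
      have "e / t * s \<le> e"
        using True \<open>0 < e\<close> \<open>t > 0\<close> by (simp add: field_simps)
      then show ?thesis by (metis add.commute add_increasing2 ennreal_leI zero_le)
    next
      case False
      have "ennreal (e / t * s) = ennreal (s / t) * ennreal e"
        using \<open>0 < e\<close> \<open>0 \<le> s\<close> \<open>t > 0\<close> by (simp flip: ennreal_mult add: mult.commute)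
      also have "\<dots> \<le> ennreal (s / t) * A t"
        unfolding e by (intro mult_left_mono) auto
      also have "\<dots> \<le> A s"
        using young_function_ge_secant[OF assms, of t s] False \<open>t > 0\<close> by auto
      finally show ?thesis by (simp add: add_increasing2)
    qed
  qed (use \<open>e > 0\<close> \<open>t > 0\<close> in auto)
qed

lemma borel_measurable_mono_ennreal:
  fixes B :: "real \<Rightarrow> ennreal"
  assumes "mono B"
  shows "B \<in> borel_measurable borel"
proof (rule borel_measurableI_greater)
  fix y
  have "is_interval {x. y < B x}"
    unfolding is_interval_1 using assms by (auto dest: monoD order_less_le_trans)
  then show "{x \<in> space borel. y < B x} \<in> sets borel"
    using real_interval_borel_measurable by simp
qed

lemma young_function_measurable:
  assumes "young_function A"
  shows "(\<lambda>t. A (max 0 t)) \<in> borel_measurable borel"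
  using assms by (intro borel_measurable_mono_ennreal monoI young_function_mono) auto

lemma young_function_measurable_comp:
  assumes "young_function A" and [measurable]: "v \<in> borel_measurable M" and "\<And>x. x \<in> space M \<Longrightarrow> 0 \<le> v x"
  shows "(\<lambda>x. A (v x)) \<in> borel_measurable M"
proof -
  note young_function_measurable[OF assms(1), measurable]
  have "(\<lambda>x. A (max 0 (v x))) \<in> borel_measurable M" by measurable
  then show ?thesis using assms(3) by (simp add: max_absorb2 cong: measurable_cong)
qed

text \<open>Nonnegative integrals with respect to Lebesgue measure and to its restriction to Borel sets
  agree, also for integrands that are not measurable. The Borel form makes Tonelli's theorem and
  translation invariance available.\<close>

lemma orlicz_space_iff:
  "f \<in> orlicz_space A \<longleftrightarrow>
     f \<in> borel_measurable lebesgue \<and> (\<exists>l>0. (\<integral>\<^sup>+x. A (\<bar>f x\<bar> / l) \<partial>lborel) \<le> 1)"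
proof -
  have "luxemburg_norm A f < \<infinity> \<longleftrightarrow> (\<exists>l>0. (\<integral>\<^sup>+x. A (\<bar>f x\<bar> / l) \<partial>lebesgue) \<le> 1)"
    unfolding luxemburg_norm_def by (auto simp: Inf_less_iff)
  then show ?thesis by (simp add: orlicz_space_def nn_integral_completion)
qed

text \<open>Finiteness of the modular suffices: a larger dilation brings it below one, by convexity.\<close>

lemma orlicz_spaceI:
  assumes A: "young_function A" and f: "f \<in> borel_measurable lebesgue"
    and l: "0 < l" and fin: "(\<integral>\<^sup>+x. A (\<bar>f x\<bar> / l) \<partial>lborel) < \<infinity>"
  shows "f \<in> orlicz_space A"
proof -
  obtain K where K: "(\<integral>\<^sup>+x. A (\<bar>f x\<bar> / l) \<partial>lborel) \<le> ennreal K" "1 \<le> K"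
  proof -
    obtain K0 where "(\<integral>\<^sup>+x. A (\<bar>f x\<bar> / l) \<partial>lborel) = ennreal K0" "0 \<le> K0"
      using fin by (metis infinity_ennreal_def ennreal_cases less_irrefl)
    then show thesis by (intro that[of "max 1 K0"]) (auto intro!: ennreal_leI)
  qed
  have [measurable]: "(\<lambda>x. A (\<bar>f x\<bar> / l)) \<in> borel_measurable (completion lborel)"
    using f l by (intro young_function_measurable_comp[OF A]) auto
  have "(\<integral>\<^sup>+x. A (\<bar>f x\<bar> / (l * K)) \<partial>lborel) \<le> (\<integral>\<^sup>+x. ennreal (1 / K) * A (\<bar>f x\<bar> / l) \<partial>lebesgue)"
    unfolding nn_integral_completion
  proof (rule nn_integral_mono)
    fix x show "A (\<bar>f x\<bar> / (l * K)) \<le> ennreal (1 / K) * A (\<bar>f x\<bar> / l)"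
      using young_function_scale[OF A, of "1/K" "\<bar>f x\<bar> / l"] l K by (simp add: field_simps)
  qed
  also have "\<dots> = ennreal (1 / K) * (\<integral>\<^sup>+x. A (\<bar>f x\<bar> / l) \<partial>lborel)"
    by (subst nn_integral_cmult) (auto simp: nn_integral_completion)
  also have "\<dots> \<le> ennreal (1 / K) * ennreal K"
    using K by (intro mult_left_mono) auto
  also have "\<dots> = 1" using K by (simp flip: ennreal_mult)
  finally show ?thesis
    using l K f unfolding orlicz_space_iff by (intro conjI exI[of _ "l * K"]) auto
qed

lemma orlicz_space_dominated:
  assumes A: "young_function A" and g: "g \<in> orlicz_space A" and h: "h \<in> borel_measurable lebesgue"
    and "0 < C" and dom: "AE x in lborel. \<bar>h x\<bar> \<le> C * \<bar>g x\<bar>"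
  shows "h \<in> orlicz_space A"
proof -
  obtain l where l: "0 < l" "(\<integral>\<^sup>+x. A (\<bar>g x\<bar> / l) \<partial>lborel) \<le> 1"
    using g by (auto simp: orlicz_space_iff)
  have "(\<integral>\<^sup>+x. A (\<bar>h x\<bar> / (C * l)) \<partial>lborel) \<le> (\<integral>\<^sup>+x. A (\<bar>g x\<bar> / l) \<partial>lborel)"
  proof (rule nn_integral_mono_AE, use dom in eventually_elim)
    fix x assume "\<bar>h x\<bar> \<le> C * \<bar>g x\<bar>"
    then have "\<bar>h x\<bar> / (C * l) \<le> \<bar>g x\<bar> / l"
      using \<open>0 < C\<close> l by (simp add: field_simps)
    then show "A (\<bar>h x\<bar> / (C * l)) \<le> A (\<bar>g x\<bar> / l)"
      using \<open>0 < C\<close> l by (intro young_function_mono[OF A]) auto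
  qed
  also have "\<dots> < \<infinity>" using l(2) by (simp add: order_le_less_trans)
  finally show ?thesis
    using \<open>0 < C\<close> l h by (intro orlicz_spaceI[OF A, of _ "C * l"]) auto
qed

lemma orlicz_space_cong_AE:
  assumes "g \<in> borel_measurable lebesgue" "AE x in lborel. f x = g x"
  shows "f \<in> orlicz_space A \<Longrightarrow> g \<in> orlicz_space A"
proof -
  assume "f \<in> orlicz_space A"
  moreover have "(\<integral>\<^sup>+x. A (\<bar>f x\<bar> / l) \<partial>lborel) = (\<integral>\<^sup>+x. A (\<bar>g x\<bar> / l) \<partial>lborel)" for l
    using assms(2) by (intro nn_integral_cong_AE) auto
  ultimately show ?thesis using assms(1) by (simp add: orlicz_space_iff)
qed

text \<open>A Young function dominates a linear function up to a constant, so an element of an Orlicz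
  space is integrable on every set of finite measure.\<close>

lemma orlicz_space_finite_on:
  assumes A: "young_function A" and f: "f \<in> orlicz_space A"
    and S: "S \<in> sets lborel" "emeasure lborel S < \<infinity>"
  shows "(\<integral>\<^sup>+x\<in>S. ennreal \<bar>f x\<bar> \<partial>lborel) < \<infinity>"
proof -
  obtain l where l: "0 < l" "(\<integral>\<^sup>+x. A (\<bar>f x\<bar> / l) \<partial>lborel) \<le> 1"
    and [measurable]: "f \<in> borel_measurable lebesgue"
    using f by (auto simp: orlicz_space_iff)
  obtain a b where ab: "0 < a" "0 \<le> b" and le: "\<And>s. 0 \<le> s \<Longrightarrow> ennreal (a * s) \<le> A s + ennreal b"
    using young_function_linear_minorant[OF A] by blast
  have [measurable]: "S \<in> sets lebesgue" using S(1) by auto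
  have [measurable]: "(\<lambda>x. A (\<bar>f x\<bar> / l)) \<in> borel_measurable (completion lborel)"
    using l by (intro young_function_measurable_comp[OF A]) auto
  have "(\<integral>\<^sup>+x\<in>S. ennreal \<bar>f x\<bar> \<partial>lborel)
      \<le> (\<integral>\<^sup>+x. ennreal (l / a) * (A (\<bar>f x\<bar> / l) + ennreal b * indicator S x) \<partial>lebesgue)"
    unfolding nn_integral_completion
  proof (rule nn_integral_mono)
    fix x
    have "ennreal \<bar>f x\<bar> = ennreal (l / a) * ennreal (a * (\<bar>f x\<bar> / l))"
      using l ab by (simp flip: ennreal_mult)
    also have "\<dots> \<le> ennreal (l / a) * (A (\<bar>f x\<bar> / l) + ennreal b)"
      using l by (intro mult_left_mono le) auto
    finally show "ennreal \<bar>f x\<bar> * indicator S x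
        \<le> ennreal (l / a) * (A (\<bar>f x\<bar> / l) + ennreal b * indicator S x)"
      by (auto split: split_indicator)
  qed
  also have "\<dots> = ennreal (l / a) * ((\<integral>\<^sup>+x. A (\<bar>f x\<bar> / l) \<partial>lborel) + ennreal b * emeasure lborel S)"
    using S by (subst nn_integral_cmult, measurable, subst nn_integral_add, measurable)
      (simp add: nn_integral_completion nn_integral_cmult_indicator)
  also have "\<dots> < \<infinity>"
    using l(2) S by (auto simp: ennreal_mult_less_top order_le_less_trans)
  finally show ?thesis .
qed

section \<open>Continuity of translation in the mean\<close>

lemma nn_integral_lborel_translate:
  fixes F :: "'a::euclidean_space \<Rightarrow> ennreal"
  assumes [measurable]: "F \<in> borel_measurable borel"
  shows "(\<integral>\<^sup>+x. F (x + c) \<partial>lborel) = (\<integral>\<^sup>+x. F x \<partial>lborel)"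
proof -
  have "(\<integral>\<^sup>+x. F x \<partial>lborel) = (\<integral>\<^sup>+x. F x \<partial>distr lborel borel ((+) c))"
    by (simp add: lborel_distr_plus)
  also have "\<dots> = (\<integral>\<^sup>+x. F (c + x) \<partial>lborel)"
    by (intro nn_integral_distr) auto
  finally show ?thesis by (simp add: add.commute)
qed

lemma AE_lborel_translate:
  fixes c :: "'a::euclidean_space"
  assumes "AE x in lborel. P x"
  shows "AE x in lborel. P (x + c)"
proof -
  obtain N where N: "{x. \<not> P x} \<subseteq> N" "N \<in> sets lborel" "emeasure lborel N = 0"
    using assms by (auto elim!: AE_E)
  have [measurable]: "N \<in> sets borel" using N by simp
  have "(\<integral>\<^sup>+x. indicator N (x + c) \<partial>lborel) = (\<integral>\<^sup>+x. indicator N x \<partial>lborel)"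
    by (rule nn_integral_lborel_translate) auto
  also have "\<dots> = 0" using N by simp
  finally have "AE x in lborel. indicator N (x + c) = (0::ennreal)"
    by (subst (asm) nn_integral_0_iff_AE) auto
  then show ?thesis
  proof eventually_elim
    case (elim x)
    then have "x + c \<notin> N" by (simp split: split_indicator_asm)
    then show ?case using N(1) by blast
  qed
qed

lemma ennreal_tendsto_0I:
  fixes X :: "'b \<Rightarrow> ennreal"
  assumes "\<And>e. 0 < e \<Longrightarrow> eventually (\<lambda>k. X k \<le> ennreal e) F"
  shows "(X \<longlongrightarrow> 0) F"
proof (rule order_tendstoI)
  fix y :: ennreal assume "0 < y"
  then obtain z where z: "0 < z" "z < y" using dense by blast
  then obtain e where e: "z = ennreal e" "0 < e"
    by (cases z) auto
  show "eventually (\<lambda>k. X k < y) F"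
    using assms[OF e(2)] by eventually_elim (use e z(2) in auto)
qed auto

definition translation_continuous :: "('a::euclidean_space \<Rightarrow> real) \<Rightarrow> bool" where
  "translation_continuous u \<longleftrightarrow>
     (\<forall>h. h \<longlonglongrightarrow> 0 \<longrightarrow> (\<lambda>k. \<integral>\<^sup>+x. ennreal \<bar>u (x + h k) - u x\<bar> \<partial>lborel) \<longlonglongrightarrow> 0)"

lemma translation_distance_le:
  fixes u v :: "'a::euclidean_space \<Rightarrow> real"
  assumes [measurable]: "u \<in> borel_measurable borel" "v \<in> borel_measurable borel"
  shows "(\<integral>\<^sup>+x. ennreal \<bar>u (x + h) - u x\<bar> \<partial>lborel)
    \<le> (\<integral>\<^sup>+x. ennreal \<bar>v (x + h) - v x\<bar> \<partial>lborel) + 2 * (\<integral>\<^sup>+x. ennreal \<bar>u x - v x\<bar> \<partial>lborel)"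
proof -
  have "(\<integral>\<^sup>+x. ennreal \<bar>u (x + h) - u x\<bar> \<partial>lborel)
      \<le> (\<integral>\<^sup>+x. ennreal \<bar>v (x + h) - v x\<bar> + (ennreal \<bar>u (x + h) - v (x + h)\<bar> + ennreal \<bar>u x - v x\<bar>) \<partial>lborel)"
    by (intro nn_integral_mono) (auto simp flip: ennreal_plus intro!: ennreal_leI)
  also have "\<dots> = (\<integral>\<^sup>+x. ennreal \<bar>v (x + h) - v x\<bar> \<partial>lborel)
      + ((\<integral>\<^sup>+x. ennreal \<bar>u (x + h) - v (x + h)\<bar> \<partial>lborel) + (\<integral>\<^sup>+x. ennreal \<bar>u x - v x\<bar> \<partial>lborel))"
    by (subst nn_integral_add; (subst nn_integral_add)?; simp)
  also have "(\<integral>\<^sup>+x. ennreal \<bar>u (x + h) - v (x + h)\<bar> \<partial>lborel) = (\<integral>\<^sup>+x. ennreal \<bar>u x - v x\<bar> \<partial>lborel)"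
    by (rule nn_integral_lborel_translate[where F = "\<lambda>x. ennreal \<bar>u x - v x\<bar>"]) simp
  finally show ?thesis by (simp add: mult_2)
qed

lemma translation_continuous_approx:
  fixes u :: "'a::euclidean_space \<Rightarrow> real"
  assumes u [measurable]: "u \<in> borel_measurable borel"
    and ex: "\<And>e. 0 < e \<Longrightarrow> \<exists>v. v \<in> borel_measurable borel \<and> translation_continuous v \<and>
        (\<integral>\<^sup>+x. ennreal \<bar>u x - v x\<bar> \<partial>lborel) \<le> ennreal e"
  shows "translation_continuous u"
  unfolding translation_continuous_def
proof (intro allI impI ennreal_tendsto_0I)
  fix h :: "nat \<Rightarrow> 'a" and e :: real assume h: "h \<longlonglongrightarrow> 0" and e: "0 < e"
  obtain v where v: "v \<in> borel_measurable borel" "translation_continuous v"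
      "(\<integral>\<^sup>+x. ennreal \<bar>u x - v x\<bar> \<partial>lborel) \<le> ennreal (e / 4)"
    using ex[of "e/4"] e by auto
  have "(\<lambda>k. \<integral>\<^sup>+x. ennreal \<bar>v (x + h k) - v x\<bar> \<partial>lborel) \<longlonglongrightarrow> 0"
    using v(2) h by (simp add: translation_continuous_def)
  then have "eventually (\<lambda>k. (\<integral>\<^sup>+x. ennreal \<bar>v (x + h k) - v x\<bar> \<partial>lborel) < ennreal (e / 2)) sequentially"
    using e by (intro order_tendstoD) auto
  then show "eventually (\<lambda>k. (\<integral>\<^sup>+x. ennreal \<bar>u (x + h k) - u x\<bar> \<partial>lborel) \<le> ennreal e) sequentially"
  proof eventually_elim
    case (elim k)
    have "(\<integral>\<^sup>+x. ennreal \<bar>u (x + h k) - u x\<bar> \<partial>lborel) \<le> ennreal (e / 2) + 2 * ennreal (e / 4)"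
      using translation_distance_le[OF u v(1), of "h k"] elim v(3)
      by (meson add_mono mult_left_mono order.trans less_imp_le zero_le)
    also have "2 * ennreal (e / 4) = ennreal (e / 2)"
      using e by (simp flip: ennreal_numeral ennreal_mult)
    finally show ?case using e by (simp flip: ennreal_plus)
  qed
qed

text \<open>For an open set the mass that a translation loses tends to zero by dominated convergence, and
  invariance of the measure makes the mass gained equal to the mass lost.\<close>

lemma translation_continuous_open:
  fixes U :: "'a::euclidean_space set"
  assumes U: "open U" "emeasure lborel U < \<infinity>"
  shows "translation_continuous (indicat_real U)"
  unfolding translation_continuous_def
proof (intro allI impI)
  fix h :: "nat \<Rightarrow> 'a" assume h: "h \<longlonglongrightarrow> 0"
  have [measurable]: "U \<in> sets borel" using U by auto
  let ?lost = "\<lambda>k x. indicator U x * indicator (- U) (x + h k) :: ennreal"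
  have "(\<lambda>k. \<integral>\<^sup>+x. ?lost k x \<partial>lborel) \<longlonglongrightarrow> (\<integral>\<^sup>+(x::'a). 0 \<partial>lborel)"
  proof (rule nn_integral_dominated_convergence[where w = "indicator U"])
    show "AE x in lborel. (\<lambda>k. ?lost k x) \<longlonglongrightarrow> 0"
    proof (intro AE_I2)
      fix x
      show "(\<lambda>k. ?lost k x) \<longlonglongrightarrow> 0"
      proof (cases "x \<in> U")
        case True
        have "(\<lambda>k. x + h k) \<longlonglongrightarrow> x + 0" by (intro tendsto_intros h)
        then have "eventually (\<lambda>k. x + h k \<in> U) sequentially"
          using topological_tendstoD U(1) True by fastforce
        then have "eventually (\<lambda>k. ?lost k x = 0) sequentially"
          by eventually_elim simp
        then show ?thesis by (rule tendsto_eventually)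
      qed simp
    qed
  qed (use U in \<open>auto split: split_indicator\<close>)
  moreover have "(\<integral>\<^sup>+x. ennreal \<bar>indicat_real U (x + h k) - indicat_real U x\<bar> \<partial>lborel)
      = 2 * (\<integral>\<^sup>+x. ?lost k x \<partial>lborel)" (is "?D = _") for k
  proof -
    have "?D + emeasure lborel U
        = (\<integral>\<^sup>+x. ennreal \<bar>indicat_real U (x + h k) - indicat_real U x\<bar> + indicator U x \<partial>lborel)"
      by (subst nn_integral_add) auto
    also have "\<dots> = (\<integral>\<^sup>+x. indicator U (x + h k) + 2 * ?lost k x \<partial>lborel)"
      by (intro nn_integral_cong) (auto split: split_indicator)
    also have "\<dots> = (\<integral>\<^sup>+x. indicator U (x + h k) \<partial>lborel) + 2 * (\<integral>\<^sup>+x. ?lost k x \<partial>lborel)"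
      by (subst nn_integral_add; (subst nn_integral_cmult)?; simp)
    also have "(\<integral>\<^sup>+x. indicator U (x + h k) \<partial>lborel) = emeasure lborel U"
      by (subst nn_integral_lborel_translate[where F = "indicator U"]) auto
    finally show ?thesis
      using U(2) by (auto simp: add.commute[of _ "emeasure lborel U"] ennreal_add_left_cancel)
  qed
  ultimately show "(\<lambda>k. \<integral>\<^sup>+x. ennreal \<bar>indicat_real U (x + h k) - indicat_real U x\<bar> \<partial>lborel) \<longlonglongrightarrow> 0"
    using ennreal_tendsto_cmult[where c = 2 and x = 0] by simp
qed

lemma translation_continuous_indicator:
  fixes S :: "'a::euclidean_space set"
  assumes S: "S \<in> sets borel" "emeasure lborel S < \<infinity>"
  shows "translation_continuous (indicat_real S)"
proof (rule translation_continuous_approx)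
  fix e :: real assume e: "0 < e"
  obtain U where U: "open U" "S \<subseteq> U" "emeasure lborel (U - S) < ennreal e"
    using outer_regular_lborel[of S e] S e by auto
  have [measurable]: "S \<in> sets borel" "U \<in> sets borel" using U S by auto
  have "emeasure lborel U = emeasure lborel S + emeasure lborel (U - S)"
    using U(2) by (subst plus_emeasure) (auto simp: Un_absorb1)
  also have "\<dots> < \<infinity>" using S U by (auto simp: less_top[symmetric] dest: less_trans)
  finally have fin: "emeasure lborel U < \<infinity>" .
  have "(\<integral>\<^sup>+x. ennreal \<bar>indicat_real S x - indicat_real U x\<bar> \<partial>lborel) = emeasure lborel (U - S)"
    using U(2) 
    by (subst nn_integral_indicator[symmetric], simp, intro nn_integral_cong) (auto split: split_indicator)
  then show "\<exists>v. v \<in> borel_measurable borel \<and> translation_continuous v \<and>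
      (\<integral>\<^sup>+x. ennreal \<bar>indicat_real S x - v x\<bar> \<partial>lborel) \<le> ennreal e"
    using U fin translation_continuous_open[OF U(1) fin] by (intro exI[of _ "indicat_real U"]) auto
qed (use S in auto)

theorem L1_translation_continuous:
  fixes u :: "'a::euclidean_space \<Rightarrow> real"
  assumes "integrable lborel u"
  shows "translation_continuous u"
  using assms
proof (induction rule: integrable_induct)
  case (base S c)
  show ?case
    unfolding translation_continuous_def
  proof (intro allI impI)
    fix h :: "nat \<Rightarrow> 'a" assume "h \<longlonglongrightarrow> 0"
    then have "(\<lambda>k. \<integral>\<^sup>+x. ennreal \<bar>indicat_real S (x + h k) - indicat_real S x\<bar> \<partial>lborel) \<longlonglongrightarrow> 0"
      using translation_continuous_indicator[of S] base by (simp add: translation_continuous_def)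
    then have "(\<lambda>k. ennreal \<bar>c\<bar> * (\<integral>\<^sup>+x. ennreal \<bar>indicat_real S (x + h k) - indicat_real S x\<bar> \<partial>lborel)) \<longlonglongrightarrow> 0"
      using ennreal_tendsto_cmult[where c = "ennreal \<bar>c\<bar>" and x = 0] by simp
    moreover have "(\<integral>\<^sup>+x. ennreal \<bar>indicat_real S (x + h k) *\<^sub>R c - indicat_real S x *\<^sub>R c\<bar> \<partial>lborel)
        = ennreal \<bar>c\<bar> * (\<integral>\<^sup>+x. ennreal \<bar>indicat_real S (x + h k) - indicat_real S x\<bar> \<partial>lborel)" for k
    proof -
      have [measurable]: "S \<in> sets borel" using base by simp
      show ?thesis
        by (subst nn_integral_cmult[symmetric])
          (auto intro!: nn_integral_cong simp flip: ennreal_mult split: split_indicator)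
    qed
    ultimately show "(\<lambda>k. \<integral>\<^sup>+x. ennreal \<bar>indicat_real S (x + h k) *\<^sub>R c - indicat_real S x *\<^sub>R c\<bar> \<partial>lborel) \<longlonglongrightarrow> 0"
      by simp
  qed
next
  case (add f g)
  have [measurable]: "f \<in> borel_measurable borel" "g \<in> borel_measurable borel"
    using add by (auto dest: borel_measurable_integrable)
  show ?case
    unfolding translation_continuous_def
  proof (intro allI impI)
    fix h :: "nat \<Rightarrow> 'a" assume "h \<longlonglongrightarrow> 0"
    then have "(\<lambda>k. (\<integral>\<^sup>+x. ennreal \<bar>f (x + h k) - f x\<bar> \<partial>lborel) + (\<integral>\<^sup>+x. ennreal \<bar>g (x + h k) - g x\<bar> \<partial>lborel)) \<longlonglongrightarrow> 0 + 0"
      using add by (intro tendsto_add) (auto simp: translation_continuous_def)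
    then have sum: "(\<lambda>k. (\<integral>\<^sup>+x. ennreal \<bar>f (x + h k) - f x\<bar> \<partial>lborel) + (\<integral>\<^sup>+x. ennreal \<bar>g (x + h k) - g x\<bar> \<partial>lborel)) \<longlonglongrightarrow> 0"
      by simp
    show "(\<lambda>k. \<integral>\<^sup>+x. ennreal \<bar>f (x + h k) + g (x + h k) - (f x + g x)\<bar> \<partial>lborel) \<longlonglongrightarrow> 0"
    proof (rule tendsto_sandwich[OF _ _ tendsto_const sum])
      show "\<forall>\<^sub>F k in sequentially. (\<integral>\<^sup>+x. ennreal \<bar>f (x + h k) + g (x + h k) - (f x + g x)\<bar> \<partial>lborel)
          \<le> (\<integral>\<^sup>+x. ennreal \<bar>f (x + h k) - f x\<bar> \<partial>lborel) + (\<integral>\<^sup>+x. ennreal \<bar>g (x + h k) - g x\<bar> \<partial>lborel)"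
        by (intro always_eventually allI, subst nn_integral_add[symmetric], simp, simp)
          (auto intro!: nn_integral_mono ennreal_leI simp flip: ennreal_plus)
    qed auto
  qed
next
  case (lim f s)
  have [measurable]: "f \<in> borel_measurable borel" "\<And>i. s i \<in> borel_measurable borel"
    using lim by (auto dest: borel_measurable_integrable)
  show ?case
  proof (rule translation_continuous_approx)
    fix e :: real assume e: "0 < e"
    have "(\<lambda>i. \<integral>\<^sup>+x. ennreal \<bar>f x - s i x\<bar> \<partial>lborel) \<longlonglongrightarrow> (\<integral>\<^sup>+(x::'a). 0 \<partial>lborel)"
    proof (rule nn_integral_dominated_convergence[where w = "\<lambda>x. ennreal (3 * \<bar>f x\<bar>)"])
      fix i
      show "AE x in lborel. ennreal \<bar>f x - s i x\<bar> \<le> ennreal (3 * \<bar>f x\<bar>)"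
      proof (intro AE_I2 ennreal_leI)
        fix x
        have "norm (s i x) \<le> 2 * norm (f x)" by (rule lim.hyps(3)) simp
        then show "\<bar>f x - s i x\<bar> \<le> 3 * \<bar>f x\<bar>" by simp
      qed
    next
      show "(\<integral>\<^sup>+x. ennreal (3 * \<bar>f x\<bar>) \<partial>lborel) < \<infinity>"
        using integrable_mult_right[OF integrable_abs[OF lim.hyps(4)], of 3] unfolding integrable_iff_bounded by (simp add: abs_mult)
    next
      show "AE x in lborel. (\<lambda>i. ennreal \<bar>f x - s i x\<bar>) \<longlonglongrightarrow> 0"
      proof (intro AE_I2)
        fix x
        have "(\<lambda>i. \<bar>f x - s i x\<bar>) \<longlonglongrightarrow> \<bar>f x - f x\<bar>"
          by (rule tendsto_rabs[OF tendsto_diff[OF tendsto_const lim.hyps(2)]]) simp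
        from tendsto_ennrealI[OF this] show "(\<lambda>i. ennreal \<bar>f x - s i x\<bar>) \<longlonglongrightarrow> 0"
          by simp
      qed
    qed auto
    then have "eventually (\<lambda>i. (\<integral>\<^sup>+x. ennreal \<bar>f x - s i x\<bar> \<partial>lborel) < ennreal e) sequentially"
      using e by (intro order_tendstoD) auto
    then obtain i where "(\<integral>\<^sup>+x. ennreal \<bar>f x - s i x\<bar> \<partial>lborel) < ennreal e"
      by (auto simp: eventually_sequentially)
    then show "\<exists>v. v \<in> borel_measurable borel \<and> translation_continuous v \<and>
        (\<integral>\<^sup>+x. ennreal \<bar>f x - v x\<bar> \<partial>lborel) \<le> ennreal e"
      using lim.IH by (intro exI[of _ "s i"]) auto
  qed simp
qed

text \<open>The sequential form of continuity at zero, restated with a modulus.\<close>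

lemma translation_continuous_uniform:
  fixes w :: "'a::euclidean_space \<Rightarrow> real"
  assumes "translation_continuous w" "0 < e"
  obtains d where "0 < d"
    "\<And>h. norm h < d \<Longrightarrow> (\<integral>\<^sup>+x. ennreal \<bar>w (x + h) - w x\<bar> \<partial>lborel) \<le> ennreal e"
proof -
  let ?T = "\<lambda>h. \<integral>\<^sup>+x. ennreal \<bar>w (x + h) - w x\<bar> \<partial>lborel"
  have "\<exists>d>0. \<forall>h. norm h < d \<longrightarrow> ?T h \<le> ennreal e"
  proof (rule ccontr)
    assume "\<not> ?thesis"
    then have "\<exists>h. norm h < d \<and> \<not> ?T h \<le> ennreal e" if "0 < d" for d
      using that by blast
    then have "\<forall>k. \<exists>h. norm h < inverse (real (Suc k)) \<and> \<not> ?T h \<le> ennreal e"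
      by simp
    then obtain h where h: "\<And>k. norm (h k) < inverse (real (Suc k))" "\<And>k. \<not> ?T (h k) \<le> ennreal e"
      by metis
    have "(\<lambda>k. norm (h k)) \<longlonglongrightarrow> 0"
      by (rule tendsto_sandwich[OF _ _ tendsto_const LIMSEQ_inverse_real_of_nat])
         (use h(1) in \<open>auto intro!: always_eventually less_imp_le\<close>)
    then have "h \<longlonglongrightarrow> 0" by (simp add: tendsto_norm_zero_iff)
    then have "(\<lambda>k. ?T (h k)) \<longlonglongrightarrow> 0"
      using assms(1) by (simp add: translation_continuous_def)
    then have "eventually (\<lambda>k. ?T (h k) < ennreal e) sequentially"
      using assms(2) by (intro order_tendstoD) auto
    then obtain k where "?T (h k) < ennreal e" by (auto simp: eventually_sequentially)
    then show False using h(2)[of k] by (simp add: less_imp_le)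
  qed
  then show thesis using that by blast
qed

section \<open>The maximal function\<close>

lemma emeasure_ball_pos_finite:
  fixes x :: "'a::euclidean_space"
  assumes "0 < r"
  shows "0 < emeasure lborel (ball x r)" "emeasure lborel (ball x r) < \<infinity>"
  using assms unit_ball_vol_pos[of "real DIM('a)"] by (auto simp: emeasure_ball emeasure_lborel_ball_finite)

lemma emeasure_ball_scale:
  fixes x y :: "'a::euclidean_space"
  assumes "0 < r" "0 \<le> k"
  shows "emeasure lborel (ball y (k * r)) = ennreal (k ^ DIM('a)) * emeasure lborel (ball x r)"
  using assms by (simp add: emeasure_ball power_mult_distrib mult_ac flip: ennreal_mult)

lemma ennreal_less_divide_iff:
  fixes a b t :: ennreal
  assumes "0 < b" "b < \<infinity>"
  shows "t < a / b \<longleftrightarrow> t * b < a"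
proof -
  have "a / b \<le> t \<longleftrightarrow> a \<le> t * b"
  proof
    assume "a / b \<le> t"
    then have "a / b * b \<le> t * b" by (rule mult_right_mono) simp
    moreover have "a / b * b = a"
      using mult_divide_eq_ennreal[of b a] assms by (simp add: divide_ennreal_def mult_ac)
    ultimately show "a \<le> t * b" by simp
  qed (use assms in \<open>auto intro: divide_le_posI_ennreal simp: mult.commute\<close>)
  then show ?thesis by (simp flip: not_le)
qed

definition maximal_function :: "('a::euclidean_space \<Rightarrow> ennreal) \<Rightarrow> 'a \<Rightarrow> ennreal" where
  "maximal_function u x =
     (SUP r\<in>{0<..}. (\<integral>\<^sup>+z\<in>ball x r. u z \<partial>lborel) / emeasure lborel (ball x r))"

text \<open>Strict lower bounds avoid division by the volume and the supremum.\<close>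

lemma less_maximal_function_iff:
  "t < maximal_function u x \<longleftrightarrow>
     (\<exists>r>0. t * emeasure lborel (ball x r) < (\<integral>\<^sup>+z\<in>ball x r. u z \<partial>lborel))"
  unfolding maximal_function_def less_SUP_iff
  by (auto simp: ennreal_less_divide_iff emeasure_ball_pos_finite[unfolded infinity_ennreal_def])

lemma maximal_function_upper:
  fixes u :: "'a::euclidean_space \<Rightarrow> ennreal"
  assumes "0 < r"
  shows "(\<integral>\<^sup>+z\<in>ball x r. u z \<partial>lborel) \<le> maximal_function u x * emeasure lborel (ball x r)"
  using less_maximal_function_iff[of "maximal_function u x" u x] assms by (metis less_irrefl not_less)

text \<open>The integral over an open ball is the limit of the integrals over smaller concentric balls, so
  a strict lower bound survives a small displacement of the centre.\<close>

lemma open_maximal_function: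
  fixes u :: "'a::euclidean_space \<Rightarrow> ennreal"
  assumes [measurable]: "u \<in> borel_measurable borel"
  shows "open {x. t < maximal_function u x}"
  unfolding open_contains_ball
proof (intro ballI)
  fix x assume "x \<in> {x. t < maximal_function u x}"
  then obtain r where r: "0 < r" and less: "t * emeasure lborel (ball x r) < (\<integral>\<^sup>+z\<in>ball x r. u z \<partial>lborel)"
    by (auto simp: less_maximal_function_iff)
  let ?B = "\<lambda>k::nat. ball x (r - r / real (Suc k))"
  have "(\<Union>k. ?B k) = ball x r"
  proof
    show "ball x r \<subseteq> (\<Union>k. ?B k)"
    proof
      fix y assume y: "y \<in> ball x r"
      have "(\<lambda>k. r - r * inverse (real (Suc k))) \<longlonglongrightarrow> r - r * 0"
        by (intro tendsto_intros LIMSEQ_inverse_real_of_nat)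
      then have "eventually (\<lambda>k. dist x y < r - r * inverse (real (Suc k))) sequentially"
        using y by (intro order_tendstoD) auto
      then show "y \<in> (\<Union>k. ?B k)"
        by (auto simp: eventually_sequentially divide_inverse)
    qed
  next
    show "(\<Union>k. ?B k) \<subseteq> ball x r"
      using r by (intro UN_least subset_ball) simp
  qed
  moreover have "incseq ?B"
    using r by (intro monoI) (auto intro!: subset_ball divide_left_mono)
  ultimately have "(SUP k. emeasure (density lborel u) (?B k)) = emeasure (density lborel u) (ball x r)"
    by (subst SUP_emeasure_incseq) auto
  with less have "t * emeasure lborel (ball x r) < (SUP k. emeasure (density lborel u) (?B k))"
    by (simp add: emeasure_density)
  then obtain k where k: "t * emeasure lborel (ball x r) < (\<integral>\<^sup>+z\<in>?B k. u z \<partial>lborel)"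
    by (auto simp: less_SUP_iff emeasure_density)
  show "\<exists>e>0. ball x e \<subseteq> {x. t < maximal_function u x}"
  proof (intro exI conjI subsetI)
    show "0 < r / real (Suc k)" using r by simp
    fix y assume y: "y \<in> ball x (r / real (Suc k))"
    have "?B k \<subseteq> ball y r"
    proof
      fix z assume "z \<in> ?B k"
      then show "z \<in> ball y r" using y dist_triangle[of y z x] by (auto simp: dist_commute)
    qed
    then have "(\<integral>\<^sup>+z\<in>?B k. u z \<partial>lborel) \<le> (\<integral>\<^sup>+z\<in>ball y r. u z \<partial>lborel)"
      by (intro nn_integral_mono mult_left_mono) (auto split: split_indicator)
    moreover have "emeasure lborel (ball y r) = emeasure lborel (ball x r)"
      using r by (simp add: emeasure_ball)
    ultimately show "y \<in> {x. t < maximal_function u x}"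
      using k r by (auto simp: less_maximal_function_iff intro!: exI[of _ r] less_le_trans[OF k])
  qed
qed

lemma borel_measurable_maximal_function [measurable]:
  fixes u :: "'a::euclidean_space \<Rightarrow> ennreal"
  assumes "u \<in> borel_measurable borel"
  shows "maximal_function u \<in> borel_measurable borel"
  by (rule borel_measurableI_greater) (use open_maximal_function[OF assms] in auto)

text \<open>Every point of a superlevel set is the centre of a ball on which the average of the function
  is large. By Vitali's covering lemma, the fivefold dilations of countably many disjoint balls
  among these cover the set.\<close>

theorem maximal_function_weak_type:
  fixes u :: "'a::euclidean_space \<Rightarrow> ennreal"
  assumes [measurable]: "u \<in> borel_measurable borel" and t: "0 < t"
  shows "ennreal t * emeasure lborel {x. ennreal t < maximal_function u x}
    \<le> ennreal (5 ^ DIM('a)) * (\<integral>\<^sup>+x. u x \<partial>lborel)"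
proof (cases "(\<integral>\<^sup>+x. u x \<partial>lborel) = \<infinity>")
  case True
  then show ?thesis by (simp add: ennreal_mult_top)
next
  case False
  then obtain I where I: "(\<integral>\<^sup>+x. u x \<partial>lborel) = ennreal I" "0 \<le> I"
    by (metis ennreal_cases infinity_ennreal_def)
  define E where "E = {x. ennreal t < maximal_function u x}"
  define V where "V = unit_ball_vol (real DIM('a))"
  have V: "0 < V" using unit_ball_vol_pos[of "real DIM('a)"] by (simp add: V_def)
  have [measurable]: "E \<in> sets borel"
    unfolding E_def using open_maximal_function[OF assms(1)] by auto
  have "\<forall>x\<in>E. \<exists>r>0. ennreal t * emeasure lborel (ball x r) < (\<integral>\<^sup>+z\<in>ball x r. u z \<partial>lborel)"
    by (auto simp: E_def less_maximal_function_iff)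
  then obtain r where r: "\<And>x. x \<in> E \<Longrightarrow> 0 < r x"
      "\<And>x. x \<in> E \<Longrightarrow> ennreal t * emeasure lborel (ball x (r x)) < (\<integral>\<^sup>+z\<in>ball x (r x). u z \<partial>lborel)"
    by metis
  have [measurable]: "indicator (ball x s) \<in> borel_measurable borel" for x :: 'a and s
    by (intro borel_measurable_indicator) simp
  \<comment> \<open>Vitali's lemma needs bounded radii: a large ball has too much volume for an integrable function.\<close>
  have bound: "r x \<le> max 1 (I / (t * V))" if "x \<in> E" for x
  proof (rule ccontr)
    assume "\<not> r x \<le> max 1 (I / (t * V))"
    then have gt: "1 < r x" "I / (t * V) < r x" by auto
    have "ennreal t * emeasure lborel (ball x (r x)) < (\<integral>\<^sup>+z\<in>ball x (r x). u z \<partial>lborel)"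
      by (rule r(2)[OF that])
    also have "\<dots> \<le> (\<integral>\<^sup>+z. u z \<partial>lborel)"
      by (intro nn_integral_mono) (auto split: split_indicator)
    finally have "ennreal (t * (V * r x ^ DIM('a))) < ennreal I"
      using r(1)[OF that] t V by (simp add: I emeasure_ball V_def ennreal_mult)
    moreover have "0 \<le> t * (V * r x ^ DIM('a))"
      using r(1)[OF that] t V by simp
    ultimately have "t * (V * r x ^ DIM('a)) < I" by (simp add: ennreal_less_iff)
    moreover have "t * (V * r x) \<le> t * (V * r x ^ DIM('a))"
      using gt t V DIM_positive[where 'a='a] by (intro mult_left_mono self_le_power) auto
    moreover have "I < t * (V * r x)" using gt(2) t V by (simp add: field_simps)
    ultimately show False by linarith
  qed
  have "\<exists>C. countable C \<and> C \<subseteq> E \<and> pairwise (\<lambda>i j. disjnt (cball i (r i)) (cball j (r j))) C \<and>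
      (\<forall>i\<in>E. \<exists>j\<in>C. cball i (r i) \<subseteq> ball j (5 * r j))"
  proof (rule Vitali_covering_lemma_cballs_balls[of E r "max 1 (I / (t * V))" "\<lambda>x. x", OF conjI[OF r(1) bound]])
    fix C assume "countable C" "C \<subseteq> E" "pairwise (\<lambda>i j. disjnt (cball i (r i)) (cball j (r j))) C"
      and "\<And>i. i \<in> E \<Longrightarrow> \<exists>j. j \<in> C \<and> \<not> disjnt (cball i (r i)) (cball j (r j)) \<and> cball i (r i) \<subseteq> ball j (5 * r j)"
    then show ?thesis
      by (intro exI[of _ C] conjI ballI) (assumption | meson)+
  qed
  then obtain C where C: "countable C" "C \<subseteq> E"
    and disj: "pairwise (\<lambda>i j. disjnt (cball i (r i)) (cball j (r j))) C"
    and cover: "\<And>i. i \<in> E \<Longrightarrow> \<exists>j\<in>C. cball i (r i) \<subseteq> ball j (5 * r j)"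
    by blast
  have "ennreal t * emeasure lborel E
      \<le> ennreal t * (\<integral>\<^sup>+x. (\<integral>\<^sup>+c. indicator (ball c (5 * r c)) x \<partial>count_space C) \<partial>lborel)"
  proof (subst nn_integral_indicator[symmetric], simp, intro mult_left_mono nn_integral_mono)
    fix x
    show "indicator E x \<le> (\<integral>\<^sup>+c. indicator (ball c (5 * r c)) x \<partial>count_space C)"
    proof (cases "x \<in> E")
      case True
      then obtain c where c: "c \<in> C" "x \<in> ball c (5 * r c)"
        using cover[of x] r(1)[of x] by (meson centre_in_cball less_imp_le subsetD)
      then have "(1::ennreal) = (\<integral>\<^sup>+c'. indicator {c} c' \<partial>count_space C)"
        by (subst nn_integral_indicator) auto
      also have "\<dots> \<le> (\<integral>\<^sup>+c. indicator (ball c (5 * r c)) x \<partial>count_space C)"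
        using c by (intro nn_integral_mono) (auto split: split_indicator)
      finally show ?thesis using True by simp
    qed simp
  qed simp
  also have "\<dots> = ennreal t * (\<integral>\<^sup>+c. emeasure lborel (ball c (5 * r c)) \<partial>count_space C)"
    using C(1) by (subst nn_integral_count_space_nn_integral) auto
  also have "\<dots> = (\<integral>\<^sup>+c. ennreal t * emeasure lborel (ball c (5 * r c)) \<partial>count_space C)"
    by (rule nn_integral_cmult[symmetric]) simp
  also have "\<dots> \<le> (\<integral>\<^sup>+c. ennreal (5 ^ DIM('a)) * (\<integral>\<^sup>+z\<in>ball c (r c). u z \<partial>lborel) \<partial>count_space C)"
  proof (rule nn_integral_mono)
    fix c assume "c \<in> space (count_space C)"
    then have c: "c \<in> E" using C by auto
    have "ennreal t * emeasure lborel (ball c (5 * r c))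
        = ennreal (5 ^ DIM('a)) * (ennreal t * emeasure lborel (ball c (r c)))"
      by (subst emeasure_ball_scale[where x = c]) (use r(1)[OF c] in \<open>auto simp: mult_ac\<close>)
    also have "\<dots> \<le> ennreal (5 ^ DIM('a)) * (\<integral>\<^sup>+z\<in>ball c (r c). u z \<partial>lborel)"
      using r(2)[OF c] by (intro mult_left_mono) auto
    finally show "ennreal t * emeasure lborel (ball c (5 * r c))
        \<le> ennreal (5 ^ DIM('a)) * (\<integral>\<^sup>+z\<in>ball c (r c). u z \<partial>lborel)" .
  qed
  also have "\<dots> = ennreal (5 ^ DIM('a)) * (\<integral>\<^sup>+z. (\<integral>\<^sup>+c. u z * indicator (ball c (r c)) z \<partial>count_space C) \<partial>lborel)"
    using C(1) by (subst nn_integral_count_space_nn_integral) (auto simp: nn_integral_cmult)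
  also have "\<dots> \<le> ennreal (5 ^ DIM('a)) * (\<integral>\<^sup>+z. u z \<partial>lborel)"
  proof (intro mult_left_mono nn_integral_mono)
    fix z
    have "(\<integral>\<^sup>+c. u z * indicator (ball c (r c)) z \<partial>count_space C)
        = (\<integral>\<^sup>+c. u z * indicator {c\<in>C. z \<in> ball c (r c)} c \<partial>count_space C)"
      by (intro nn_integral_cong) (auto split: split_indicator)
    also have "\<dots> = u z * emeasure (count_space C) {c\<in>C. z \<in> ball c (r c)}"
      by (subst nn_integral_cmult_indicator) auto
    also have "emeasure (count_space C) {c\<in>C. z \<in> ball c (r c)} \<le> 1"
    proof -
      have eq: "c = d" if "c \<in> C" "z \<in> ball c (r c)" "d \<in> C" "z \<in> ball d (r d)" for c d
      proof (rule ccontr)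
        assume "c \<noteq> d"
        then have "disjnt (cball c (r c)) (cball d (r d))"
          using that disj by (auto simp: pairwise_def)
        moreover have "z \<in> cball c (r c)" "z \<in> cball d (r d)" using that by auto
        ultimately show False by (meson disjnt_iff)
      qed
      show ?thesis
      proof (cases "{c\<in>C. z \<in> ball c (r c)} = {}")
        case False
        then obtain c where "{c\<in>C. z \<in> ball c (r c)} = {c}" using eq by blast
        moreover have "emeasure (count_space C) {c} = 1" if "c \<in> C"
          using that by (subst emeasure_count_space_finite) auto
        ultimately show ?thesis by fastforce
      next
        case True
        show ?thesis unfolding True by simp
      qed
    qed
    then show "(\<integral>\<^sup>+c. u z * indicator (ball c (r c)) z \<partial>count_space C) \<le> u z"
      unfolding calculation using mult_left_mono[of _ 1 "u z"] by simp
  qed simp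
  finally show ?thesis by (simp add: E_def)
qed

text \<open>Splitting the function at height \<open>t\<close>, only the part above the height contributes
  to the set where the maximal function exceeds \<open>2 * t\<close>.\<close>

corollary maximal_function_weak_type_truncated:
  fixes u :: "'a::euclidean_space \<Rightarrow> ennreal"
  assumes [measurable]: "u \<in> borel_measurable borel" and t: "0 < t"
  shows "ennreal t * emeasure lborel {x. ennreal (2 * t) < maximal_function u x}
    \<le> ennreal (5 ^ DIM('a)) * (\<integral>\<^sup>+x\<in>{x. ennreal t < u x}. u x \<partial>lborel)"
proof -
  define w where "w = (\<lambda>x. u x * indicator {x. ennreal t < u x} x)"
  have [measurable]: "w \<in> borel_measurable borel" unfolding w_def by measurable
  have "{x. ennreal (2 * t) < maximal_function u x} \<subseteq> {x. ennreal t < maximal_function w x}"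
  proof safe
    fix x assume "ennreal (2 * t) < maximal_function u x"
    then obtain r where r: "0 < r" "ennreal (2 * t) * emeasure lborel (ball x r) < (\<integral>\<^sup>+z\<in>ball x r. u z \<partial>lborel)"
      by (auto simp: less_maximal_function_iff)
    have [measurable]: "ball x r \<in> sets borel" by simp
    let ?b = "ennreal t * emeasure lborel (ball x r)"
    have "(\<integral>\<^sup>+z\<in>ball x r. u z \<partial>lborel) \<le> (\<integral>\<^sup>+z. w z * indicator (ball x r) z + ennreal t * indicator (ball x r) z \<partial>lborel)"
      by (intro nn_integral_mono) (auto simp: w_def not_less split: split_indicator)
    also have "\<dots> = (\<integral>\<^sup>+z\<in>ball x r. w z \<partial>lborel) + ?b"
      by (subst nn_integral_add) (auto simp: nn_integral_cmult_indicator)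
    finally have "?b + ?b < (\<integral>\<^sup>+z\<in>ball x r. w z \<partial>lborel) + ?b"
      using r(2) t by (simp flip: distrib_right ennreal_plus)
    then have "?b < (\<integral>\<^sup>+z\<in>ball x r. w z \<partial>lborel)"
      by (meson add_right_mono not_less)
    then show "ennreal t < maximal_function w x"
      using r(1) by (auto simp: less_maximal_function_iff)
  qed
  then have "ennreal t * emeasure lborel {x. ennreal (2 * t) < maximal_function u x}
      \<le> ennreal t * emeasure lborel {x. ennreal t < maximal_function w x}"
    using open_maximal_function[of w "ennreal t"] by (intro mult_left_mono emeasure_mono) auto
  also have "\<dots> \<le> ennreal (5 ^ DIM('a)) * (\<integral>\<^sup>+x. w x \<partial>lborel)"
    by (rule maximal_function_weak_type) (use t in auto)
  finally show ?thesis by (simp add: w_def)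
qed

section \<open>The maximal function on Orlicz spaces\<close>

text \<open>The integral on the right is a Young function equivalent to \<open>A\<close> whose
  derivative is explicit, so that the layer-cake formula applies to it.\<close>

lemma young_function_le_integral:
  assumes A: "young_function A" and v: "0 \<le> v"
  shows "A v \<le> (\<integral>\<^sup>+s\<in>{0<..<2 * v}. (A s / ennreal s) \<partial>lborel)"
proof (cases "v = 0")
  case True
  then show ?thesis using A by (simp add: young_function_def)
next
  case False
  with v have v: "0 < v" by simp
  have "A v = A v / ennreal v * emeasure lborel {v<..<2 * v}"
    using v by (simp add: mult_divide_eq_ennreal divide_ennreal_def mult.assoc flip: ennreal_mult)
      (simp add: inverse_ennreal flip: ennreal_mult)
  also have "\<dots> = (\<integral>\<^sup>+s\<in>{v<..<2 * v}. (A v / ennreal v) \<partial>lborel)"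
    by (simp add: nn_integral_cmult_indicator)
  also have "\<dots> \<le> (\<integral>\<^sup>+s\<in>{0<..<2 * v}. (A s / ennreal s) \<partial>lborel)"
  proof (rule nn_integral_mono)
    fix s
    have "A v / ennreal v \<le> A s / ennreal s" if "v < s"
    proof -
      have "A v / ennreal v = ennreal (s / v) * A v * ennreal (1 / s)"
        using v that by (simp add: divide_ennreal_def inverse_ennreal mult_ac flip: ennreal_mult)
          (simp add: field_simps)
      also have "\<dots> \<le> A s * ennreal (1 / s)"
        using young_function_ge_secant[OF A v, of s] that by (intro mult_right_mono) auto
      also have "\<dots> = A s / ennreal s"
        using v that by (simp add: divide_ennreal_def inverse_ennreal inverse_eq_divide)
      finally show ?thesis .
    qed
    then show "A v / ennreal v * indicator {v<..<2 * v} s \<le> A s / ennreal s * indicator {0<..<2 * v} s"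
      using v by (auto split: split_indicator)
  qed
  finally show ?thesis .
qed

text \<open>The hypothesis on \<open>A\<close> enters here: after the layer-cake formula and the weak-type
  estimate, Tonelli's theorem leaves exactly the integral of \<open>A s / s\<^sup>2\<close>.\<close>

theorem maximal_function_modular:
  fixes u :: "'a::euclidean_space \<Rightarrow> real"
  assumes A: "young_function A" and "0 < c"
    and hyp: "\<And>t. 0 < t \<Longrightarrow> (\<integral>\<^sup>+s\<in>{0<..<t}. (A s / ennreal (s\<^sup>2)) \<partial>lborel) \<le> A (c * t) / ennreal t"
    and [measurable]: "u \<in> borel_measurable borel" and u: "\<And>x. 0 \<le> u x"
  shows "(\<integral>\<^sup>+x. A (enn2real (maximal_function (\<lambda>z. ennreal (u z)) x)) \<partial>lborel)
    \<le> ennreal (5 ^ DIM('a)) * (\<integral>\<^sup>+x. A (4 * c * u x) \<partial>lborel)"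
proof -
  define m where "m = maximal_function (\<lambda>z. ennreal (u z))"
  define v where "v = (\<lambda>x. enn2real (m x))"
  define B where "B = (\<lambda>s. A (max 0 s))"
  have [measurable]: "m \<in> borel_measurable borel" "v \<in> borel_measurable borel"
    unfolding m_def v_def by measurable
  have [measurable]: "B \<in> borel_measurable borel"
    unfolding B_def by (rule young_function_measurable[OF A])
  have subgraph: "(\<lambda>p. indicator {..<h (fst p)} (snd p) :: ennreal) \<in> borel_measurable (lborel \<Otimes>\<^sub>M lborel)"
    if [measurable]: "h \<in> borel_measurable borel" for h :: "'a \<Rightarrow> real"
  proof -
    have "(\<lambda>p. indicator {p. snd p < h (fst p)} p :: ennreal) \<in> borel_measurable (lborel \<Otimes>\<^sub>M lborel)"
      by measurable
    then show ?thesis by (simp add: indicator_def)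
  qed
  have [measurable]:
    "(\<lambda>p. indicator {..<2 * v (fst p)} (snd p) :: ennreal) \<in> borel_measurable (lborel \<Otimes>\<^sub>M lborel)"
    "(\<lambda>p. indicator {..<4 * u (fst p)} (snd p) :: ennreal) \<in> borel_measurable (lborel \<Otimes>\<^sub>M lborel)"
    by (intro subgraph; measurable)+
  have [measurable]: "(\<lambda>x. indicator {..<h x} s :: ennreal) \<in> borel_measurable borel"
    if [measurable]: "h \<in> borel_measurable borel" for h :: "'a \<Rightarrow> real" and s
  proof -
    have "(\<lambda>x. indicator {x. s < h x} x :: ennreal) \<in> borel_measurable borel" by measurable
    then show ?thesis by (simp add: indicator_def)
  qed
  have AB: "A s = B s" if "0 \<le> s" for s using that by (simp add: B_def)
  have "(\<integral>\<^sup>+x. A (v x) \<partial>lborel) \<le> (\<integral>\<^sup>+x. (\<integral>\<^sup>+s. A s / ennreal s * indicator {0<..<2 * v x} s \<partial>lborel) \<partial>lborel)"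
    by (intro nn_integral_mono young_function_le_integral[OF A]) (simp add: v_def)
  also have "\<dots> = (\<integral>\<^sup>+x. (\<integral>\<^sup>+s. B s / ennreal s * indicator {0<..} s * indicator {..<2 * v x} s \<partial>lborel) \<partial>lborel)"
    by (intro nn_integral_cong) (auto simp: AB split: split_indicator)
  also have "\<dots> = (\<integral>\<^sup>+s. (\<integral>\<^sup>+x. B s / ennreal s * indicator {0<..} s * indicator {..<2 * v x} s \<partial>lborel) \<partial>lborel)"
    by (rule lborel_pair.Fubini'[symmetric]) measurable
  also have "\<dots> \<le> (\<integral>\<^sup>+s. (\<integral>\<^sup>+x. ennreal (4 * 5 ^ DIM('a)) * (B s / ennreal (s\<^sup>2) * indicator {0<..} s)
      * (ennreal (u x) * indicator {..<4 * u x} s) \<partial>lborel) \<partial>lborel)"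
  proof (rule nn_integral_mono)
    fix s :: real
    show "(\<integral>\<^sup>+x. B s / ennreal s * indicator {0<..} s * indicator {..<2 * v x} s \<partial>lborel)
        \<le> (\<integral>\<^sup>+x. ennreal (4 * 5 ^ DIM('a)) * (B s / ennreal (s\<^sup>2) * indicator {0<..} s)
            * (ennreal (u x) * indicator {..<4 * u x} s) \<partial>lborel)"
    proof (cases "0 < s")
      case True
      \<comment> \<open>The weak-type estimate is used at height \<open>s / 4\<close>, because \<open>s < 2 * v x\<close> means that the
        maximal function exceeds \<open>2 * (s / 4)\<close>.\<close>
      have set_eq: "{x. ennreal (s / 4) < ennreal (u x)} = {x. s < 4 * u x}"
        using True by (auto simp: ennreal_less_iff)
      have sub: "s < 2 * v x \<Longrightarrow> ennreal (2 * (s / 4)) < m x" for x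
        using True by (cases "m x") (auto simp: v_def ennreal_less_iff)
      have "(\<integral>\<^sup>+x. indicator {..<2 * v x} s \<partial>lborel) \<le> (\<integral>\<^sup>+x. indicator {x. ennreal (2 * (s / 4)) < m x} x \<partial>lborel)"
        using sub by (intro nn_integral_mono) (auto split: split_indicator)
      also have "\<dots> = emeasure lborel {x. ennreal (2 * (s / 4)) < m x}"
        by simp
      also have "\<dots> = ennreal (4 / s) * (ennreal (s / 4) * emeasure lborel {x. ennreal (2 * (s / 4)) < m x})"
        using True by (simp flip: mult.assoc ennreal_mult)
      also have "\<dots> \<le> ennreal (4 / s) * (ennreal (5 ^ DIM('a)) * (\<integral>\<^sup>+x\<in>{x. ennreal (s / 4) < ennreal (u x)}. ennreal (u x) \<partial>lborel))"
        unfolding m_def using True by (intro mult_left_mono maximal_function_weak_type_truncated) auto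
      also have "(\<integral>\<^sup>+x\<in>{x. ennreal (s / 4) < ennreal (u x)}. ennreal (u x) \<partial>lborel)
          = (\<integral>\<^sup>+x. ennreal (u x) * indicator {..<4 * u x} s \<partial>lborel)"
        unfolding set_eq by (intro nn_integral_cong) (auto split: split_indicator)
      finally have *: "(\<integral>\<^sup>+x. indicator {..<2 * v x} s \<partial>lborel)
          \<le> ennreal (4 / s) * (ennreal (5 ^ DIM('a)) * (\<integral>\<^sup>+x. ennreal (u x) * indicator {..<4 * u x} s \<partial>lborel))" .
      have "(\<integral>\<^sup>+x. B s / ennreal s * indicator {0<..} s * indicator {..<2 * v x} s \<partial>lborel)
          = B s / ennreal s * (\<integral>\<^sup>+x. indicator {..<2 * v x} s \<partial>lborel)"
        using True by (subst nn_integral_cmult[symmetric]) auto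
      also have "\<dots> \<le> B s / ennreal s *
          (ennreal (4 / s) * (ennreal (5 ^ DIM('a)) * (\<integral>\<^sup>+x. ennreal (u x) * indicator {..<4 * u x} s \<partial>lborel)))"
        by (intro mult_left_mono *) simp
      also have "\<dots> = ennreal (4 * 5 ^ DIM('a)) * (B s / ennreal (s\<^sup>2)) *
          (\<integral>\<^sup>+x. ennreal (u x) * indicator {..<4 * u x} s \<partial>lborel)"
      proof -
        have "ennreal (1/s) * ennreal (4/s) * ennreal (5 ^ DIM('a)) = ennreal (4 * 5 ^ DIM('a)) * ennreal (1 / s\<^sup>2)"
          using True by (simp add: power2_eq_square flip: ennreal_mult)
        then have *: "B s * (ennreal (1/s) * ennreal (4/s) * ennreal (5 ^ DIM('a))) * I
            = B s * (ennreal (4 * 5 ^ DIM('a)) * ennreal (1 / s\<^sup>2)) * I" for I by simp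
        have "B s / ennreal s = B s * ennreal (1/s)" "B s / ennreal (s\<^sup>2) = B s * ennreal (1 / s\<^sup>2)"
          using True by (auto simp: divide_ennreal_def inverse_ennreal inverse_eq_divide)
        then show ?thesis
          using *[of "\<integral>\<^sup>+x. ennreal (u x) * indicator {..<4 * u x} s \<partial>lborel"] by (simp only: mult_ac)
      qed
      also have "\<dots> = (\<integral>\<^sup>+x. ennreal (4 * 5 ^ DIM('a)) * (B s / ennreal (s\<^sup>2) * indicator {0<..} s)
          * (ennreal (u x) * indicator {..<4 * u x} s) \<partial>lborel)"
        using True by (subst nn_integral_cmult) auto
      finally show ?thesis .
    qed simp
  qed
  also have "\<dots> = (\<integral>\<^sup>+x. (\<integral>\<^sup>+s. ennreal (4 * 5 ^ DIM('a)) * (B s / ennreal (s\<^sup>2) * indicator {0<..} s)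
      * (ennreal (u x) * indicator {..<4 * u x} s) \<partial>lborel) \<partial>lborel)"
    by (rule lborel_pair.Fubini') measurable
  also have "\<dots> \<le> (\<integral>\<^sup>+x. ennreal (5 ^ DIM('a)) * B (4 * c * u x) \<partial>lborel)"
  proof (rule nn_integral_mono)
    fix x
    have "(\<integral>\<^sup>+s. ennreal (4 * 5 ^ DIM('a)) * (B s / ennreal (s\<^sup>2) * indicator {0<..} s)
        * (ennreal (u x) * indicator {..<4 * u x} s) \<partial>lborel)
      = (\<integral>\<^sup>+s. ennreal (4 * 5 ^ DIM('a)) * ennreal (u x) * (A s / ennreal (s\<^sup>2) * indicator {0<..<4 * u x} s) \<partial>lborel)"
      by (intro nn_integral_cong) (auto simp: AB mult_ac split: split_indicator)
    also have "\<dots> = ennreal (4 * 5 ^ DIM('a)) * ennreal (u x) * (\<integral>\<^sup>+s\<in>{0<..<4 * u x}. (A s / ennreal (s\<^sup>2)) \<partial>lborel)"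
    proof (rule nn_integral_cmult)
      have "(\<lambda>s. B s / ennreal (s\<^sup>2) * indicator {0<..<4 * u x} s) \<in> borel_measurable lborel" by measurable
      also have "(\<lambda>s. B s / ennreal (s\<^sup>2) * indicator {0<..<4 * u x} s) = (\<lambda>s. A s / ennreal (s\<^sup>2) * indicator {0<..<4 * u x} s)"
        by (auto simp: AB split: split_indicator)
      finally show "(\<lambda>s. A s / ennreal (s\<^sup>2) * indicator {0<..<4 * u x} s) \<in> borel_measurable lborel" .
    qed
    also have "\<dots> \<le> ennreal (5 ^ DIM('a)) * B (4 * c * u x)"
    proof (cases "u x = 0")
      case False
      with u[of x] have pos: "0 < u x" by linarith
      have "ennreal (4 * 5 ^ DIM('a)) * ennreal (u x) * (\<integral>\<^sup>+s\<in>{0<..<4 * u x}. (A s / ennreal (s\<^sup>2)) \<partial>lborel)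
          \<le> ennreal (4 * 5 ^ DIM('a)) * ennreal (u x) * (A (c * (4 * u x)) / ennreal (4 * u x))"
        using pos by (intro mult_left_mono hyp) auto
      also have "A (c * (4 * u x)) / ennreal (4 * u x) = ennreal (1 / (4 * u x)) * B (4 * c * u x)"
        using pos \<open>0 < c\<close> by (simp add: AB divide_ennreal_def inverse_ennreal inverse_eq_divide mult_ac)
      also have "ennreal (4 * 5 ^ DIM('a)) * ennreal (u x) * (ennreal (1 / (4 * u x)) * B (4 * c * u x))
          = ennreal (4 * 5 ^ DIM('a)) * ennreal (u x) * ennreal (1 / (4 * u x)) * B (4 * c * u x)"
        by (simp only: mult.assoc)
      also have "ennreal (4 * 5 ^ DIM('a)) * ennreal (u x) * ennreal (1 / (4 * u x)) = ennreal (5 ^ DIM('a))"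
        using pos by (simp flip: ennreal_mult)
      finally show ?thesis .
    qed simp
    finally show "(\<integral>\<^sup>+s. ennreal (4 * 5 ^ DIM('a)) * (B s / ennreal (s\<^sup>2) * indicator {0<..} s)
        * (ennreal (u x) * indicator {..<4 * u x} s) \<partial>lborel) \<le> ennreal (5 ^ DIM('a)) * B (4 * c * u x)" .
  qed
  also have "\<dots> = ennreal (5 ^ DIM('a)) * (\<integral>\<^sup>+x. B (4 * c * u x) \<partial>lborel)"
    by (rule nn_integral_cmult) measurable
  also have "(\<integral>\<^sup>+x. B (4 * c * u x) \<partial>lborel) = (\<integral>\<^sup>+x. A (4 * c * u x) \<partial>lborel)"
    using u \<open>0 < c\<close> by (intro nn_integral_cong) (simp add: AB)
  finally show ?thesis by (simp add: v_def m_def)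
qed

text \<open>The set where the maximal function is infinite lies in every superlevel set. By the weak-type
  estimate its measure is at most a constant over \<open>t\<close>, since \<open>A\<close> dominates a linear function on
  large arguments.\<close>

lemma maximal_function_finite_AE:
  fixes u :: "'a::euclidean_space \<Rightarrow> real"
  assumes A: "young_function A" and [measurable]: "u \<in> borel_measurable borel" and u: "\<And>x. 0 \<le> u x"
    and fin: "(\<integral>\<^sup>+x. A (u x) \<partial>lborel) < \<infinity>"
  shows "AE x in lborel. maximal_function (\<lambda>z. ennreal (u z)) x < \<infinity>"
proof -
  define m where "m = maximal_function (\<lambda>z. ennreal (u z))"
  have [measurable]: "m \<in> borel_measurable borel"
    unfolding m_def by measurable
  obtain a b where ab: "0 < a" "0 \<le> b" and le: "\<And>s. 0 \<le> s \<Longrightarrow> ennreal (a * s) \<le> A s + ennreal b"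
    using young_function_linear_minorant[OF A] by blast
  obtain J where J: "(\<integral>\<^sup>+x. A (u x) \<partial>lborel) = ennreal J" "0 \<le> J"
    using fin by (metis ennreal_cases infinity_ennreal_def less_irrefl)
  \<comment> \<open>Above \<open>t0\<close> the additive constant \<open>b\<close> is absorbed by half of the linear term.\<close>
  define t0 where "t0 = max 1 (2 * b / a)"
  define K where "K = 5 ^ DIM('a) * (2 / a * J)"
  have K: "0 \<le> K" using ab J by (simp add: K_def)
  have bound: "ennreal t * emeasure lborel {x. m x = \<infinity>} \<le> ennreal K" if t: "t0 \<le> t" for t
  proof -
    have t1: "0 < t" using t by (simp add: t0_def)
    have "ennreal t * emeasure lborel {x. m x = \<infinity>} \<le> ennreal t * emeasure lborel {x. ennreal (2 * t) < m x}"
      by (intro mult_left_mono emeasure_mono) auto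
    also have "\<dots> \<le> ennreal (5 ^ DIM('a)) * (\<integral>\<^sup>+x\<in>{x. ennreal t < ennreal (u x)}. ennreal (u x) \<partial>lborel)"
      unfolding m_def by (rule maximal_function_weak_type_truncated) (use t1 in auto)
    also have "(\<integral>\<^sup>+x\<in>{x. ennreal t < ennreal (u x)}. ennreal (u x) \<partial>lborel) \<le> (\<integral>\<^sup>+x. ennreal (2 / a) * A (u x) \<partial>lborel)"
    proof (intro nn_integral_mono)
      fix x
      have "ennreal (u x) \<le> ennreal (2 / a) * A (u x)" if "t < u x"
      proof -
        have "2 * b / a < u x" using that t by (simp add: t0_def)
        then have "2 * b < a * u x" using ab by (simp add: field_simps)
        then have "ennreal (a * u x / 2) + ennreal b \<le> ennreal (a * u x)"
          using ab u[of x] ennreal_leI[of "a * u x / 2 + b" "a * u x"] by simp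
        also have "\<dots> \<le> A (u x) + ennreal b" by (rule le[OF u])
        finally have "ennreal (a * u x / 2) \<le> A (u x)"
          by (simp add: add.commute[of _ "ennreal b"] ennreal_add_left_cancel_le)
        then have "ennreal (2 / a) * ennreal (a * u x / 2) \<le> ennreal (2 / a) * A (u x)"
          by (intro mult_left_mono) auto
        then show ?thesis using ab u[of x] by (simp flip: ennreal_mult)
      qed
      then show "ennreal (u x) * indicator {x. ennreal t < ennreal (u x)} x \<le> ennreal (2 / a) * A (u x)"
        using t1 by (auto simp: ennreal_less_iff split: split_indicator)
    qed
    also have "(\<integral>\<^sup>+x. ennreal (2 / a) * A (u x) \<partial>lborel) = ennreal (2 / a) * ennreal J"
      unfolding J(1)[symmetric] by (intro nn_integral_cmult young_function_measurable_comp[OF A]) (auto simp: u)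
    finally show ?thesis
      using ab J by (simp add: K_def mult_left_mono flip: ennreal_mult)
  qed
  have "emeasure lborel {x. m x = \<infinity>} = 0"
  proof (rule ccontr)
    assume "emeasure lborel {x. m x = \<infinity>} \<noteq> 0"
    then have "0 < min 1 (emeasure lborel {x. m x = \<infinity>})" by (simp add: zero_less_iff_neq_zero)
    moreover have "min 1 (emeasure lborel {x. m x = \<infinity>}) < \<infinity>" by (simp add: min_less_iff_disj)
    ultimately obtain e where e: "min 1 (emeasure lborel {x. m x = \<infinity>}) = ennreal e" "0 < e"
      by (metis ennreal_cases ennreal_less_zero_iff infinity_ennreal_def less_irrefl)
    define t where "t = max t0 ((K + 1) / e)"
    have "ennreal (K + 1) \<le> ennreal (t * e)"
      using e(2) K by (intro ennreal_leI) (auto simp: t_def field_simps max_def)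
    also have "\<dots> = ennreal t * min 1 (emeasure lborel {x. m x = \<infinity>})"
      unfolding e using e(2) by (intro ennreal_mult) (auto simp: t_def t0_def)
    also have "\<dots> \<le> ennreal t * emeasure lborel {x. m x = \<infinity>}"
      by (intro mult_left_mono) auto
    also have "\<dots> \<le> ennreal K" by (rule bound) (simp add: t_def)
    finally show False using K by simp
  qed
  then have "AE x in lborel. m x \<noteq> \<infinity>"
    by (intro AE_I[of _ _ "{x. m x = \<infinity>}"]) auto
  then show ?thesis by (simp add: m_def less_top)
qed

section \<open>Smooth test functions\<close>

lemma C_diff_SucI:
  assumes "\<And>x. (f has_derivative f' x) (at x)" and "\<And>b. b \<in> Basis \<Longrightarrow> C_diff k (\<lambda>x. f' x b)"
  shows "C_diff (Suc k) f"
proof -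
  have "frechet_derivative f (at x) = f' x" for x
    using frechet_derivative_at[OF assms(1)] by metis
  then show ?thesis
    using assms by (auto simp: differentiable_on_def differentiable_def)
qed

lemma C_diff_SucD:
  assumes "C_diff (Suc k) f"
  shows "\<And>x. (f has_derivative frechet_derivative f (at x)) (at x)"
    and "\<And>b. b \<in> Basis \<Longrightarrow> C_diff k (\<lambda>x. frechet_derivative f (at x) b)"
  using assms by (auto simp: differentiable_on_def frechet_derivative_works)

lemma C_diff_Suc_imp: "C_diff (Suc k) f \<Longrightarrow> C_diff k f"
proof (induction k arbitrary: f)
  case 0
  then show ?case by (auto intro: differentiable_imp_continuous_on)
next
  case (Suc k)
  show ?case
    by (rule C_diff_SucI[OF C_diff_SucD(1)[OF Suc.prems]]) (use Suc in auto)
qed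

lemma C_diff_const: "C_diff k (\<lambda>_. c)"
  by (induction k arbitrary: c) (auto intro!: C_diff_SucI[where f' = "\<lambda>_ _. 0"] simp del: C_diff.simps(2))

lemma C_diff_add: "C_diff k f \<Longrightarrow> C_diff k g \<Longrightarrow> C_diff k (\<lambda>x. f x + g x)"
proof (induction k arbitrary: f g)
  case (Suc k)
  show ?case
    by (rule C_diff_SucI[OF has_derivative_add[OF C_diff_SucD(1)[OF Suc.prems(1)] C_diff_SucD(1)[OF Suc.prems(2)]]])
       (use Suc in auto)
qed (auto intro: continuous_intros)

lemma C_diff_mult: "C_diff k f \<Longrightarrow> C_diff k g \<Longrightarrow> C_diff k (\<lambda>x. f x * g x)"
proof (induction k arbitrary: f g)
  case (Suc k)
  show ?case
    by (rule C_diff_SucI[OF has_derivative_mult[OF C_diff_SucD(1)[OF Suc.prems(1)] C_diff_SucD(1)[OF Suc.prems(2)]]])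
       (intro C_diff_add Suc.IH C_diff_Suc_imp[OF Suc.prems(1)] C_diff_Suc_imp[OF Suc.prems(2)]
          C_diff_SucD(2)[OF Suc.prems(1)] C_diff_SucD(2)[OF Suc.prems(2)])
qed (auto intro: continuous_intros)

lemma C_diff_prod: "finite I \<Longrightarrow> (\<And>i. i \<in> I \<Longrightarrow> C_diff k (f i)) \<Longrightarrow> C_diff k (\<lambda>x. \<Prod>i\<in>I. f i x)"
  by (induction I rule: finite_induct) (auto intro: C_diff_const C_diff_mult)

lemma C_diff_real_SucI:
  fixes h :: "real \<Rightarrow> real"
  assumes "\<And>t. (h has_real_derivative h' t) (at t)" "C_diff k h'"
  shows "C_diff (Suc k) h"
  by (rule C_diff_SucI[where f' = "\<lambda>x y. h' x * y"])
    (use assms in \<open>auto simp: has_field_derivative_def\<close>)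

lemma C_diff_compose_affine:
  fixes h :: "real \<Rightarrow> real" and v :: "'a::euclidean_space"
  assumes "C_diff k h"
  shows "C_diff k (\<lambda>x. h (x \<bullet> v + q))"
  using assms
proof (induction k arbitrary: h)
  case 0
  then show ?case
    by (auto intro!: continuous_intros continuous_on_compose2[of UNIV h])
next
  case (Suc k)
  let ?h' = "\<lambda>t. frechet_derivative h (at t) 1"
  have h': "(h has_derivative (\<lambda>y. ?h' t * y)) (at t)" for t
  proof -
    have d: "(h has_derivative frechet_derivative h (at t)) (at t)"
      by (rule C_diff_SucD(1)[OF Suc.prems])
    have "frechet_derivative h (at t) y = ?h' t * y" for y
      using linear_scale[OF has_derivative_linear[OF d], of y 1] by (simp add: mult.commute)
    then show ?thesis using d by (metis (no_types, lifting) ext)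
  qed
  show ?case
  proof (rule C_diff_SucI)
    fix x
    show "((\<lambda>x. h (x \<bullet> v + q)) has_derivative (\<lambda>y. ?h' (x \<bullet> v + q) * (y \<bullet> v))) (at x)"
      by (rule has_derivative_compose[OF _ h', where f = "\<lambda>x. x \<bullet> v + q"]) (auto intro!: derivative_eq_intros)
  next
    fix b :: 'a
    show "C_diff k (\<lambda>x. ?h' (x \<bullet> v + q) * (b \<bullet> v))"
      using C_diff_SucD(2)[OF Suc.prems, of 1] by (intro C_diff_mult C_diff_const Suc.IH) auto
  qed
qed

text \<open>The classical smooth function that vanishes to infinite order at the origin. The family
  \<open>exp (- 1 / t) / t ^ m\<close> is closed under differentiation, up to linear combinations.\<close>

definition flat :: "nat \<Rightarrow> real \<Rightarrow> real" where
  "flat m t = (if 0 < t then exp (- inverse t) * inverse t ^ m else 0)"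

lemma flat_tendsto_0: "(flat m \<longlongrightarrow> 0) (at 0)"
proof -
  have "((\<lambda>s::real. s ^ m / exp s) \<longlongrightarrow> 0) at_top"
    by (rule tendsto_power_div_exp_0)
  from filterlim_compose[OF this filterlim_inverse_at_top_right]
  have "((\<lambda>t. inverse t ^ m / exp (inverse t)) \<longlongrightarrow> 0) (at_right (0::real))" .
  moreover have "eventually (\<lambda>t. inverse t ^ m / exp (inverse t) = flat m t) (at_right 0)"
    by (auto simp: eventually_at_filter flat_def exp_minus field_simps)
  ultimately have right: "(flat m \<longlongrightarrow> 0) (at_right 0)"
    by (rule Lim_transform_eventually)
  have "(flat m \<longlongrightarrow> 0) (at_left 0)"
    by (rule tendsto_eventually) (auto simp: eventually_at_filter flat_def)
  with right show ?thesis by (simp add: filterlim_at_split)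
qed

lemma DERIV_flat: "(flat m has_real_derivative flat (m + 2) t - real m * flat (m + 1) t) (at t)"
proof -
  consider "t < 0" | "t = 0" | "0 < t" by linarith
  then show ?thesis
  proof cases
    case 1
    have "((\<lambda>_. 0) has_real_derivative 0) (at t)" by simp
    then have "(flat m has_real_derivative 0) (at t)"
      by (rule has_field_derivative_transform_within_open[of _ _ _ "{..<0}"])
         (use 1 in \<open>auto simp: flat_def\<close>)
    then show ?thesis using 1 by (simp add: flat_def)
  next
    case 2
    have "((\<lambda>h. (flat m (0 + h) - flat m 0) / h) \<longlongrightarrow> 0) (at 0)"
      using flat_tendsto_0[of "m + 1"]
    proof (rule Lim_transform_eventually)
      show "\<forall>\<^sub>F h in at 0. flat (m + 1) h = (flat m (0 + h) - flat m 0) / h"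
        by (auto simp: eventually_at_filter flat_def field_simps)
    qed
    then show ?thesis using 2 by (simp add: DERIV_def flat_def)
  next
    case 3
    have "((\<lambda>s. exp (- inverse s) * inverse s ^ m) has_real_derivative
        flat (m + 2) t - real m * flat (m + 1) t) (at t)"
    proof -
      have D: "((\<lambda>s. exp (- inverse s) * inverse s ^ m) has_real_derivative
          exp (- inverse t) * (inverse t * inverse t) * inverse t ^ m
          - exp (- inverse t) * (real m * inverse t ^ (m - 1) * (inverse t * inverse t))) (at t)"
        using 3 by (auto intro!: derivative_eq_intros simp: power2_eq_square algebra_simps)
      have eq: "real m * inverse t ^ (m - 1) * (inverse t * inverse t) = real m * inverse t ^ (m + 1)"
        by (cases m) auto
      show ?thesis
        using D[unfolded eq] 3 by (simp add: flat_def algebra_simps)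
    qed
    then show ?thesis
      by (rule has_field_derivative_transform_within_open[of _ _ _ "{0<..}"])
         (use 3 in \<open>auto simp: flat_def\<close>)
  qed
qed

lemma C_diff_flat: "C_diff k (flat m)"
proof (induction k arbitrary: m)
  case 0
  show ?case
    using DERIV_continuous[OF DERIV_flat] by (simp add: continuous_on_eq_continuous_at)
next
  case (Suc k)
  have "C_diff k (\<lambda>t. flat (m + 2) t + (- real m) * flat (m + 1) t)"
    by (intro C_diff_add C_diff_mult C_diff_const Suc.IH)
  then show ?case
    by (intro C_diff_real_SucI[OF DERIV_flat]) simp
qed

text \<open>A smooth transition \<open>\<Gamma>\<close> from 0 to 1 on the unit interval and its derivative \<open>\<beta>\<close>,
  which is then a bump function of mass one.\<close>

locale smooth_step =
  fixes \<Gamma> \<beta> :: "real \<Rightarrow> real" and K :: real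
  assumes C_diff_\<Gamma>: "C_diff k \<Gamma>" and C_diff_\<beta>: "C_diff k \<beta>"
    and DERIV_\<Gamma>: "(\<Gamma> has_real_derivative \<beta> t) (at t)"
    and \<beta>_nonneg: "0 \<le> \<beta> t" and \<beta>_le: "\<beta> t \<le> K" and K_ge: "1 \<le> K"
    and \<Gamma>_left: "t \<le> 0 \<Longrightarrow> \<Gamma> t = 0" and \<Gamma>_right: "1 \<le> t \<Longrightarrow> \<Gamma> t = 1"
    and \<beta>_outside: "t \<notin> {0<..<1} \<Longrightarrow> \<beta> t = 0"
    and \<Gamma>_bounds: "0 \<le> \<Gamma> t" "\<Gamma> t \<le> 1"

text \<open>Normalise an antiderivative of the bump \<open>flat 0 t * flat 0 (1 - t)\<close>.\<close>

lemma smooth_step_exists: "\<exists>\<Gamma> \<beta> K. smooth_step \<Gamma> \<beta> K"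
proof -
  define p where "p = (\<lambda>t. flat 0 t * flat 0 (1 - t))"
  have C_p: "C_diff k p" for k
  proof -
    have "C_diff k (\<lambda>t::real. flat 0 (t \<bullet> (- 1) + 1))"
      by (intro C_diff_compose_affine C_diff_flat)
    moreover have "(\<lambda>t::real. flat 0 (t \<bullet> (- 1) + 1)) = (\<lambda>t. flat 0 (1 - t))" by simp
    ultimately show ?thesis unfolding p_def by (intro C_diff_mult C_diff_flat) (simp add: inner_real_def)
  qed
  have p_pos: "0 < p t" if "0 < t" "t < 1" for t using that by (simp add: p_def flat_def)
  have p_out: "p t = 0" if "t \<notin> {0<..<1}" for t using that by (auto simp: p_def flat_def)
  have p_nonneg: "0 \<le> p t" for t by (simp add: p_def flat_def)
  have p_cont: "continuous_on UNIV p" using C_p[of 0] by simp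
  have "\<exists>P. \<forall>x. -\<infinity> < ereal x \<longrightarrow> ereal x < \<infinity> \<longrightarrow> (P has_vector_derivative p x) (at x)"
    by (rule einterval_antiderivative) (use p_cont in \<open>auto simp: continuous_on_eq_continuous_at\<close>)
  then obtain P where P: "\<And>t. (P has_real_derivative p t) (at t)"
    by (auto simp: has_real_derivative_iff_has_vector_derivative)
  have mono: "P s \<le> P t" if "s \<le> t" for s t
    by (rule DERIV_nonneg_imp_nondecreasing[OF that]) (use P p_nonneg in blast)
  have left: "P t = P 0" if "t \<le> 0" for t
  proof (cases "t = 0")
    case False
    show ?thesis
    proof (rule DERIV_isconst_end[of t 0 P, symmetric])
      show "t < 0" using that False by simp
      show "continuous_on {t..0} P"
        using P by (intro DERIV_continuous_on) (auto intro: has_field_derivative_at_within)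
      show "(P has_real_derivative 0) (at x)" if "t < x" "x < 0" for x
        using P[of x] p_out[of x] that by simp
    qed
  qed simp
  have right: "P t = P 1" if "1 \<le> t" for t
  proof (cases "t = 1")
    case False
    show ?thesis
    proof (rule DERIV_isconst_end[of 1 t P])
      show "1 < t" using that False by simp
      show "continuous_on {1..t} P"
        using P by (intro DERIV_continuous_on) (auto intro: has_field_derivative_at_within)
      show "(P has_real_derivative 0) (at x)" if "1 < x" "x < t" for x
        using P[of x] p_out[of x] that by simp
    qed
  qed simp
  have less: "P 0 < P 1"
  proof (rule DERIV_pos_imp_increasing_open[of 0 1 P])
    show "\<exists>y. (P has_real_derivative y) (at x) \<and> 0 < y" if "0 < x" "x < 1" for x
      using P p_pos that by blast
    show "continuous_on {0..1} P"
      using P by (intro DERIV_continuous_on) (auto intro: has_field_derivative_at_within)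
  qed simp
  define L where "L = P 1 - P 0"
  have L: "0 < L" using less by (simp add: L_def)
  have "bounded (p ` {0..1})"
    by (intro compact_imp_bounded compact_continuous_image continuous_on_subset[OF p_cont]) auto
  then obtain K0 where K0: "\<And>t. t \<in> {0..1} \<Longrightarrow> norm (p t) \<le> K0"
    unfolding bounded_iff by blast
  define \<beta> where "\<beta> = (\<lambda>t. p t * inverse L)"
  define \<Gamma> where "\<Gamma> = (\<lambda>t. (P t - P 0) * inverse L)"
  have D: "(\<Gamma> has_real_derivative \<beta> t) (at t)" for t
    unfolding \<Gamma>_def \<beta>_def by (rule derivative_eq_intros P refl | simp)+
  have C\<beta>: "C_diff k \<beta>" for k
    unfolding \<beta>_def by (intro C_diff_mult C_diff_const C_p)
  have "smooth_step \<Gamma> \<beta> (max 1 (K0 * inverse L))"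
  proof
    fix k t
    show "C_diff k \<Gamma>"
      using C_diff_Suc_imp[OF C_diff_real_SucI[OF D C\<beta>]] .
    show "\<beta> t \<le> max 1 (K0 * inverse L)"
    proof (cases "t \<in> {0..1}")
      case True
      then have "p t * inverse L \<le> K0 * inverse L"
        using K0[of t] L by (intro mult_right_mono) auto
      then show ?thesis by (simp add: \<beta>_def)
    next
      case False
      then have "t \<notin> {0<..<1}" by auto
      then show ?thesis using p_out[of t] by (simp add: \<beta>_def)
    qed
    show "0 \<le> \<Gamma> t" "\<Gamma> t \<le> 1"
      using mono[of t 0] mono[of 0 t] mono[of t 1] mono[of 1 t] left[of t] right[of t] L
      by (cases "t \<le> 0"; cases "1 \<le> t"; auto simp: \<Gamma>_def L_def field_simps)+
    show "C_diff k \<beta>" by (rule C\<beta>)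
    show "(\<Gamma> has_real_derivative \<beta> t) (at t)" by (rule D)
    show "0 \<le> \<beta> t" using p_nonneg L by (simp add: \<beta>_def)
    show "1 \<le> max 1 (K0 * inverse L)" by simp
    show "t \<le> 0 \<Longrightarrow> \<Gamma> t = 0" using left[of t] by (simp add: \<Gamma>_def)
    show "1 \<le> t \<Longrightarrow> \<Gamma> t = 1" using right[of t] L by (simp add: \<Gamma>_def L_def)
    show "t \<notin> {0<..<1} \<Longrightarrow> \<beta> t = 0" using p_out[of t] by (simp add: \<beta>_def)
  qed
  then show ?thesis by blast
qed

context smooth_step
begin

lemma nn_integral_\<beta>: "(\<integral>\<^sup>+t. ennreal (\<beta> t) \<partial>lborel) = 1"
proof -
  have cont: "continuous_on UNIV \<beta>" using C_diff_\<beta>[of 0] by simp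
  have "(\<integral>\<^sup>+t. ennreal (\<beta> t) \<partial>lborel) = (\<integral>\<^sup>+t. ennreal (\<beta> t) * indicator {0..1} t \<partial>lborel)"
    using \<beta>_outside by (intro nn_integral_cong) (auto split: split_indicator)
  also have "\<dots> = \<Gamma> 1 - \<Gamma> 0"
    using DERIV_\<Gamma> \<beta>_nonneg cont by (intro nn_integral_FTC_Icc) (auto intro: borel_measurable_continuous_onI has_field_derivative_at_within)
  finally show ?thesis by (simp add: \<Gamma>_left \<Gamma>_right)
qed

end

section \<open>Smooth averages of a function with a dominated weak gradient\<close>

text \<open>Only Borel representatives are averaged and translated below, so local integrability is
  needed in this form, with balls as exhausting sets.\<close>

definition locally_integrable_borel :: "('a::euclidean_space \<Rightarrow> real) \<Rightarrow> bool" where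
  "locally_integrable_borel f \<longleftrightarrow> f \<in> borel_measurable borel \<and>
     (\<forall>R. integrable lborel (\<lambda>z. indicat_real (cball 0 R) z * f z))"

lemma integrable_mult_bounded_support:
  fixes f g :: "'a::euclidean_space \<Rightarrow> real"
  assumes f: "locally_integrable_borel f" and [measurable]: "g \<in> borel_measurable borel"
    and bound: "\<And>z. \<bar>g z\<bar> \<le> C" and supp: "\<And>z. g z \<noteq> 0 \<Longrightarrow> z \<in> cball x R"
  shows "integrable lborel (\<lambda>z. f z * g z)"
proof (rule Bochner_Integration.integrable_bound)
  have [measurable]: "f \<in> borel_measurable borel" using f by (simp add: locally_integrable_borel_def)
  show "integrable lborel (\<lambda>z. C * (indicat_real (cball 0 (norm x + R)) z * f z))"
    using f by (intro integrable_mult_right) (simp add: locally_integrable_borel_def)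
  show "(\<lambda>z. f z * g z) \<in> borel_measurable lborel" by measurable
  show "AE z in lborel. norm (f z * g z) \<le> norm (C * (indicat_real (cball 0 (norm x + R)) z * f z))"
  proof (intro AE_I2)
    fix z
    show "norm (f z * g z) \<le> norm (C * (indicat_real (cball 0 (norm x + R)) z * f z))"
    proof (cases "g z = 0")
      case False
      have "dist x z \<le> R" using supp[OF False] by simp
      then have "norm z \<le> norm x + R"
        using norm_triangle_ineq[of x "z - x"] by (simp add: dist_norm norm_minus_commute)
      moreover have "\<bar>f z\<bar> * \<bar>g z\<bar> \<le> \<bar>f z\<bar> * \<bar>C\<bar>"
        using bound[of z] by (intro mult_left_mono) auto
      ultimately show ?thesis by (simp add: abs_mult mult.commute)
    qed simp
  qed
qed

lemma cball_of_coordinates: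
  fixes x z :: "'a::euclidean_space"
  assumes "\<And>b. b \<in> Basis \<Longrightarrow> \<bar>z \<bullet> b - x \<bullet> b\<bar> \<le> R"
  shows "z \<in> cball x (real DIM('a) * R)"
proof -
  have "norm (z - x) \<le> (\<Sum>b\<in>Basis. \<bar>(z - x) \<bullet> b\<bar>)" by (rule norm_le_l1)
  also have "\<dots> \<le> of_nat DIM('a) * R"
    using assms by (intro sum_bounded_above) (simp add: inner_diff_left)
  finally show ?thesis by (simp add: dist_norm norm_minus_commute)
qed

text \<open>Only the factor that depends on the coordinate \<open>b\<close> contributes.\<close>

lemma frechet_derivative_coordinate_product:
  fixes b :: "'a::euclidean_space" and g g' :: "real \<Rightarrow> real"
  assumes b: "b \<in> Basis" and g: "\<And>t. (g has_real_derivative g' t) (at t)"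
    and k: "\<And>i t. i \<in> Basis - {b} \<Longrightarrow> k i differentiable (at t)"
  shows "frechet_derivative (\<lambda>z. g (z \<bullet> b) * (\<Prod>i\<in>Basis - {b}. k i (z \<bullet> i))) (at z) b
    = g' (z \<bullet> b) * (\<Prod>i\<in>Basis - {b}. (k i (z \<bullet> i) :: real))"
proof -
  define k' where "k' = (\<lambda>i. deriv (k i))"
  have k': "\<And>i t. i \<in> Basis - {b} \<Longrightarrow> (k i has_real_derivative k' i t) (at t)"
    using k by (simp add: k'_def DERIV_deriv_iff_real_differentiable)
  have kd: "((\<lambda>z. k i (z \<bullet> i)) has_derivative (\<lambda>y. k' i (z \<bullet> i) * (y \<bullet> i))) (at z)"
    if "i \<in> Basis - {b}" for i
    using k'[OF that, of "z \<bullet> i", unfolded has_field_derivative_def]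
    by (intro has_derivative_compose[where f = "\<lambda>x. x \<bullet> i", of "\<lambda>y. y \<bullet> i" z UNIV "k i"])
       (auto intro!: derivative_eq_intros)
  have gd: "((\<lambda>z. g (z \<bullet> b)) has_derivative (\<lambda>y. g' (z \<bullet> b) * (y \<bullet> b))) (at z)"
    using g[of "z \<bullet> b", unfolded has_field_derivative_def]
    by (intro has_derivative_compose[where f = "\<lambda>x. x \<bullet> b", of "\<lambda>y. y \<bullet> b" z UNIV g])
       (auto intro!: derivative_eq_intros)
  have D: "((\<lambda>z. g (z \<bullet> b) * (\<Prod>i\<in>Basis - {b}. k i (z \<bullet> i))) has_derivative
      (\<lambda>y. g (z \<bullet> b) * (\<Sum>i\<in>Basis - {b}. k' i (z \<bullet> i) * (y \<bullet> i) * (\<Prod>j\<in>Basis - {b} - {i}. k j (z \<bullet> j)))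
        + g' (z \<bullet> b) * (y \<bullet> b) * (\<Prod>i\<in>Basis - {b}. k i (z \<bullet> i)))) (at z)"
    by (intro has_derivative_mult gd has_derivative_prod kd)
  have "(\<Sum>i\<in>Basis - {b}. k' i (z \<bullet> i) * (b \<bullet> i) * (\<Prod>j\<in>Basis - {b} - {i}. k j (z \<bullet> j))) = 0"
    using b by (intro sum.neutral) (auto simp: inner_Basis)
  then show ?thesis
    using b unfolding frechet_derivative_at[OF D, symmetric] by simp
qed

context smooth_step
begin

lemma borel_measurable_\<beta> [measurable]: "\<beta> \<in> borel_measurable borel"
  using C_diff_\<beta>[of 0] by (simp add: borel_measurable_continuous_onI)

text \<open>The position and the side length of the supporting box are separate for every coordinate, so that
  one coordinate of a kernel can be changed at a time.\<close>

definition kern :: "('a::euclidean_space \<Rightarrow> real) \<Rightarrow> ('a \<Rightarrow> real) \<Rightarrow> 'a \<Rightarrow> real" where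
  "kern p s z = (\<Prod>b\<in>Basis. \<beta> ((z \<bullet> b - p b) / s b) / s b)"

text \<open>The box that supports \<open>kern p s\<close> lies in the cube of centre \<open>x\<close> and half-side \<open>R\<close>, and its sides
  are not shorter than \<open>\<rho>\<close>, which bounds the kernel from above.\<close>

definition box_in_cube :: "'a::euclidean_space \<Rightarrow> real \<Rightarrow> real \<Rightarrow> ('a \<Rightarrow> real) \<Rightarrow> ('a \<Rightarrow> real) \<Rightarrow> bool" where
  "box_in_cube x R \<rho> p s \<longleftrightarrow>
     (\<forall>b\<in>Basis. \<rho> \<le> s b \<and> x \<bullet> b - R \<le> p b \<and> p b + s b \<le> x \<bullet> b + R)"

lemma borel_measurable_kern [measurable]: "kern p s \<in> borel_measurable borel"
  unfolding kern_def by measurable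

lemma \<beta>_support:
  assumes "0 < s" "\<beta> ((t - p) / s) \<noteq> 0"
  shows "p < t" "t < p + s"
  using \<beta>_outside[of "(t - p) / s"] assms by (auto simp: field_simps)

lemma kern_support:
  fixes z x :: "'a::euclidean_space"
  assumes "0 < \<rho>" "box_in_cube x R \<rho> p s" "kern p s z \<noteq> 0"
  shows "z \<in> cball x (real DIM('a) * R)"
proof (rule cball_of_coordinates)
  fix b :: 'a assume b: "b \<in> Basis"
  have "\<beta> ((z \<bullet> b - p b) / s b) \<noteq> 0" using assms(3) b by (auto simp: kern_def)
  moreover have "0 < s b" "x \<bullet> b - R \<le> p b" "p b + s b \<le> x \<bullet> b + R"
    using assms(1,2) b by (force simp: box_in_cube_def)+
  ultimately show "\<bar>z \<bullet> b - x \<bullet> b\<bar> \<le> R" using \<beta>_support[of "s b" "z \<bullet> b" "p b"] by auto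
qed

lemma kern_bounds:
  fixes z x :: "'a::euclidean_space"
  assumes "0 < \<rho>" "box_in_cube x R \<rho> p s"
  shows "0 \<le> kern p s z" "kern p s z \<le> (K / \<rho>) ^ DIM('a)"
proof -
  have s: "\<rho> \<le> s b" "0 < s b" if "b \<in> Basis" for b using assms that by (force simp: box_in_cube_def)+
  show "0 \<le> kern p s z"
    unfolding kern_def using s(2) \<beta>_nonneg by (intro prod_nonneg) (auto intro!: divide_nonneg_pos)
  have "kern p s z \<le> (\<Prod>b\<in>(Basis::'a set). K / \<rho>)"
    unfolding kern_def
  proof (intro prod_mono conjI)
    fix b :: 'a assume b: "b \<in> Basis"
    show "0 \<le> \<beta> ((z \<bullet> b - p b) / s b) / s b" using s(2)[OF b] \<beta>_nonneg by simp
    show "\<beta> ((z \<bullet> b - p b) / s b) / s b \<le> K / \<rho>"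
      using s[OF b] \<beta>_nonneg \<beta>_le K_ge assms(1) by (intro frac_le) auto
  qed
  then show "kern p s z \<le> (K / \<rho>) ^ DIM('a)" by simp
qed

lemma integrable_mult_kern:
  fixes f :: "'a::euclidean_space \<Rightarrow> real"
  assumes "locally_integrable_borel f" "0 < \<rho>" "box_in_cube x R \<rho> p s"
  shows "integrable lborel (\<lambda>z. f z * kern p s z)"
  by (rule integrable_mult_bounded_support[OF assms(1), where C = "(K / \<rho>) ^ DIM('a)" and x = x and R = "real DIM('a) * R"])
     (use kern_bounds[OF assms(2,3)] kern_support[OF assms(2,3)] in auto)

text \<open>Two product kernels that differ only in the coordinate \<open>b\<close> differ by the partial
  derivative of a test function, because the one-dimensional kernels have equal mass. So the weak
  gradient controls the difference of the corresponding averages.\<close>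

lemma kern_diff_one_coordinate:
  fixes f :: "'a::euclidean_space \<Rightarrow> real" and u :: "'a \<Rightarrow> ennreal"
  assumes f: "locally_integrable_borel f" and [measurable]: "u \<in> borel_measurable borel"
    and dom: "\<And>\<phi> b. test_function \<phi> \<Longrightarrow> b \<in> Basis \<Longrightarrow>
      ennreal \<bar>LINT z|lborel. f z * frechet_derivative \<phi> (at z) b\<bar> \<le> (\<integral>\<^sup>+z. u z * ennreal \<bar>\<phi> z\<bar> \<partial>lborel)"
    and \<rho>: "0 < \<rho>" and box: "box_in_cube x R \<rho> p s" "box_in_cube x R \<rho> p' s'"
    and b: "b \<in> Basis" and agree: "\<And>i. i \<in> Basis - {b} \<Longrightarrow> p i = p' i \<and> s i = s' i"
  shows "ennreal \<bar>(LINT z|lborel. f z * kern p s z) - (LINT z|lborel. f z * kern p' s' z)\<bar>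
    \<le> ennreal ((K / \<rho>) ^ (DIM('a) - 1)) * (\<integral>\<^sup>+z\<in>cball x (real DIM('a) * R). u z \<partial>lborel)"
proof -
  have s: "0 < s i" "0 < s' i" "\<rho> \<le> s i" if "i \<in> Basis" for i
    using box \<rho> that by (force simp: box_in_cube_def)+
  have cube: "x \<bullet> i - R \<le> p i" "p i + s i \<le> x \<bullet> i + R" "x \<bullet> i - R \<le> p' i" "p' i + s' i \<le> x \<bullet> i + R"
    if "i \<in> Basis" for i
    using box that by (auto simp: box_in_cube_def)
  \<comment> \<open>The antiderivative of the difference of the two one-dimensional kernels. It has compact support
    because both terms are 0 far to the left and 1 far to the right.\<close>
  define g where "g = (\<lambda>t. \<Gamma> ((t - p b) / s b) - \<Gamma> ((t - p' b) / s' b))"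
  define g' where "g' = (\<lambda>t. \<beta> ((t - p b) / s b) / s b - \<beta> ((t - p' b) / s' b) / s' b)"
  define k where "k = (\<lambda>i t. \<beta> ((t - p i) / s i) / s i)"
  define \<phi> where "\<phi> = (\<lambda>z. g (z \<bullet> b) * (\<Prod>i\<in>Basis - {b}. k i (z \<bullet> i)))"
  have g_deriv: "(g has_real_derivative g' t) (at t)" for t
    unfolding g_def g'_def
    by (rule derivative_eq_intros DERIV_chain2[OF DERIV_\<Gamma>] refl | use s[OF b] in simp)+
  have aff: "C_diff m (\<lambda>z::'a. h ((z \<bullet> i - q) / r))" if "C_diff m h" for m h i q r
  proof -
    have "C_diff m (\<lambda>z::'a. h (z \<bullet> (inverse r *\<^sub>R i) + - q / r))"
      by (rule C_diff_compose_affine[OF that])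
    then show ?thesis by (simp add: field_simps diff_divide_distrib inverse_eq_divide)
  qed
  have C_diff_\<phi>: "C_diff m \<phi>" for m
  proof -
    have "C_diff m (\<lambda>z. (\<Gamma> ((z \<bullet> b - p b) / s b) + (-1) * \<Gamma> ((z \<bullet> b - p' b) / s' b)) *
        (\<Prod>i\<in>Basis - {b}. inverse (s i) * \<beta> ((z \<bullet> i - p i) / s i)))"
      by (intro C_diff_mult C_diff_add C_diff_prod C_diff_const aff C_diff_\<Gamma> C_diff_\<beta>) auto
    then show ?thesis
      unfolding \<phi>_def g_def k_def by (simp add: divide_inverse mult.commute)
  qed
  have supp: "z \<in> cball x (real DIM('a) * R)" if "\<phi> z \<noteq> 0" for z
  proof (rule cball_of_coordinates)
    fix i :: 'a assume i: "i \<in> Basis"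
    show "\<bar>z \<bullet> i - x \<bullet> i\<bar> \<le> R"
    proof (cases "i = b")
      case True
      have gz: "g (z \<bullet> b) \<noteq> 0" using that by (auto simp: \<phi>_def)
      have "\<not> (z \<bullet> b \<le> p b \<and> z \<bullet> b \<le> p' b)"
      proof
        assume *: "z \<bullet> b \<le> p b \<and> z \<bullet> b \<le> p' b"
        then have "(z \<bullet> b - p b) / s b \<le> 0" "(z \<bullet> b - p' b) / s' b \<le> 0"
          using s[OF b] by (auto intro!: divide_nonpos_pos)
        then show False using gz by (simp add: g_def \<Gamma>_left)
      qed
      moreover have "\<not> (p b + s b \<le> z \<bullet> b \<and> p' b + s' b \<le> z \<bullet> b)"
      proof
        assume *: "p b + s b \<le> z \<bullet> b \<and> p' b + s' b \<le> z \<bullet> b"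
        then have "1 \<le> (z \<bullet> b - p b) / s b" "1 \<le> (z \<bullet> b - p' b) / s' b"
          using s[OF b] by auto
        then show False using gz by (simp add: g_def \<Gamma>_right)
      qed
      ultimately show ?thesis using cube[OF b] True by auto
    next
      case False
      then have "k i (z \<bullet> i) \<noteq> 0" using that i by (auto simp: \<phi>_def)
      then have "\<beta> ((z \<bullet> i - p i) / s i) \<noteq> 0" by (auto simp: k_def)
      then show ?thesis using \<beta>_support[of "s i" "z \<bullet> i" "p i"] s[OF i] cube[OF i] by auto
    qed
  qed
  have bound: "\<bar>\<phi> z\<bar> \<le> (K / \<rho>) ^ (DIM('a) - 1)" for z
  proof -
    have "\<bar>\<Prod>i\<in>Basis - {b}. k i (z \<bullet> i)\<bar> \<le> (\<Prod>i\<in>Basis - {b}. K / \<rho>)"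
      unfolding abs_prod
    proof (intro prod_mono conjI)
      fix i :: 'a assume "i \<in> Basis - {b}"
      then have i: "i \<in> Basis" by simp
      show "\<bar>k i (z \<bullet> i)\<bar> \<le> K / \<rho>"
        using s[OF i] \<beta>_nonneg \<beta>_le K_ge \<rho> unfolding k_def by (simp add: frac_le)
    qed simp
    also have "\<dots> = (K / \<rho>) ^ (DIM('a) - 1)" using b by simp
    finally have 1: "\<bar>\<Prod>i\<in>Basis - {b}. k i (z \<bullet> i)\<bar> \<le> (K / \<rho>) ^ (DIM('a) - 1)" .
    have 2: "\<bar>g t\<bar> \<le> 1" for t
      using \<Gamma>_bounds[of "(t - p b) / s b"] \<Gamma>_bounds[of "(t - p' b) / s' b"] by (simp add: g_def abs_le_iff)
    show ?thesis
      using mult_mono[OF 2 1] by (simp add: \<phi>_def abs_mult)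
  qed
  have test: "test_function \<phi>"
  proof -
    have "closure {z. \<phi> z \<noteq> 0} \<subseteq> cball x (real DIM('a) * R)"
      using supp by (intro closure_minimal) auto
    then have "compact (closure {z. \<phi> z \<noteq> 0})"
      by (meson bounded_cball bounded_subset closed_closure compact_eq_bounded_closed)
    then show ?thesis using C_diff_\<phi> by (simp add: test_function_def)
  qed
  have split: "kern q r z = \<beta> ((z \<bullet> b - q b) / r b) / r b * (\<Prod>i\<in>Basis - {b}. \<beta> ((z \<bullet> i - q i) / r i) / r i)" for q r z
    unfolding kern_def using b by (subst prod.remove[of _ b]) auto
  have deriv: "frechet_derivative \<phi> (at z) b = kern p s z - kern p' s' z" for z
  proof -
    have "(\<lambda>z. k i z) differentiable at t" if "i \<in> Basis - {b}" for i t
    proof -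
      have "(\<lambda>z. \<beta> ((z \<bullet> 1 - p i) / s i)) differentiable at t"
      proof -
        have "C_diff 1 (\<lambda>z::real. \<beta> (z \<bullet> (inverse (s i)) + - p i / s i))"
          by (rule C_diff_compose_affine[OF C_diff_\<beta>])
        then show ?thesis by (simp add: differentiable_on_def field_simps diff_divide_distrib)
      qed
      then show ?thesis unfolding k_def by (simp add: divide_inverse)
    qed
    from frechet_derivative_coordinate_product[OF b g_deriv this]
    have "frechet_derivative \<phi> (at z) b = g' (z \<bullet> b) * (\<Prod>i\<in>Basis - {b}. k i (z \<bullet> i))"
      unfolding \<phi>_def by simp
    also have "\<dots> = kern p s z - kern p' s' z"
    proof -
      have "(\<Prod>i\<in>Basis - {b}. \<beta> ((z \<bullet> i - p' i) / s' i) / s' i) = (\<Prod>i\<in>Basis - {b}. k i (z \<bullet> i))"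
        using agree by (intro prod.cong) (auto simp: k_def)
      then show ?thesis
        unfolding split g'_def k_def by (simp add: left_diff_distrib)
    qed
    finally show ?thesis .
  qed
  have "(LINT z|lborel. f z * kern p s z) - (LINT z|lborel. f z * kern p' s' z)
      = (LINT z|lborel. f z * frechet_derivative \<phi> (at z) b)"
    unfolding deriv right_diff_distrib
    by (intro Bochner_Integration.integral_diff[symmetric] integrable_mult_kern[OF f \<rho> box(1)]
        integrable_mult_kern[OF f \<rho> box(2)])
  also have "ennreal \<bar>\<dots>\<bar> \<le> (\<integral>\<^sup>+z. u z * ennreal \<bar>\<phi> z\<bar> \<partial>lborel)"
    by (rule dom[OF test b])
  also have "\<dots> \<le> (\<integral>\<^sup>+z. ennreal ((K / \<rho>) ^ (DIM('a) - 1)) * (u z * indicator (cball x (real DIM('a) * R)) z) \<partial>lborel)"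
  proof (rule nn_integral_mono)
    fix z
    show "u z * ennreal \<bar>\<phi> z\<bar> \<le> ennreal ((K / \<rho>) ^ (DIM('a) - 1)) * (u z * indicator (cball x (real DIM('a) * R)) z)"
    proof (cases "\<phi> z = 0")
      case False
      then show ?thesis
        using supp[of z] bound[of z] by (simp add: mult.commute mult_left_mono ennreal_leI)
    qed simp
  qed
  moreover have [measurable]: "cball x (real DIM('a) * R) \<in> sets borel" by simp
  have "(\<integral>\<^sup>+z. ennreal ((K / \<rho>) ^ (DIM('a) - 1)) * (u z * indicator (cball x (real DIM('a) * R)) z) \<partial>lborel)
      = ennreal ((K / \<rho>) ^ (DIM('a) - 1)) * (\<integral>\<^sup>+z\<in>cball x (real DIM('a) * R). u z \<partial>lborel)"
    by (rule nn_integral_cmult) measurable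
  ultimately show ?thesis by simp
qed

text \<open>Changing the coordinates one at a time connects any two kernels.\<close>

lemma kern_diff:
  fixes f :: "'a::euclidean_space \<Rightarrow> real" and u :: "'a \<Rightarrow> ennreal"
  assumes f: "locally_integrable_borel f" and u: "u \<in> borel_measurable borel"
    and dom: "\<And>\<phi> b. test_function \<phi> \<Longrightarrow> b \<in> Basis \<Longrightarrow>
      ennreal \<bar>LINT z|lborel. f z * frechet_derivative \<phi> (at z) b\<bar> \<le> (\<integral>\<^sup>+z. u z * ennreal \<bar>\<phi> z\<bar> \<partial>lborel)"
    and \<rho>: "0 < \<rho>" and box: "box_in_cube x R \<rho> p s" "box_in_cube x R \<rho> p' s'"
  shows "ennreal \<bar>(LINT z|lborel. f z * kern p s z) - (LINT z|lborel. f z * kern p' s' z)\<bar>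
    \<le> ennreal (real DIM('a) * (K / \<rho>) ^ (DIM('a) - 1)) * (\<integral>\<^sup>+z\<in>cball x (real DIM('a) * R). u z \<partial>lborel)"
proof -
  define c where "c = ennreal ((K / \<rho>) ^ (DIM('a) - 1)) * (\<integral>\<^sup>+z\<in>cball x (real DIM('a) * R). u z \<partial>lborel)"
  define I where "I = (\<lambda>B. LINT z|lborel. f z *
      kern (\<lambda>i. if i \<in> B then p i else p' i) (\<lambda>i. if i \<in> B then s i else s' i) z)"
  have "ennreal \<bar>I B - I {}\<bar> \<le> of_nat (card B) * c" if "finite B" "B \<subseteq> Basis" for B
    using that
  proof (induction B rule: finite_induct)
    case (insert b B)
    have "ennreal \<bar>I (insert b B) - I B\<bar> \<le> c"
      unfolding I_def c_def
      by (rule kern_diff_one_coordinate[OF f u dom \<rho>, where b = b])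
         (use box insert in \<open>auto simp: box_in_cube_def\<close>)
    then have "ennreal \<bar>I (insert b B) - I B\<bar> + ennreal \<bar>I B - I {}\<bar> \<le> c + of_nat (card B) * c"
      using insert by (intro add_mono) auto
    moreover have "ennreal \<bar>I (insert b B) - I {}\<bar> \<le> ennreal \<bar>I (insert b B) - I B\<bar> + ennreal \<bar>I B - I {}\<bar>"
      by (simp flip: ennreal_plus add: ennreal_leI)
    ultimately show ?case
      using insert by (simp add: distrib_right)
  qed simp
  from this[of Basis] have "ennreal \<bar>I Basis - I {}\<bar> \<le> of_nat DIM('a) * c" by simp
  moreover have "I Basis = (LINT z|lborel. f z * kern p s z)" "I {} = (LINT z|lborel. f z * kern p' s' z)"
    unfolding I_def kern_def by (auto intro!: Bochner_Integration.integral_cong)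
  moreover have "of_nat DIM('a) * c = ennreal (real DIM('a) * (K / \<rho>) ^ (DIM('a) - 1)) * (\<integral>\<^sup>+z\<in>cball x (real DIM('a) * R). u z \<partial>lborel)"
    using K_ge \<rho> by (simp add: c_def ennreal_mult mult.assoc flip: ennreal_of_nat_eq_real_of_nat)
  ultimately show ?thesis by simp
qed

definition average :: "('a::euclidean_space \<Rightarrow> real) \<Rightarrow> real \<Rightarrow> 'a \<Rightarrow> real" where
  "average f r x = (LINT z|lborel. f z * kern (\<lambda>b. x \<bullet> b) (\<lambda>_. r) z)"

text \<open>The factor from \<open>kern_diff\<close> at \<open>\<rho> = r / 2\<close>, times the volume of a ball of radius
  \<open>3 * DIM('a) * r\<close>, is this constant times \<open>r\<close>.\<close>

definition average_const :: "'a::euclidean_space itself \<Rightarrow> real" where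
  "average_const _ = real DIM('a) * (2 * K) ^ (DIM('a) - 1) * (unit_ball_vol (real DIM('a)) * (3 * real DIM('a)) ^ DIM('a))"

lemma average_const_pos: "0 < average_const TYPE('a::euclidean_space)"
  using K_ge unit_ball_vol_pos[of "real DIM('a)"] by (simp add: average_const_def)

text \<open>Both supporting cubes lie in a ball around \<open>x\<close> with radius comparable to \<open>r\<close>, and their sides are
  comparable to \<open>r\<close>. So the powers of \<open>r\<close> cancel up to one factor.\<close>

lemma average_diff:
  fixes f :: "'a::euclidean_space \<Rightarrow> real" and u :: "'a \<Rightarrow> ennreal"
  assumes f: "locally_integrable_borel f" and u: "u \<in> borel_measurable borel"
    and dom: "\<And>\<phi> b. test_function \<phi> \<Longrightarrow> b \<in> Basis \<Longrightarrow>
      ennreal \<bar>LINT z|lborel. f z * frechet_derivative \<phi> (at z) b\<bar> \<le> (\<integral>\<^sup>+z. u z * ennreal \<bar>\<phi> z\<bar> \<partial>lborel)"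
    and r: "0 < r" "r / 2 \<le> s" "s \<le> r" "dist x y \<le> r"
    and fin: "maximal_function u x < \<infinity>"
  shows "\<bar>average f r x - average f s y\<bar>
    \<le> average_const TYPE('a) * r * enn2real (maximal_function u x)"
proof -
  define n where "n = DIM('a)"
  define V where "V = unit_ball_vol (real n)"
  define m where "m = enn2real (maximal_function u x)"
  have m: "maximal_function u x = ennreal m" "0 \<le> m" using fin by (auto simp: m_def)
  have n: "1 \<le> n" by (simp add: n_def Suc_le_eq)
  have near: "\<bar>x \<bullet> b - y \<bullet> b\<bar> \<le> r" if "b \<in> Basis" for b
  proof -
    have "\<bar>(x - y) \<bullet> b\<bar> \<le> norm (x - y)" using that by (rule Basis_le_norm)
    then show ?thesis using r by (simp add: dist_norm inner_diff_left)
  qed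
  have "ennreal \<bar>average f r x - average f s y\<bar>
      \<le> ennreal (real DIM('a) * (K / (r / 2)) ^ (DIM('a) - 1)) * (\<integral>\<^sup>+z\<in>cball x (real DIM('a) * (2 * r)). u z \<partial>lborel)"
    unfolding average_def
  proof (rule kern_diff[OF f u dom])
    show "box_in_cube x (2 * r) (r / 2) ((\<bullet>) x) (\<lambda>_. r)"
      using r(1) by (auto simp: box_in_cube_def)
    show "box_in_cube x (2 * r) (r / 2) ((\<bullet>) y) (\<lambda>_. s)"
      unfolding box_in_cube_def
    proof (intro ballI conjI)
      fix b :: 'a assume "b \<in> Basis"
      from near[OF this] show "x \<bullet> b - 2 * r \<le> y \<bullet> b" "y \<bullet> b + s \<le> x \<bullet> b + 2 * r"
        using r by auto
    qed (use r in auto)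
  qed (use r in auto)
  also have "(\<integral>\<^sup>+z\<in>cball x (real DIM('a) * (2 * r)). u z \<partial>lborel) \<le> (\<integral>\<^sup>+z\<in>ball x (3 * real n * r). u z \<partial>lborel)"
  proof (intro nn_integral_mono mult_left_mono)
    have "real n * (2 * r) < 3 * real n * r" using n r(1) by simp
    then have "cball x (real n * (2 * r)) \<subseteq> ball x (3 * real n * r)"
      unfolding subset_iff mem_cball mem_ball by (meson order_le_less_trans)
    then show "indicator (cball x (real DIM('a) * (2 * r))) z \<le> (indicator (ball x (3 * real n * r)) z :: ennreal)" for z
      by (auto simp: n_def split: split_indicator)
  qed simp
  also have "\<dots> \<le> maximal_function u x * emeasure lborel (ball x (3 * real n * r))"
    by (rule maximal_function_upper) (use n r in simp)
  also have "\<dots> = ennreal (m * (V * (3 * real n * r) ^ n))"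
    using r unit_ball_vol_nonneg[of "real DIM('a)"]
    by (simp add: m emeasure_ball V_def n_def ennreal_mult)
  finally have "ennreal \<bar>average f r x - average f s y\<bar>
      \<le> ennreal (real n * (K / (r / 2)) ^ (n - 1)) * ennreal (m * (V * (3 * real n * r) ^ n))"
    by (simp add: n_def mult_left_mono)
  also have "\<dots> = ennreal (real n * (K / (r / 2)) ^ (n - 1) * (m * (V * (3 * real n * r) ^ n)))"
    using K_ge r m n unit_ball_vol_nonneg[of "real n"] by (intro ennreal_mult[symmetric]) (auto simp: V_def)
  also have "real n * (K / (r / 2)) ^ (n - 1) * (m * (V * (3 * real n * r) ^ n)) = average_const TYPE('a) * r * m"
  proof -
    obtain j where j: "n = Suc j" using n by (cases n) auto
    have "(K / (r / 2)) ^ j * r ^ j = (K / (r / 2) * r) ^ j"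
      by (rule power_mult_distrib[symmetric])
    also have "K / (r / 2) * r = 2 * K" using r(1) by simp
    finally have scale: "(K / (r / 2)) ^ j * r ^ j = (2 * K) ^ j" .
    have "(3 * real n * r) ^ n = (3 * real n) ^ n * (r ^ j * r)"
      unfolding power_mult_distrib by (simp add: j)
    then have "real n * (K / (r / 2)) ^ j * (m * (V * (3 * real n * r) ^ n))
        = real n * ((K / (r / 2)) ^ j * r ^ j) * (V * (3 * real n) ^ n) * r * m"
      by simp
    then show ?thesis
      unfolding average_const_def n_def[symmetric] V_def[symmetric] scale by (simp add: j)
  qed
  finally show ?thesis
    using average_const_pos[where 'a='a] r m by (simp add: m_def[symmetric] ennreal_le_iff)
qed

text \<open>Halving the radius repeatedly gives a geometric series.\<close>

lemma average_diff_radii: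
  fixes f :: "'a::euclidean_space \<Rightarrow> real" and u :: "'a \<Rightarrow> ennreal"
  assumes f: "locally_integrable_borel f" and u: "u \<in> borel_measurable borel"
    and dom: "\<And>\<phi> b. test_function \<phi> \<Longrightarrow> b \<in> Basis \<Longrightarrow>
      ennreal \<bar>LINT z|lborel. f z * frechet_derivative \<phi> (at z) b\<bar> \<le> (\<integral>\<^sup>+z. u z * ennreal \<bar>\<phi> z\<bar> \<partial>lborel)"
    and fin: "maximal_function u x < \<infinity>"
    and "0 < r" "r / 2 ^ k \<le> s" "s \<le> r"
  shows "\<bar>average f r x - average f s x\<bar>
    \<le> 2 * average_const TYPE('a) * r * enn2real (maximal_function u x)"
  using assms(5-)
proof (induction k arbitrary: r)
  case (Suc k)
  note step = average_diff[OF f u dom \<open>0 < r\<close> _ _ _ fin, of _ x]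
  let ?m = "average_const TYPE('a) * r * enn2real (maximal_function u x)"
  have nonneg: "0 \<le> ?m"
    using average_const_pos[where 'a='a] Suc.prems(1) by simp
  show ?case
  proof (cases "r / 2 \<le> s")
    case True
    then have "\<bar>average f r x - average f s x\<bar> \<le> ?m"
      using Suc.prems by (intro step) auto
    then show ?thesis using nonneg by simp
  next
    case False
    have "\<bar>average f r x - average f (r / 2) x\<bar> \<le> ?m"
      using Suc.prems by (intro step) auto
    moreover have "\<bar>average f (r / 2) x - average f s x\<bar>
        \<le> 2 * average_const TYPE('a) * (r / 2) * enn2real (maximal_function u x)"
      using Suc.prems False by (intro Suc.IH) auto
    ultimately show ?thesis by (simp add: algebra_simps)
  qed
next
  case 0
  then show ?case using average_const_pos[where 'a='a] by simp
qed

text \<open>Pass from \<open>f x\<close> to the average at \<open>x\<close> of scale \<open>dist x y\<close>, from there to the average at \<open>y\<close>, and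
  from there to \<open>f y\<close>. It suffices that averages of some arbitrarily small scales approximate the
  values of \<open>f\<close>.\<close>

theorem pointwise_estimate:
  fixes f :: "'a::euclidean_space \<Rightarrow> real" and u :: "'a \<Rightarrow> ennreal"
  assumes f: "locally_integrable_borel f" and u: "u \<in> borel_measurable borel"
    and dom: "\<And>\<phi> b. test_function \<phi> \<Longrightarrow> b \<in> Basis \<Longrightarrow>
      ennreal \<bar>LINT z|lborel. f z * frechet_derivative \<phi> (at z) b\<bar> \<le> (\<integral>\<^sup>+z. u z * ennreal \<bar>\<phi> z\<bar> \<partial>lborel)"
    and fin: "maximal_function u x < \<infinity>" "maximal_function u y < \<infinity>"
    and leb: "\<And>e. 0 < e \<Longrightarrow> \<exists>r>0. r < e \<and> \<bar>average f r x - f x\<bar> \<le> e"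
      "\<And>e. 0 < e \<Longrightarrow> \<exists>r>0. r < e \<and> \<bar>average f r y - f y\<bar> \<le> e"
  shows "\<bar>f x - f y\<bar> \<le> 3 * average_const TYPE('a) * dist x y *
    (enn2real (maximal_function u x) + enn2real (maximal_function u y))"
proof (cases "x = y")
  case False
  define r where "r = dist x y"
  have r: "0 < r" using False by (simp add: r_def)
  have approx: "\<bar>average f r x - f x\<bar> \<le> 2 * average_const TYPE('a) * r * enn2real (maximal_function u x)"
    if fin: "maximal_function u x < \<infinity>"
      and leb: "\<And>e. 0 < e \<Longrightarrow> \<exists>r>0. r < e \<and> \<bar>average f r x - f x\<bar> \<le> e" for x
  proof (rule field_le_epsilon)
    fix e :: real assume e: "0 < e"
    obtain s where s: "0 < s" "s < min e r" "\<bar>average f s x - f x\<bar> \<le> min e r"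
      using leb[of "min e r"] e r by auto
    obtain k where "r / s < 2 ^ k" using real_arch_pow[of 2 "r / s"] by auto
    then have "r / 2 ^ k \<le> s" using s(1) by (simp add: field_simps)
    then have "\<bar>average f r x - average f s x\<bar> \<le> 2 * average_const TYPE('a) * r * enn2real (maximal_function u x)"
      using s by (intro average_diff_radii[OF f u dom fin r]) auto
    then show "\<bar>average f r x - f x\<bar> \<le> 2 * average_const TYPE('a) * r * enn2real (maximal_function u x) + e"
      using s(3) by linarith
  qed
  have mid: "\<bar>average f r x - average f r y\<bar> \<le> average_const TYPE('a) * r * enn2real (maximal_function u x)"
    by (rule average_diff[OF f u dom r _ _ _ fin(1)]) (use r in \<open>auto simp: r_def\<close>)
  have "0 \<le> average_const TYPE('a) * r * enn2real (maximal_function u y)"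
    using average_const_pos[where 'a='a] r by simp
  then have "\<bar>f x - f y\<bar> \<le> 3 * (average_const TYPE('a) * r * enn2real (maximal_function u x))
      + 3 * (average_const TYPE('a) * r * enn2real (maximal_function u y))"
    using approx[OF fin(1) leb(1)] approx[OF fin(2) leb(2)] mid by linarith
  then show ?thesis by (simp add: r_def algebra_simps)
qed simp

text \<open>The kernels form an approximate identity.\<close>

lemma nn_integral_kern:
  fixes x :: "'a::euclidean_space"
  assumes r: "0 < r"
  shows "(\<integral>\<^sup>+z. ennreal (kern (\<lambda>b. x \<bullet> b) (\<lambda>_. r) z) \<partial>lborel) = 1"
proof -
  have "(\<integral>\<^sup>+z. ennreal (kern (\<lambda>b. x \<bullet> b) (\<lambda>_. r) z) \<partial>lborel)
      = (\<integral>\<^sup>+z. (\<Prod>b\<in>Basis. ennreal (\<beta> ((z \<bullet> b - x \<bullet> b) / r) / r)) \<partial>lborel)"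
    unfolding kern_def using r \<beta>_nonneg by (subst prod_ennreal) auto
  also have "\<dots> = (\<Prod>b\<in>Basis. (\<integral>\<^sup>+t. ennreal (\<beta> ((t - x \<bullet> b) / r) / r) \<partial>lborel))"
    by (rule nn_integral_lborel_prod) auto
  also have "\<dots> = (\<Prod>b\<in>(Basis :: 'a set). 1)"
  proof (rule prod.cong)
    fix b :: 'a
    have "(\<integral>\<^sup>+t. ennreal (\<beta> ((t - x \<bullet> b) / r) / r) \<partial>lborel)
        = ennreal \<bar>r\<bar> * (\<integral>\<^sup>+t. ennreal (\<beta> ((x \<bullet> b + r * t - x \<bullet> b) / r) / r) \<partial>lborel)"
      by (rule nn_integral_real_affine) (use r in auto)
    also have "\<dots> = (\<integral>\<^sup>+t. ennreal (\<beta> t) \<partial>lborel)"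
      using r \<beta>_nonneg by (subst nn_integral_cmult[symmetric]) (auto simp flip: ennreal_mult)
    finally show "(\<integral>\<^sup>+t. ennreal (\<beta> ((t - x \<bullet> b) / r) / r) \<partial>lborel) = 1"
      by (simp add: nn_integral_\<beta>)
  qed simp
  finally show ?thesis by simp
qed

lemma box_in_cube_cube: "0 < r \<Longrightarrow> box_in_cube x r r ((\<bullet>) x) (\<lambda>_. r)"
  by (auto simp: box_in_cube_def)

lemma kern_translate: "kern ((\<bullet>) x) s (h + x) = kern (\<lambda>_. 0) s h"
  by (simp add: kern_def inner_add_left)

lemma average_minus_le:
  fixes f :: "'a::euclidean_space \<Rightarrow> real"
  assumes f: "locally_integrable_borel f" and r: "0 < r"
  shows "ennreal \<bar>average f r x - f x\<bar>
    \<le> (\<integral>\<^sup>+z. ennreal (\<bar>f z - f x\<bar> * kern (\<lambda>b. x \<bullet> b) (\<lambda>_. r) z) \<partial>lborel)"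
proof -
  have nonneg: "0 \<le> kern (\<lambda>b. x \<bullet> b) (\<lambda>_. r) z" for z
    by (rule kern_bounds[OF r box_in_cube_cube[OF r]])
  have int: "integrable lborel (\<lambda>z. f z * kern (\<lambda>b. x \<bullet> b) (\<lambda>_. r) z)"
    by (rule integrable_mult_kern[OF f r box_in_cube_cube[OF r]])
  have int1: "integrable lborel (kern (\<lambda>b. x \<bullet> b) (\<lambda>_. r))"
    using nn_integral_kern[OF r, of x] nonneg by (intro integrableI_nonneg) auto
  have "(LINT z|lborel. kern (\<lambda>b. x \<bullet> b) (\<lambda>_. r) z) = 1"
    using nn_integral_kern[OF r, of x] nonneg by (subst integral_eq_nn_integral) auto
  then have "average f r x - f x = (LINT z|lborel. (f z - f x) * kern (\<lambda>b. x \<bullet> b) (\<lambda>_. r) z)"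
    using int int1 by (simp add: average_def left_diff_distrib)
  moreover have "ennreal (norm (LINT z|lborel. (f z - f x) * kern (\<lambda>b. x \<bullet> b) (\<lambda>_. r) z))
      \<le> (\<integral>\<^sup>+z. ennreal (norm ((f z - f x) * kern (\<lambda>b. x \<bullet> b) (\<lambda>_. r) z)) \<partial>lborel)"
    by (rule integral_norm_bound_ennreal) (use int int1 in \<open>simp add: left_diff_distrib\<close>)
  ultimately show ?thesis using nonneg by (simp add: abs_mult)
qed

text \<open>Averages over shrinking cubes converge to the function in the mean on bounded sets, by
  continuity of translations. Fatou's lemma then gives convergence along a subsequence at almost
  every point, which is all that the telescoping estimate needs.\<close>

theorem average_approximates_AE:
  fixes f :: "'a::euclidean_space \<Rightarrow> real"
  assumes f: "locally_integrable_borel f"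
  shows "AE x in lborel. \<forall>e>0. \<exists>r>0. r < e \<and> \<bar>average f r x - f x\<bar> \<le> e"
proof -
  have "AE x in lborel. x \<in> ball 0 (real N) \<longrightarrow> (\<forall>e>0. \<exists>r>0. r < e \<and> \<bar>average f r x - f x\<bar> \<le> e)" for N :: nat
  proof -
    define n where "n = real DIM('a)"
    \<comment> \<open>On the ball the averages of scale at most one only see \<open>f\<close> on a larger ball, where it is
      integrable.\<close>
    define w where "w = (\<lambda>z. indicat_real (cball 0 (real N + n)) z * f z)"
    define \<rho> where "\<rho> = (\<lambda>k. inverse (real (Suc k)))"
    define D where "D = (\<lambda>k x. \<integral>\<^sup>+h. ennreal (\<bar>w (h + x) - w x\<bar> * kern (\<lambda>_. 0) (\<lambda>_. \<rho> k) h) \<partial>lborel)"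
    have n: "0 < n" by (simp add: n_def)
    have \<rho>: "0 < \<rho> k" "\<rho> k \<le> 1" for k by (auto simp: \<rho>_def inverse_eq_divide)
    have w: "integrable lborel w" using f by (simp add: w_def locally_integrable_borel_def)
    then have [measurable]: "w \<in> borel_measurable borel" by (auto dest: borel_measurable_integrable)
    have [measurable]: "f \<in> borel_measurable borel" using f by (simp add: locally_integrable_borel_def)
    have box0: "box_in_cube (0::'a) (\<rho> k) (\<rho> k) (\<lambda>_. 0) (\<lambda>_. \<rho> k)" for k
      using \<rho>[of k] by (auto simp: box_in_cube_def)
    have kern0_nonneg: "0 \<le> kern (\<lambda>_. 0) (\<lambda>_. \<rho> k) (h::'a)" for k h
      by (rule kern_bounds[OF \<rho>(1) box0])
    have kern0_supp: "norm h \<le> n * \<rho> k" if "kern (\<lambda>_. 0) (\<lambda>_. \<rho> k) (h::'a) \<noteq> 0" for k h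
      using kern_support[OF \<rho>(1) box0 that] by (simp add: n_def)
    have local: "ennreal \<bar>average f (\<rho> k) x - f x\<bar> \<le> D k x" if x: "x \<in> ball 0 (real N)" for k x
    proof -
      have "ennreal \<bar>average f (\<rho> k) x - f x\<bar>
          \<le> (\<integral>\<^sup>+z. ennreal (\<bar>f z - f x\<bar> * kern ((\<bullet>) x) (\<lambda>_. \<rho> k) z) \<partial>lborel)"
        by (rule average_minus_le[OF f \<rho>(1)])
      also have "\<dots> = (\<integral>\<^sup>+h. ennreal (\<bar>f (h + x) - f x\<bar> * kern ((\<bullet>) x) (\<lambda>_. \<rho> k) (h + x)) \<partial>lborel)"
        by (rule nn_integral_lborel_translate[symmetric]) measurable
      also have "\<dots> = D k x"
        unfolding D_def kern_translate
      proof (intro nn_integral_cong)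
        fix h :: 'a
        show "ennreal (\<bar>f (h + x) - f x\<bar> * kern (\<lambda>_. 0) (\<lambda>_. \<rho> k) h)
            = ennreal (\<bar>w (h + x) - w x\<bar> * kern (\<lambda>_. 0) (\<lambda>_. \<rho> k) h)"
        proof (cases "kern (\<lambda>_. 0) (\<lambda>_. \<rho> k) h = 0")
          case False
          have "norm (h + x) \<le> norm h + norm x" by (rule norm_triangle_ineq)
          also have "\<dots> \<le> n * \<rho> k + real N" using kern0_supp[OF False] x by simp
          also have "n * \<rho> k \<le> n * 1" using n \<rho>(2) by (intro mult_left_mono) auto
          finally have "norm (h + x) \<le> real N + n" by simp
          moreover have "norm x \<le> real N + n" using x n by simp
          ultimately show ?thesis by (simp add: w_def)
        qed simp
      qed
      finally show ?thesis .
    qed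
    have lim: "(\<lambda>k. \<integral>\<^sup>+x. D k x \<partial>lborel) \<longlonglongrightarrow> 0"
    proof (rule ennreal_tendsto_0I)
      fix e :: real assume e: "0 < e"
      obtain d where d: "0 < d"
        "\<And>h. norm h < d \<Longrightarrow> (\<integral>\<^sup>+x. ennreal \<bar>w (x + h) - w x\<bar> \<partial>lborel) \<le> ennreal e"
        using translation_continuous_uniform[OF L1_translation_continuous[OF w] e] by blast
      have "(\<lambda>k. n * \<rho> k) \<longlonglongrightarrow> n * 0"
        unfolding \<rho>_def by (intro tendsto_intros LIMSEQ_inverse_real_of_nat)
      then have "eventually (\<lambda>k. n * \<rho> k < d) sequentially"
        using d(1) by (intro order_tendstoD) auto
      then show "eventually (\<lambda>k. (\<integral>\<^sup>+x. D k x \<partial>lborel) \<le> ennreal e) sequentially"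
      proof eventually_elim
        case (elim k)
        have "(\<integral>\<^sup>+x. D k x \<partial>lborel)
            = (\<integral>\<^sup>+h. (\<integral>\<^sup>+x. ennreal (\<bar>w (h + x) - w x\<bar> * kern (\<lambda>_. 0) (\<lambda>_. \<rho> k) h) \<partial>lborel) \<partial>lborel)"
          unfolding D_def by (rule lborel_pair.Fubini'[symmetric]) measurable
        also have "\<dots> \<le> (\<integral>\<^sup>+h. ennreal e * ennreal (kern (\<lambda>_. 0) (\<lambda>_. \<rho> k) (h::'a)) \<partial>lborel)"
        proof (rule nn_integral_mono)
          fix h :: 'a
          have "(\<integral>\<^sup>+x. ennreal (\<bar>w (h + x) - w x\<bar> * kern (\<lambda>_. 0) (\<lambda>_. \<rho> k) h) \<partial>lborel)
              = ennreal (kern (\<lambda>_. 0) (\<lambda>_. \<rho> k) h) * (\<integral>\<^sup>+x. ennreal \<bar>w (x + h) - w x\<bar> \<partial>lborel)"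
            unfolding ennreal_mult[OF abs_ge_zero kern0_nonneg] mult.commute[of _ "ennreal (kern _ _ _)"] add.commute[of h]
            by (rule nn_integral_cmult) measurable
          also have "\<dots> \<le> ennreal (kern (\<lambda>_. 0) (\<lambda>_. \<rho> k) h) * ennreal e"
          proof (cases "kern (\<lambda>_. 0) (\<lambda>_. \<rho> k) h = 0")
            case False
            then have "norm h < d" using kern0_supp[OF False] elim by simp
            then show ?thesis using d(2) by (intro mult_left_mono) auto
          qed simp
          finally show "(\<integral>\<^sup>+x. ennreal (\<bar>w (h + x) - w x\<bar> * kern (\<lambda>_. 0) (\<lambda>_. \<rho> k) h) \<partial>lborel)
              \<le> ennreal e * ennreal (kern (\<lambda>_. 0) (\<lambda>_. \<rho> k) h)"
            by (simp add: mult.commute)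
        qed
        also have "\<dots> = ennreal e * (\<integral>\<^sup>+h. ennreal (kern (\<lambda>_. 0) (\<lambda>_. \<rho> k) (h::'a)) \<partial>lborel)"
          by (rule nn_integral_cmult) measurable
        also have "(\<integral>\<^sup>+h. ennreal (kern (\<lambda>_. 0) (\<lambda>_. \<rho> k) (h::'a)) \<partial>lborel) = 1"
          using nn_integral_kern[OF \<rho>(1)[of k], of "0::'a"] by simp
        finally show ?case by simp
      qed
    qed
    have [measurable]: "D k \<in> borel_measurable borel" for k
      unfolding D_def by measurable
    have "(\<integral>\<^sup>+x. liminf (\<lambda>k. D k x) \<partial>lborel) \<le> liminf (\<lambda>k. \<integral>\<^sup>+x. D k x \<partial>lborel)"
      by (rule nn_integral_liminf) measurable
    also have "\<dots> = 0" using lim by (intro lim_imp_Liminf) auto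
    finally have "AE x in lborel. liminf (\<lambda>k. D k x) = 0"
      by (subst nn_integral_0_iff_AE[symmetric]) auto
    then show ?thesis
    proof eventually_elim
      case (elim x)
      show ?case
      proof (intro impI allI)
        fix e :: real assume x: "x \<in> ball 0 (real N)" and e: "0 < e"
        obtain k0 where k0: "inverse (real (Suc k0)) < e" using reals_Archimedean[OF e] by blast
        have "\<exists>k\<ge>k0. D k x < ennreal e"
        proof (rule ccontr)
          assume "\<not> ?thesis"
          then have "eventually (\<lambda>k. ennreal e \<le> D k x) sequentially"
            by (auto simp: eventually_sequentially not_less)
          then have "ennreal e \<le> liminf (\<lambda>k. D k x)" by (rule Liminf_bounded)
          then show False using elim e by simp
        qed
        then obtain k where k: "k0 \<le> k" "D k x < ennreal e" by blast
        have "\<rho> k \<le> inverse (real (Suc k0))"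
          unfolding \<rho>_def using k(1) by (intro le_imp_inverse_le) auto
        with k0 have "\<rho> k < e" by simp
        moreover have "\<bar>average f (\<rho> k) x - f x\<bar> \<le> e"
          using local[OF x, of k] k(2) e by (metis ennreal_le_iff less_imp_le order.trans)
        ultimately show "\<exists>r>0. r < e \<and> \<bar>average f r x - f x\<bar> \<le> e"
          using \<rho>(1) by blast
      qed
    qed
  qed
  then have "AE x in lborel. \<forall>N. x \<in> ball 0 (real N) \<longrightarrow> (\<forall>e>0. \<exists>r>0. r < e \<and> \<bar>average f r x - f x\<bar> \<le> e)"
    unfolding AE_all_countable by blast
  then show ?thesis
  proof eventually_elim
    case (elim x)
    obtain N :: nat where "norm x < real N" using reals_Archimedean2 by blast
    then have "x \<in> ball 0 (real N)" by simp
    with elim show ?case by blast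
  qed
qed

end

section \<open>From Sobolev functions to the pointwise inequality\<close>

lemma orlicz_borel_representative:
  fixes f :: "'a::euclidean_space \<Rightarrow> real"
  assumes A: "young_function A" and f: "f \<in> orlicz_space A"
  obtains f' where "f' \<in> borel_measurable borel" "AE x in lborel. f x = f' x"
    "f' \<in> orlicz_space A" "locally_integrable_borel f'"
proof -
  have "f \<in> borel_measurable lebesgue" using f by (simp add: orlicz_space_def)
  then obtain f' where f': "f' \<in> borel_measurable lborel" "AE x in lborel. f x = f' x"
    using completion_ex_borel_measurable_real by blast
  then have [measurable]: "f' \<in> borel_measurable borel" by simp
  have orl: "f' \<in> orlicz_space A"
    using orlicz_space_cong_AE[OF measurable_completion[OF f'(1)] f'(2) f] .
  have "integrable lborel (\<lambda>z. indicat_real (cball 0 R) z * f' z)" for R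
  proof (rule integrableI_bounded)
    have "cball (0::'a) R \<in> sets lborel" by simp
    then show "(\<lambda>z. indicat_real (cball 0 R) z * f' z) \<in> borel_measurable lborel" by measurable
    have "(\<integral>\<^sup>+z. ennreal (norm (indicat_real (cball 0 R) z * f' z)) \<partial>lborel) = (\<integral>\<^sup>+z\<in>cball 0 R. ennreal \<bar>f' z\<bar> \<partial>lborel)"
      by (intro nn_integral_cong) (auto split: split_indicator)
    also have "\<dots> < \<infinity>"
      by (rule orlicz_space_finite_on[OF A orl]) (auto simp: emeasure_lborel_cball_finite[unfolded infinity_ennreal_def])
    finally show "(\<integral>\<^sup>+z. ennreal (norm (indicat_real (cball 0 R) z * f' z)) \<partial>lborel) < \<infinity>" .
  qed
  then have "locally_integrable_borel f'" by (simp add: locally_integrable_borel_def)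
  then show thesis by (rule that[OF \<open>f' \<in> borel_measurable borel\<close> f'(2) orl])
qed

lemma test_function_derivative_continuous:
  assumes "test_function \<phi>" "b \<in> Basis"
  shows "continuous_on UNIV (\<lambda>z. frechet_derivative \<phi> (at z) b)"
proof -
  have "C_diff (Suc 0) \<phi>" using assms by (auto simp: test_function_def)
  then show ?thesis using assms(2) by simp
qed

lemma test_function_continuous: "test_function \<phi> \<Longrightarrow> continuous_on UNIV \<phi>"
  unfolding test_function_def by (metis C_diff.simps(1))

lemma AE_null_setE:
  assumes "AE x in lborel. P x"
  obtains N where "N \<in> null_sets lborel" "\<And>x. x \<notin> N \<Longrightarrow> P x"
proof -
  obtain N where "N \<in> null_sets lborel" "{x \<in> space lborel. \<not> P x} \<subseteq> N"
    using assms unfolding eventually_ae_filter by blast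
  then show thesis by (intro that[of N]) auto
qed

text \<open>The pointwise estimate bounds the difference by the maximal function of \<open>|G|\<close>, which lies in the
  Orlicz space by the modular estimate and is therefore an admissible \<open>g\<close>.\<close>

theorem sobolev_orlicz_imp_pointwise:
  fixes f :: "'a::euclidean_space \<Rightarrow> real"
  assumes A: "young_function A" and c: "0 < c"
    and hyp: "\<And>t. 0 < t \<Longrightarrow> (\<integral>\<^sup>+s\<in>{0<..<t}. (A s / ennreal (s\<^sup>2)) \<partial>lborel) \<le> A (c * t) / ennreal t"
    and f: "f \<in> sobolev_orlicz_space A"
  shows "\<exists>g \<in> orlicz_space A. (\<forall>x. 0 \<le> g x) \<and> (\<exists>S \<in> null_sets lebesgue. \<forall>x y. x \<notin> S \<longrightarrow> y \<notin> S \<longrightarrow>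
    \<bar>f x - f y\<bar> \<le> dist x y * (g x + g y))"
proof -
  obtain \<Gamma> \<beta> K where "smooth_step \<Gamma> \<beta> K" using smooth_step_exists by blast
  then interpret smooth_step \<Gamma> \<beta> K .
  \<comment> \<open>Enlarging the constant keeps the hypothesis, and a constant of at least one makes the modular
    of the rescaled gradient \<open>v\<close> below finite.\<close>
  define d where "d = max 1 c"
  have d: "1 \<le> d" "c \<le> d" by (auto simp: d_def)
  have hypd: "(\<integral>\<^sup>+s\<in>{0<..<t}. (A s / ennreal (s\<^sup>2)) \<partial>lborel) \<le> A (d * t) / ennreal t" if "0 < t" for t
  proof -
    have "A (c * t) \<le> A (d * t)"
      using c d that by (intro young_function_mono[OF A] mult_right_mono) auto
    then show ?thesis using hyp[OF that] by (meson divide_right_mono_ennreal order.trans)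
  qed
  obtain G where G: "weak_gradient f G" "(\<lambda>x. norm (G x)) \<in> orlicz_space A" and fA: "f \<in> orlicz_space A"
    using f by (auto simp: sobolev_orlicz_space_def)
  obtain f' where f': "f' \<in> borel_measurable borel" "AE x in lborel. f x = f' x"
    "f' \<in> orlicz_space A" "locally_integrable_borel f'"
    using orlicz_borel_representative[OF A fA] .
  obtain u0 where u0: "u0 \<in> borel_measurable borel" "AE x in lborel. norm (G x) = u0 x" "u0 \<in> orlicz_space A"
    using orlicz_borel_representative[OF A G(2)] by metis
  have [measurable]: "f' \<in> borel_measurable borel" "u0 \<in> borel_measurable borel" by fact+
  have f_leb [measurable]: "f \<in> borel_measurable lebesgue" using fA by (simp add: orlicz_space_def)
  obtain l where l: "0 < l" "(\<integral>\<^sup>+x. A (\<bar>u0 x\<bar> / l) \<partial>lborel) \<le> 1"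
    using u0(3) by (auto simp: orlicz_space_iff)
  \<comment> \<open>With this scaling, the modular estimate bounds the maximal function of \<open>v = |u0| / k\<close> by the
    modular of \<open>|u0| / l\<close>.\<close>
  define k where "k = 4 * d * l"
  have k: "0 < k" using d l by (simp add: k_def)
  define v where "v = (\<lambda>x. \<bar>u0 x\<bar> / k)"
  define F where "F = (\<lambda>x. f' x / k)"
  define m where "m = (\<lambda>x. maximal_function (\<lambda>z. ennreal (v z)) x)"
  have v: "0 \<le> v x" for x using k by (simp add: v_def)
  have [measurable]: "v \<in> borel_measurable borel" unfolding v_def by measurable
  have vm: "(\<lambda>z. ennreal (v z)) \<in> borel_measurable borel" by measurable
  have F: "locally_integrable_borel F"
    using f'(4) by (auto simp: locally_integrable_borel_def F_def)
  have dom: "ennreal \<bar>LINT z|lborel. F z * frechet_derivative \<phi> (at z) b\<bar> \<le> (\<integral>\<^sup>+z. ennreal (v z) * ennreal \<bar>\<phi> z\<bar> \<partial>lborel)"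
    if \<phi>: "test_function \<phi>" and b: "b \<in> Basis" for \<phi> b
  proof -
    have D [measurable]: "(\<lambda>z. frechet_derivative \<phi> (at z) b) \<in> borel_measurable borel"
      using test_function_derivative_continuous[OF \<phi> b] by (rule borel_measurable_continuous_onI)
    have [measurable]: "\<phi> \<in> borel_measurable borel"
      using test_function_continuous[OF \<phi>] by (rule borel_measurable_continuous_onI)
    have Dleb [measurable]: "(\<lambda>z. frechet_derivative \<phi> (at z) b) \<in> borel_measurable lebesgue"
      by (rule measurable_completion) (simp add: D)
    have f'leb [measurable]: "f' \<in> borel_measurable lebesgue" using f'(3) by (simp add: orlicz_space_def)
    have "(LINT z|lborel. f' z * frechet_derivative \<phi> (at z) b) = (LINT z|lebesgue. f' z * frechet_derivative \<phi> (at z) b)"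
      by (rule integral_completion[symmetric]) measurable
    also have "\<dots> = (LINT z|lebesgue. f z * frechet_derivative \<phi> (at z) b)"
    proof (rule integral_cong_AE)
      show "AE z in lebesgue. f' z * frechet_derivative \<phi> (at z) b = f z * frechet_derivative \<phi> (at z) b"
        using AE_completion[OF f'(2)] by eventually_elim simp
    qed measurable
    also have "\<dots> = - (LINT z|lebesgue. (G z \<bullet> b) * \<phi> z)"
      using G(1) \<phi> b by (simp add: weak_gradient_def)
    finally have eq: "(LINT z|lborel. f' z * frechet_derivative \<phi> (at z) b) = - (LINT z|lebesgue. (G z \<bullet> b) * \<phi> z)" .
    have "ennreal \<bar>LINT z|lebesgue. (G z \<bullet> b) * \<phi> z\<bar> \<le> (\<integral>\<^sup>+z. ennreal (norm ((G z \<bullet> b) * \<phi> z)) \<partial>lebesgue)"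
    proof (cases "integrable lebesgue (\<lambda>z. (G z \<bullet> b) * \<phi> z)")
      case True
      from integral_norm_bound_ennreal[OF this] show ?thesis by simp
    qed (simp add: not_integrable_integral_eq)
    also have "\<dots> \<le> (\<integral>\<^sup>+z. ennreal k * (ennreal (v z) * ennreal \<bar>\<phi> z\<bar>) \<partial>lborel)"
      unfolding nn_integral_completion
    proof (rule nn_integral_mono_AE, use u0(2) in eventually_elim)
      fix z assume z: "norm (G z) = u0 z"
      have "\<bar>G z \<bullet> b\<bar> * \<bar>\<phi> z\<bar> \<le> norm (G z) * \<bar>\<phi> z\<bar>"
        using b by (intro mult_right_mono Basis_le_norm) auto
      also have "norm (G z) = k * v z" using k z norm_ge_zero[of "G z"] by (simp add: v_def)
      finally have "norm (G z \<bullet> b * \<phi> z) \<le> k * (v z * \<bar>\<phi> z\<bar>)" by (simp add: abs_mult mult.assoc)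
      then have "ennreal (norm (G z \<bullet> b * \<phi> z)) \<le> ennreal (k * (v z * \<bar>\<phi> z\<bar>))" by (rule ennreal_leI)
      also have "\<dots> = ennreal k * (ennreal (v z) * ennreal \<bar>\<phi> z\<bar>)"
        using k v[of z] by (simp add: ennreal_mult)
      finally show "ennreal (norm (G z \<bullet> b * \<phi> z)) \<le> ennreal k * (ennreal (v z) * ennreal \<bar>\<phi> z\<bar>)" .
    qed
    also have "\<dots> = ennreal k * (\<integral>\<^sup>+z. ennreal (v z) * ennreal \<bar>\<phi> z\<bar> \<partial>lborel)"
      by (rule nn_integral_cmult) measurable
    finally have le: "ennreal \<bar>LINT z|lborel. f' z * frechet_derivative \<phi> (at z) b\<bar> \<le> ennreal k * (\<integral>\<^sup>+z. ennreal (v z) * ennreal \<bar>\<phi> z\<bar> \<partial>lborel)"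
      unfolding eq by simp
    have "ennreal \<bar>LINT z|lborel. F z * frechet_derivative \<phi> (at z) b\<bar> = ennreal (inverse k) * ennreal \<bar>LINT z|lborel. f' z * frechet_derivative \<phi> (at z) b\<bar>"
    proof -
      have "(LINT z|lborel. F z * frechet_derivative \<phi> (at z) b) = (LINT z|lborel. inverse k * (f' z * frechet_derivative \<phi> (at z) b))"
        by (simp add: F_def divide_inverse mult_ac)
      then show ?thesis using k by (simp add: abs_mult flip: ennreal_mult)
    qed
    also have "\<dots> \<le> ennreal (inverse k) * (ennreal k * (\<integral>\<^sup>+z. ennreal (v z) * ennreal \<bar>\<phi> z\<bar> \<partial>lborel))"
      by (intro mult_left_mono le) simp
    also have "\<dots> = (\<integral>\<^sup>+z. ennreal (v z) * ennreal \<bar>\<phi> z\<bar> \<partial>lborel)"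
      using k by (simp flip: mult.assoc ennreal_mult)
    finally show ?thesis .
  qed
  have modular: "(\<integral>\<^sup>+x. A (enn2real (m x)) \<partial>lborel) < \<infinity>"
  proof -
    have "(\<integral>\<^sup>+x. A (enn2real (m x)) \<partial>lborel) \<le> ennreal (5 ^ DIM('a)) * (\<integral>\<^sup>+x. A (4 * d * v x) \<partial>lborel)"
      unfolding m_def by (rule maximal_function_modular[OF A _ hypd _ v]) (use d in auto)
    also have "(\<lambda>x. 4 * d * v x) = (\<lambda>x. \<bar>u0 x\<bar> / l)"
      using d by (auto simp: v_def k_def)
    also have "ennreal (5 ^ DIM('a)) * (\<integral>\<^sup>+x. A (\<bar>u0 x\<bar> / l) \<partial>lborel) < \<infinity>"
      using l(2) by (auto simp: ennreal_mult_less_top intro: order_le_less_trans)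
    finally show ?thesis .
  qed
  have finite: "AE x in lborel. m x < \<infinity>"
    unfolding m_def
  proof (rule maximal_function_finite_AE[OF A _ v])
    have "(\<integral>\<^sup>+x. A (v x) \<partial>lborel) \<le> (\<integral>\<^sup>+x. A (\<bar>u0 x\<bar> / l) \<partial>lborel)"
      using d l by (intro nn_integral_mono young_function_mono[OF A] v) (auto simp: v_def k_def intro!: divide_left_mono)
    then show "(\<integral>\<^sup>+x. A (v x) \<partial>lborel) < \<infinity>"
      using l(2) by (simp add: order_le_less_trans)
  qed measurable
  define g where "g = (\<lambda>x. k * (3 * average_const TYPE('a)) * enn2real (m x))"
  have gpos: "0 < k * (3 * average_const TYPE('a))" using k average_const_pos[where 'a='a] by simp
  have [measurable]: "m \<in> borel_measurable borel" unfolding m_def by measurable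
  have mleb: "(\<lambda>x. enn2real (m x)) \<in> borel_measurable lebesgue"
    by (rule measurable_completion) measurable
  then have "(\<lambda>x. enn2real (m x)) \<in> orlicz_space A"
    using modular by (intro orlicz_spaceI[OF A, where l = 1]) auto
  then have "g \<in> orlicz_space A"
  proof (rule orlicz_space_dominated[OF A _ _ gpos])
    show "g \<in> borel_measurable lebesgue" unfolding g_def using mleb by measurable
  qed (use k average_const_pos[where 'a='a] in \<open>simp add: g_def abs_mult\<close>)
  moreover have "0 \<le> g x" for x using gpos by (simp add: g_def less_imp_le)
  moreover have "AE x in lborel. f x = F x * k \<and> m x < \<infinity> \<and> (\<forall>e>0. \<exists>r>0. r < e \<and> \<bar>average F r x - F x\<bar> \<le> e)"
    using f'(2) finite average_approximates_AE[OF F]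
    by eventually_elim (use k in \<open>simp add: F_def\<close>)
  then obtain N where N: "N \<in> null_sets lborel"
    "\<And>x. x \<notin> N \<Longrightarrow> f x = F x * k \<and> m x < \<infinity> \<and> (\<forall>e>0. \<exists>r>0. r < e \<and> \<bar>average F r x - F x\<bar> \<le> e)"
    by (rule AE_null_setE) blast
  have "\<bar>f x - f y\<bar> \<le> dist x y * (g x + g y)" if "x \<notin> N" "y \<notin> N" for x y
  proof -
    have x: "f x = F x * k" "m x < \<infinity>" "\<And>e. 0 < e \<Longrightarrow> \<exists>r>0. r < e \<and> \<bar>average F r x - F x\<bar> \<le> e"
      and y: "f y = F y * k" "m y < \<infinity>" "\<And>e. 0 < e \<Longrightarrow> \<exists>r>0. r < e \<and> \<bar>average F r y - F y\<bar> \<le> e"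
      using N(2)[OF that(1)] N(2)[OF that(2)] by blast+
    have "\<bar>F x - F y\<bar> \<le> 3 * average_const TYPE('a) * dist x y * (enn2real (m x) + enn2real (m y))"
      unfolding m_def
      by (rule pointwise_estimate[OF F vm dom _ _ x(3) y(3)]) (use x(2) y(2) in \<open>auto simp: m_def\<close>)
    then have "\<bar>F x - F y\<bar> * k \<le> 3 * average_const TYPE('a) * dist x y * (enn2real (m x) + enn2real (m y)) * k"
      using k by (intro mult_right_mono) auto
    moreover have "\<bar>f x - f y\<bar> = \<bar>F x - F y\<bar> * k"
      using k by (simp add: x(1) y(1) abs_mult flip: left_diff_distrib)
    ultimately show ?thesis by (simp add: g_def algebra_simps)
  qed
  moreover have "N \<in> null_sets lebesgue" using N(1) by (rule null_sets_completionI)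
  ultimately show ?thesis by blast
qed

section \<open>Almost everywhere convergence of convex combinations\<close>

text \<open>The dyadic convex combinations of the tail \<open>u N, u (Suc N), \<dots>\<close>. Midpoints are all that the
  parallelogram law asks for, and they allow proofs by rule induction.\<close>

inductive midpoint_hull :: "(nat \<Rightarrow> 'a \<Rightarrow> real) \<Rightarrow> nat \<Rightarrow> ('a \<Rightarrow> real) \<Rightarrow> bool"
  for u :: "nat \<Rightarrow> 'a \<Rightarrow> real" and N :: nat where
  generator: "N \<le> k \<Longrightarrow> midpoint_hull u N (u k)"
| midpoint: "midpoint_hull u N v \<Longrightarrow> midpoint_hull u N w \<Longrightarrow> midpoint_hull u N (\<lambda>x. (v x + w x) / 2)"

lemma midpoint_hull_antimono:
  "midpoint_hull u N' v \<Longrightarrow> N \<le> N' \<Longrightarrow> midpoint_hull u N v"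
  by (induction rule: midpoint_hull.induct) (auto intro: midpoint_hull.intros)

lemma midpoint_hull_measurable:
  assumes "midpoint_hull u N v" and "\<And>k. u k \<in> borel_measurable M"
  shows "v \<in> borel_measurable M"
  using assms by (induction rule: midpoint_hull.induct) auto

lemma midpoint_hull_abs_le:
  assumes "midpoint_hull u N v" and "\<And>k. \<bar>u k x\<bar> \<le> 1"
  shows "\<bar>v x\<bar> \<le> (1::real)"
  using assms(1)
proof (induction rule: midpoint_hull.induct)
  case (midpoint v w)
  then have "\<bar>v x + w x\<bar> \<le> 2" by linarith
  then show ?case by simp
qed (use assms(2) in auto)

text \<open>Integrals of the tail against a fixed weight are inherited by its hull. So the convex
  combinations keep the limits of such integrals.\<close>

lemma midpoint_hull_integral:
  fixes h :: "'a \<Rightarrow> real"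
  assumes v: "midpoint_hull u N v"
    and u: "\<And>k. u k \<in> borel_measurable M" "\<And>k x. \<bar>u k x\<bar> \<le> 1"
    and h: "integrable M h"
    and close: "\<And>k. N \<le> k \<Longrightarrow> \<bar>(LINT x|M. u k x * h x) - l\<bar> \<le> e"
  shows "\<bar>(LINT x|M. v x * h x) - l\<bar> \<le> e"
  using v
proof (induction rule: midpoint_hull.induct)
  case (midpoint v w)
  have [measurable]: "h \<in> borel_measurable M" using h by (rule borel_measurable_integrable)
  have int: "integrable M (\<lambda>x. v x * h x)" if v: "midpoint_hull u N v" for v
  proof (rule Bochner_Integration.integrable_bound[OF h])
    have [measurable]: "v \<in> borel_measurable M" by (rule midpoint_hull_measurable[OF v u(1)])
    show "(\<lambda>x. v x * h x) \<in> borel_measurable M" by measurable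
    show "AE x in M. norm (v x * h x) \<le> norm (h x)"
      using midpoint_hull_abs_le[OF v u(2)] by (intro AE_I2) (simp add: abs_mult mult_left_le_one_le)
  qed
  have "(LINT x|M. (v x + w x) / 2 * h x) = ((LINT x|M. v x * h x) + (LINT x|M. w x * h x)) / 2"
    using int[OF midpoint.hyps(1)] int[OF midpoint.hyps(2)]
    by (simp add: add_divide_distrib distrib_right)
  then show ?case using midpoint.IH by (simp add: abs_le_iff field_simps)
qed (rule close)

text \<open>In the Hilbert space of square integrable functions, almost minimisers of the norm in the
  hulls of the tails form a Cauchy sequence by the parallelogram law. A sufficiently fast choice
  converges almost everywhere.\<close>

theorem midpoint_hull_convergent:
  fixes u :: "nat \<Rightarrow> 'a \<Rightarrow> real"
  assumes M: "finite_measure M" and u [measurable]: "\<And>k. u k \<in> borel_measurable M" and bound: "\<And>k x. \<bar>u k x\<bar> \<le> 1"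
  shows "\<exists>v. (\<forall>j. midpoint_hull u j (v j)) \<and> (AE x in M. convergent (\<lambda>j. v j x))"
proof -
  interpret finite_measure M by fact
  define T where "T = measure M (space M)"
  define E where "E = (\<lambda>v::'a \<Rightarrow> real. LINT x|M. (v x)\<^sup>2)"
  \<comment> \<open>The squared minimal norms of the hulls increase, as the hulls shrink, to a finite limit \<open>L\<close>.\<close>
  define a where "a = (\<lambda>N. Inf (E ` {v. midpoint_hull u N v}))"
  have sq_int: "integrable M (\<lambda>x. v x * w x)"
    if [measurable]: "v \<in> borel_measurable M" "w \<in> borel_measurable M" and b: "\<And>x. \<bar>v x\<bar> \<le> 1" "\<And>x. \<bar>w x\<bar> \<le> 1" for v w :: "'a \<Rightarrow> real"
  proof (rule finite_measure.integrable_const_bound[OF M])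
    show "AE x in M. norm (v x * w x) \<le> (1::real)"
      using mult_mono[OF b] by (intro AE_I2) (simp add: abs_mult)
  qed measurable
  have hull_int: "integrable M (\<lambda>x. v x * w x)" if "midpoint_hull u N v" "midpoint_hull u N' w" for v w N N'
    by (intro sq_int midpoint_hull_measurable[OF that(1) u] midpoint_hull_measurable[OF that(2) u]
        midpoint_hull_abs_le[OF that(1) bound] midpoint_hull_abs_le[OF that(2) bound])
  have E_nonneg: "0 \<le> E v" for v by (simp add: E_def)
  have E_le: "E v \<le> T" if v: "midpoint_hull u N v" for v N
  proof -
    have "(LINT x|M. (v x)\<^sup>2) \<le> (LINT x|M. 1)"
      using hull_int[OF v v] midpoint_hull_abs_le[OF v bound]
      by (intro integral_mono) (auto simp: power2_eq_square abs_square_le_1[unfolded power2_eq_square])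
    then show ?thesis by (simp add: E_def T_def)
  qed
  have ne: "E ` {v. midpoint_hull u N v} \<noteq> {}" for N
    using midpoint_hull.generator[of N N u] by auto
  have bdd: "bdd_below (E ` {v. midpoint_hull u N v})" for N
    using E_nonneg by (intro bdd_belowI2[where m = 0])
  have a_le: "a N \<le> E v" if "midpoint_hull u N v" for N v
    unfolding a_def using that by (intro cInf_lower bdd) auto
  have a_T: "a N \<le> T" for N
    using a_le[OF midpoint_hull.generator[of N N]] E_le[OF midpoint_hull.generator[of N N]] by fastforce
  define L where "L = Sup (range a)"
  have bdd_a: "bdd_above (range a)" using a_T by (intro bdd_aboveI2)
  have a_L: "a N \<le> L" for N unfolding L_def by (intro cSup_upper bdd_a) auto
  have incr: "a N \<le> a N'" if "N \<le> N'" for N N'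
  proof -
    have "a N \<le> Inf (E ` {v. midpoint_hull u N' v})"
    proof (rule cInf_greatest[OF ne])
      fix t assume "t \<in> E ` {v. midpoint_hull u N' v}"
      then obtain v where v: "midpoint_hull u N' v" "t = E v" by blast
      show "a N \<le> t" unfolding v(2) by (rule a_le[OF midpoint_hull_antimono[OF v(1) that]])
    qed
    then show ?thesis by (simp only: a_def)
  qed
  define q where "q = (\<lambda>j::nat. (1/4::real) ^ j)"
  have q: "0 < q j" for j by (simp add: q_def)
  have "\<exists>N v. j \<le> N \<and> L - q j < a N \<and> midpoint_hull u N v \<and> E v \<le> L + q j" for j
  proof -
    obtain N0 where N0: "L - q j < a N0"
      using less_cSup_iff[OF _ bdd_a, of "L - q j"] q[of j] unfolding L_def by auto
    define N where "N = max j N0"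
    have "L - q j < a N" using N0 incr[of N0 N] by (simp add: N_def)
    moreover have "a N < L + q j" using a_L[of N] q[of j] by simp
    then obtain v where "midpoint_hull u N v" "E v < L + q j"
      unfolding a_def using cInf_less_iff[OF ne bdd] by auto
    ultimately show ?thesis by (intro exI[of _ N] exI[of _ v]) (auto simp: N_def)
  qed
  then obtain N v where Nv: "\<And>j. j \<le> N j" "\<And>j. L - q j < a (N j)"
      "\<And>j. midpoint_hull u (N j) (v j)" "\<And>j. E (v j) \<le> L + q j"
    by metis
  have v_meas [measurable]: "v j \<in> borel_measurable M" for j
    by (rule midpoint_hull_measurable[OF Nv(3) u])
  have mid: "L - q i - q j \<le> E (\<lambda>x. (v i x + v j x) / 2)" for i j
  proof -
    let ?N = "min (N i) (N j)"
    have "midpoint_hull u ?N (\<lambda>x. (v i x + v j x) / 2)"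
      using midpoint_hull_antimono[OF Nv(3)[of i], of ?N] midpoint_hull_antimono[OF Nv(3)[of j], of ?N]
      by (intro midpoint_hull.midpoint) auto
    then have "a ?N \<le> E (\<lambda>x. (v i x + v j x) / 2)" by (rule a_le)
    moreover have "L - q i - q j \<le> a ?N"
      using Nv(2)[of i] Nv(2)[of j] q[of i] q[of j] by (cases "N i \<le> N j") (auto simp: min_def)
    ultimately show ?thesis by simp
  qed
  define d where "d = (\<lambda>i x. v (Suc i) x - v i x)"
  have int_v: "integrable M (\<lambda>x. v i x * v j x)" for i j by (rule hull_int[OF Nv(3) Nv(3)])
  have d_sq_int: "integrable M (\<lambda>x. (d i x)\<^sup>2)" for i
    using int_v by (simp add: d_def power2_eq_square algebra_simps)
  have d_sq: "(LINT x|M. (d i x)\<^sup>2) \<le> 12 * q i" for i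
  proof -
    have "(LINT x|M. (d i x)\<^sup>2) = (LINT x|M. 2 * (v i x * v i x) + 2 * (v (Suc i) x * v (Suc i) x)
        - 4 * (((v i x + v (Suc i) x) / 2) * ((v i x + v (Suc i) x) / 2)))"
      by (intro Bochner_Integration.integral_cong) (auto simp: d_def power2_eq_square field_simps)
    also have "\<dots> = 2 * E (v i) + 2 * E (v (Suc i)) - 4 * E (\<lambda>x. (v i x + v (Suc i) x) / 2)"
    proof -
      define z where "z = (\<lambda>x. ((v i x + v (Suc i) x) / 2) * ((v i x + v (Suc i) x) / 2))"
      have "integrable M z"
        unfolding z_def using int_v by (simp add: algebra_simps add_divide_distrib)
      then have "(LINT x|M. 2 * (v i x * v i x) + 2 * (v (Suc i) x * v (Suc i) x) - 4 * z x)
          = 2 * (LINT x|M. v i x * v i x) + 2 * (LINT x|M. v (Suc i) x * v (Suc i) x) - 4 * (LINT x|M. z x)"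
        using int_v by simp
      then show ?thesis
        unfolding E_def power2_eq_square z_def .
    qed
    also have "\<dots> \<le> 12 * q i"
    proof -
      have "q (Suc i) = q i / 4" by (simp add: q_def)
      then show ?thesis
        using Nv(4)[of i] Nv(4)[of "Suc i"] mid[of i "Suc i"] q[of i] by linarith
    qed
    finally show ?thesis .
  qed
  have d_L1: "(\<integral>\<^sup>+x. ennreal \<bar>d i x\<bar> \<partial>M) \<le> ennreal ((T / 2 + 6) * (1/2) ^ i)" for i
  proof -
    \<comment> \<open>Young's inequality with weights that balance the finite total mass against the decay of the
      squared norms.\<close>
    have pw: "\<bar>d i x\<bar> \<le> (1/2) ^ i / 2 + 2 ^ i / 2 * (d i x)\<^sup>2" for x
    proof -
      have "0 \<le> (1 - 2 ^ i * \<bar>d i x\<bar>)\<^sup>2" by simp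
      then have "2 * (2 ^ i * \<bar>d i x\<bar>) \<le> 1 + (2 ^ i)\<^sup>2 * (d i x)\<^sup>2"
        by (simp add: power2_diff power_mult_distrib)
      then have "2 * (2 ^ i * \<bar>d i x\<bar>) / (2 * 2 ^ i) \<le> (1 + (2 ^ i)\<^sup>2 * (d i x)\<^sup>2) / (2 * 2 ^ i)"
        by (rule divide_right_mono) simp
      then show ?thesis by (simp add: add_divide_distrib power2_eq_square power_divide)
    qed
    have "(\<integral>\<^sup>+x. ennreal \<bar>d i x\<bar> \<partial>M) \<le> (\<integral>\<^sup>+x. ennreal ((1/2) ^ i / 2 + 2 ^ i / 2 * (d i x)\<^sup>2) \<partial>M)"
      by (intro nn_integral_mono ennreal_leI pw)
    also have "\<dots> = ennreal (LINT x|M. (1/2) ^ i / 2 + 2 ^ i / 2 * (d i x)\<^sup>2)"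
      using d_sq_int by (intro nn_integral_eq_integral) auto
    also have "(LINT x|M. (1/2) ^ i / 2 + 2 ^ i / 2 * (d i x)\<^sup>2) = (1/2) ^ i / 2 * T + 2 ^ i / 2 * (LINT x|M. (d i x)\<^sup>2)"
      using d_sq_int by (simp add: T_def)
    also have "\<dots> \<le> (1/2) ^ i / 2 * T + 2 ^ i / 2 * (12 * q i)"
      by (intro add_left_mono mult_left_mono d_sq) simp
    also have "2 ^ i * q i = (1/2) ^ i"
      unfolding q_def by (simp flip: power_mult_distrib)
    then have "(1/2) ^ i / 2 * T + 2 ^ i / 2 * (12 * q i) = (T / 2 + 6) * (1/2) ^ i"
      by (simp add: algebra_simps)
    finally show ?thesis by (simp add: ennreal_leI)
  qed
  have "(\<integral>\<^sup>+x. (\<Sum>i. ennreal \<bar>d i x\<bar>) \<partial>M) = (\<Sum>i. \<integral>\<^sup>+x. ennreal \<bar>d i x\<bar> \<partial>M)"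
    unfolding d_def by (rule nn_integral_suminf) measurable
  also have "\<dots> \<le> (\<Sum>i. ennreal ((T / 2 + 6) * (1/2) ^ i))"
    by (intro suminf_le d_L1) auto
  also have "\<dots> = ennreal (\<Sum>i. (T / 2 + 6) * (1/2) ^ i)"
    by (intro suminf_ennreal2 summable_mult) (auto simp: T_def)
  finally have "(\<integral>\<^sup>+x. (\<Sum>i. ennreal \<bar>d i x\<bar>) \<partial>M) \<noteq> \<infinity>" by (auto simp: top_unique)
  then have "AE x in M. (\<Sum>i. ennreal \<bar>d i x\<bar>) \<noteq> \<infinity>"
    unfolding d_def by (intro nn_integral_PInf_AE) auto
  then have "AE x in M. convergent (\<lambda>j. v j x)"
  proof eventually_elim
    case (elim x)
    then have "summable (\<lambda>i. \<bar>d i x\<bar>)" by (intro summable_suminf_not_top) auto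
    then have "summable (\<lambda>i. d i x)" by (rule summable_rabs_cancel)
    then have "convergent (\<lambda>n. \<Sum>i<n. d i x)" by (simp add: summable_iff_convergent)
    then have "convergent (\<lambda>n. v n x - v 0 x)" by (simp add: d_def sum_lessThan_telescope[of "\<lambda>n. v n x"])
    then have "convergent (\<lambda>n. (v n x - v 0 x) + v 0 x)" by (intro convergent_add convergent_const)
    then show ?case by simp
  qed
  moreover have "midpoint_hull u j (v j)" for j
    using midpoint_hull_antimono[OF Nv(3) Nv(1)] .
  ultimately show ?thesis by blast
qed

section \<open>From the pointwise inequality to Sobolev functions\<close>

lemma integrable_lborel_translate:
  fixes F :: "'a::euclidean_space \<Rightarrow> real"
  assumes "integrable lborel F"
  shows "integrable lborel (\<lambda>x. F (x + c))" "(LINT x|lborel. F (x + c)) = (LINT x|lborel. F x)"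
proof -
  have [measurable]: "F \<in> borel_measurable borel" using assms by (auto dest: borel_measurable_integrable)
  have "integrable (distr lborel borel ((+) c)) F" using assms by (simp add: lborel_distr_plus)
  then show "integrable lborel (\<lambda>x. F (x + c))"
    by (subst (asm) integrable_distr_eq) (auto simp: add.commute)
  have "(LINT x|lborel. F x) = (LINT x|distr lborel borel ((+) c). F x)" by (simp add: lborel_distr_plus)
  also have "\<dots> = (LINT x|lborel. F (c + x))" by (intro integral_distr) auto
  finally show "(LINT x|lborel. F (x + c)) = (LINT x|lborel. F x)" by (simp add: add.commute)
qed

lemma test_function_support:
  fixes \<phi> :: "'a::euclidean_space \<Rightarrow> real"
  assumes "test_function \<phi>"
  obtains R C where "0 \<le> R" "0 \<le> C" "\<And>z. \<phi> z \<noteq> 0 \<Longrightarrow> z \<in> cball 0 R" "\<And>z. \<bar>\<phi> z\<bar> \<le> C"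
proof -
  have "bounded (closure {z. \<phi> z \<noteq> 0})" using assms by (auto simp: test_function_def intro: compact_imp_bounded)
  then obtain R0 where R0: "\<And>z. z \<in> closure {z. \<phi> z \<noteq> 0} \<Longrightarrow> norm z \<le> R0" unfolding bounded_iff by blast
  define R where "R = max 0 R0"
  have supp: "z \<in> cball 0 R" if "\<phi> z \<noteq> 0" for z
    using R0[of z] closure_subset[of "{z. \<phi> z \<noteq> 0}"] that by (auto simp: R_def le_max_iff_disj)
  have "bounded (\<phi> ` cball 0 R)"
    by (intro compact_imp_bounded compact_continuous_image continuous_on_subset[OF test_function_continuous[OF assms]]) auto
  then obtain C0 where C0: "\<And>z. z \<in> cball 0 R \<Longrightarrow> norm (\<phi> z) \<le> C0" unfolding bounded_iff by blast
  show thesis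
  proof (rule that[of R "max 0 C0"])
    show "\<bar>\<phi> z\<bar> \<le> max 0 C0" for z
      using C0[of z] supp[of z] by (cases "\<phi> z = 0") auto
  qed (use supp in \<open>auto simp: R_def\<close>)
qed

lemma test_function_directional:
  assumes "test_function \<phi>"
  shows "((\<lambda>s. \<phi> (x + s *\<^sub>R b)) has_real_derivative frechet_derivative \<phi> (at (x + s *\<^sub>R b)) b) (at s)"
proof -
  have "C_diff (Suc 0) \<phi>" using assms by (auto simp: test_function_def)
  then have d: "(\<phi> has_derivative frechet_derivative \<phi> (at z)) (at z)" for z by (rule C_diff_SucD)
  have "((\<lambda>s. \<phi> (x + s *\<^sub>R b)) has_derivative (\<lambda>t. frechet_derivative \<phi> (at (x + s *\<^sub>R b)) (t *\<^sub>R b))) (at s)"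
    by (rule has_derivative_compose[OF _ d, where f = "\<lambda>s. x + s *\<^sub>R b"]) (auto intro!: derivative_eq_intros)
  then show ?thesis
    unfolding has_field_derivative_def
    using linear_scale[OF has_derivative_linear[OF d]] by (simp add: mult.commute[of _ "frechet_derivative \<phi> _ b"])
qed

text \<open>Translation invariance moves the difference quotient onto the test function, where it converges
  boundedly.\<close>

lemma difference_quotient_tendsto:
  fixes f :: "'a::euclidean_space \<Rightarrow> real"
  assumes f: "locally_integrable_borel f" and \<phi>: "test_function \<phi>" and b: "b \<in> Basis"
    and t: "\<And>k. 0 < t k" "\<And>k. t k \<le> 1" "t \<longlonglongrightarrow> 0"
  shows "(\<lambda>k. LINT x|lborel. (f (x + t k *\<^sub>R b) - f x) / t k * \<phi> x)
      \<longlonglongrightarrow> - (LINT x|lborel. f x * frechet_derivative \<phi> (at x) b)"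
proof -
  have [measurable]: "f \<in> borel_measurable borel" using f by (simp add: locally_integrable_borel_def)
  have D [measurable]: "(\<lambda>z. frechet_derivative \<phi> (at z) b) \<in> borel_measurable borel"
    using test_function_derivative_continuous[OF \<phi> b] by (rule borel_measurable_continuous_onI)
  have [measurable]: "\<phi> \<in> borel_measurable borel"
    using test_function_continuous[OF \<phi>] by (rule borel_measurable_continuous_onI)
  obtain R C where RC: "0 \<le> R" "0 \<le> C" "\<And>z. \<phi> z \<noteq> 0 \<Longrightarrow> z \<in> cball 0 R" "\<And>z. \<bar>\<phi> z\<bar> \<le> C"
    using test_function_support[OF \<phi>] by blast
  define Q where "Q = (\<lambda>k x. (\<phi> (x - t k *\<^sub>R b) - \<phi> x) / t k)"
  have shift_supp: "x \<in> cball 0 (R + 1)" if "\<phi> (x - t k *\<^sub>R b) \<noteq> 0" for x k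
  proof -
    have "norm (x - t k *\<^sub>R b) \<le> R" using RC(3)[OF that] by simp
    moreover have "norm (t k *\<^sub>R b) \<le> 1" using b t by (simp add: less_imp_le)
    ultimately show ?thesis using norm_triangle_ineq[of "x - t k *\<^sub>R b" "t k *\<^sub>R b"] by simp
  qed
  have Q_supp: "x \<in> cball 0 (R + 1)" if "Q k x \<noteq> 0" for x k
    using that shift_supp[of x k] RC(3)[of x] by (cases "\<phi> x = 0") (auto simp: Q_def)
  have [measurable]: "Q k \<in> borel_measurable borel" for k unfolding Q_def by measurable
  have quot: "(LINT x|lborel. (f (x + t k *\<^sub>R b) - f x) / t k * \<phi> x) = (LINT x|lborel. f x * Q k x)" for k
  proof -
    have i1: "integrable lborel (\<lambda>x. f x * \<phi> (x - t k *\<^sub>R b))"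
      by (rule integrable_mult_bounded_support[OF f _ RC(4) shift_supp]) measurable
    have i2: "integrable lborel (\<lambda>x. f x * \<phi> x)"
      by (rule integrable_mult_bounded_support[OF f _ RC(4) RC(3)]) measurable
    have i3: "integrable lborel (\<lambda>x. f (x + t k *\<^sub>R b) * \<phi> x)"
      and e3: "(LINT x|lborel. f (x + t k *\<^sub>R b) * \<phi> x) = (LINT x|lborel. f x * \<phi> (x - t k *\<^sub>R b))"
      using integrable_lborel_translate[OF i1, of "t k *\<^sub>R b"] by simp_all
    have "(LINT x|lborel. (f (x + t k *\<^sub>R b) - f x) / t k * \<phi> x)
        = (LINT x|lborel. (f (x + t k *\<^sub>R b) * \<phi> x - f x * \<phi> x) / t k)"
      by (simp add: left_diff_distrib)
    also have "\<dots> = ((LINT x|lborel. f (x + t k *\<^sub>R b) * \<phi> x) - (LINT x|lborel. f x * \<phi> x)) / t k"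
      using i2 i3 by simp
    also have "\<dots> = (LINT x|lborel. (f x * \<phi> (x - t k *\<^sub>R b) - f x * \<phi> x) / t k)"
      unfolding e3 using i1 i2 by simp
    also have "\<dots> = (LINT x|lborel. f x * Q k x)"
      by (simp add: Q_def right_diff_distrib)
    finally show ?thesis .
  qed
  have "bounded ((\<lambda>z. frechet_derivative \<phi> (at z) b) ` cball 0 (R + 2))"
    by (intro compact_imp_bounded compact_continuous_image continuous_on_subset[OF test_function_derivative_continuous[OF \<phi> b]]) auto
  then obtain L where L: "\<And>z. z \<in> cball 0 (R + 2) \<Longrightarrow> norm (frechet_derivative \<phi> (at z) b) \<le> L"
    unfolding bounded_iff by blast
  have L0: "0 \<le> L" using L[of 0] RC(1) by (auto intro: order.trans[OF norm_ge_zero])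
  have Q_bound: "\<bar>Q k x\<bar> \<le> L" for k x
  proof (cases "Q k x = 0")
    case False
    then have x: "norm x \<le> R + 1" using Q_supp by fastforce
    obtain s where s: "- t k < s" "s < 0"
      and eq: "\<phi> (x + 0 *\<^sub>R b) - \<phi> (x + (- t k) *\<^sub>R b) = (0 - - t k) * frechet_derivative \<phi> (at (x + s *\<^sub>R b)) b"
      using MVT2[of "- t k" 0 "\<lambda>s. \<phi> (x + s *\<^sub>R b)" "\<lambda>s. frechet_derivative \<phi> (at (x + s *\<^sub>R b)) b"]
        t(1)[of k] test_function_directional[OF \<phi>] by auto
    have "norm (x + s *\<^sub>R b) \<le> norm x + \<bar>s\<bar>"
      using norm_triangle_ineq[of x "s *\<^sub>R b"] b by simp
    then have "\<bar>frechet_derivative \<phi> (at (x + s *\<^sub>R b)) b\<bar> \<le> L"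
      using L[of "x + s *\<^sub>R b"] x s t(2)[of k] by simp
    moreover have "Q k x = - frechet_derivative \<phi> (at (x + s *\<^sub>R b)) b"
      using eq t(1)[of k] by (simp add: Q_def field_simps)
    ultimately show ?thesis by simp
  qed (use L0 in simp)
  have Q_lim: "(\<lambda>k. Q k x) \<longlonglongrightarrow> - frechet_derivative \<phi> (at x) b" for x
  proof -
    have "((\<lambda>h. (\<phi> (x + h *\<^sub>R b) - \<phi> x) / h) \<longlongrightarrow> frechet_derivative \<phi> (at x) b) (at 0)"
      using test_function_directional[OF \<phi>, of x b 0] by (simp add: DERIV_def)
    moreover have "filterlim (\<lambda>k. - t k) (at 0) sequentially"
      unfolding filterlim_at using tendsto_minus[OF t(3)] t(1) by (auto simp: less_imp_neq[symmetric])
    ultimately have "(\<lambda>k. (\<phi> (x + (- t k) *\<^sub>R b) - \<phi> x) / (- t k)) \<longlonglongrightarrow> frechet_derivative \<phi> (at x) b"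
      by (rule filterlim_compose)
    from tendsto_minus[OF this] show ?thesis by (simp add: Q_def)
  qed
  have "(\<lambda>k. LINT x|lborel. f x * Q k x) \<longlonglongrightarrow> (LINT x|lborel. f x * - frechet_derivative \<phi> (at x) b)"
  proof (rule integral_dominated_convergence[where w = "\<lambda>x. L * \<bar>indicat_real (cball 0 (R + 1)) x * f x\<bar>"])
    show "integrable lborel (\<lambda>x. L * \<bar>indicat_real (cball 0 (R + 1)) x * f x\<bar>)"
      using f by (intro integrable_mult_right integrable_abs) (simp add: locally_integrable_borel_def)
    show "AE x in lborel. (\<lambda>k. f x * Q k x) \<longlonglongrightarrow> f x * - frechet_derivative \<phi> (at x) b"
      by (intro AE_I2 tendsto_mult tendsto_const Q_lim)
    fix k
    show "AE x in lborel. norm (f x * Q k x) \<le> L * \<bar>indicat_real (cball 0 (R + 1)) x * f x\<bar>"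
    proof (intro AE_I2)
      fix x
      have "\<bar>Q k x\<bar> * \<bar>f x\<bar> \<le> L * \<bar>f x\<bar>" by (intro mult_right_mono Q_bound) simp
      then show "norm (f x * Q k x) \<le> L * \<bar>indicat_real (cball 0 (R + 1)) x * f x\<bar>"
        using Q_supp[of k x] by (cases "Q k x = 0") (auto simp: abs_mult mult.commute L0)
    qed
  qed measurable
  then show ?thesis unfolding quot by simp
qed

text \<open>The difference quotients are dominated by \<open>2 * g\<close> up to an error that vanishes in the
  mean. Truncating them at \<open>2 * g\<close> and passing to convex combinations that converge almost
  everywhere produces the weak derivative.\<close>

theorem pointwise_imp_weak_derivative:
  fixes f g :: "'a::euclidean_space \<Rightarrow> real"
  assumes f: "locally_integrable_borel f" and g: "locally_integrable_borel g" and g_nonneg: "\<And>x. 0 \<le> g x"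
    and N: "N \<in> null_sets lborel"
    and ineq: "\<And>x y. x \<notin> N \<Longrightarrow> y \<notin> N \<Longrightarrow> \<bar>f x - f y\<bar> \<le> dist x y * (g x + g y)"
    and b: "b \<in> Basis"
  shows "\<exists>h. h \<in> borel_measurable borel \<and> (\<forall>x. \<bar>h x\<bar> \<le> 2 * g x) \<and>
    (\<forall>\<phi>. test_function \<phi> \<longrightarrow> (LINT x|lborel. f x * frechet_derivative \<phi> (at x) b) = - (LINT x|lborel. h x * \<phi> x))"
proof -
  have [measurable]: "f \<in> borel_measurable borel" "g \<in> borel_measurable borel"
    using f g by (auto simp: locally_integrable_borel_def)
  define t where "t = (\<lambda>k. inverse (real (Suc k)))"
  have t: "0 < t k" "t k \<le> 1" for k by (auto simp: t_def inverse_eq_divide)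
  have t_lim: "t \<longlonglongrightarrow> 0" unfolding t_def by (rule LIMSEQ_inverse_real_of_nat)
  define D where "D = (\<lambda>k x. (f (x + t k *\<^sub>R b) - f x) / t k)"
  \<comment> \<open>Then \<open>2 * g x * u k x\<close> is the truncation of \<open>D k x\<close> to the interval from \<open>- 2 * g x\<close> to \<open>2 * g x\<close>.\<close>
  define u where "u = (\<lambda>k x. if g x = 0 then 0 else max (-1) (min 1 (D k x / (2 * g x))))"
  have [measurable]: "D k \<in> borel_measurable borel" for k unfolding D_def by measurable
  have [measurable]: "u k \<in> borel_measurable borel" for k unfolding u_def by measurable
  have u_le: "\<bar>u k x\<bar> \<le> 1" for k x by (auto simp: u_def)
  have close: "AE x in lborel. \<bar>D k x - 2 * g x * u k x\<bar> \<le> \<bar>g (x + t k *\<^sub>R b) - g x\<bar>" for k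
  proof -
    have "AE x in lborel. x \<notin> N" using N by (rule AE_not_in)
    from this AE_lborel_translate[OF this, of "t k *\<^sub>R b"] show ?thesis
    proof eventually_elim
      case (elim x)
      have "\<bar>f (x + t k *\<^sub>R b) - f x\<bar> \<le> t k * (g (x + t k *\<^sub>R b) + g x)"
        using ineq[OF elim(2,1)] b t(1)[of k] by (simp add: dist_norm)
      then have D_le: "\<bar>D k x\<bar> \<le> g (x + t k *\<^sub>R b) + g x"
        using t(1)[of k] by (simp add: D_def abs_divide pos_divide_le_eq mult.commute)
      show ?case
      proof (cases "g x = 0")
        case False
        then have g: "0 < g x" using g_nonneg[of x] by linarith
        have "2 * g x * u k x = max (- 2 * g x) (min (2 * g x) (D k x))"
          using g by (auto simp: u_def max_def min_def field_simps)
        then show ?thesis using D_le by (auto simp: max_def min_def abs_if split: if_splits)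
      qed (use D_le in \<open>simp add: u_def\<close>)
    qed
  qed
  \<comment> \<open>A finite measure with the same null sets as Lebesgue measure.\<close>
  obtain H :: "'a \<Rightarrow> ennreal" where H: "H \<in> borel_measurable lborel" "integral\<^sup>N lborel H \<noteq> \<infinity>" "\<And>x. 0 < H x"
    using sigma_finite_measure.Ex_finite_integrable_function[OF sigma_finite_lborel] by auto
  have "finite_measure (density lborel H)"
    using H by (intro finite_measureI) (simp add: emeasure_density)
  then obtain v where v: "\<And>j. midpoint_hull u j (v j)" "AE x in density lborel H. convergent (\<lambda>j. v j x)"
    using midpoint_hull_convergent[of "density lborel H" u] u_le by auto
  have [measurable]: "v j \<in> borel_measurable borel" for j
    by (rule midpoint_hull_measurable[OF v(1)]) measurable
  have conv: "AE x in lborel. convergent (\<lambda>j. v j x)"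
    using v(2) H by (simp add: AE_density)
  \<comment> \<open>The truncation gives a bound also on the null set where the sequence diverges.\<close>
  define w where "w = (\<lambda>x. max (-1) (min 1 (lim (\<lambda>j. v j x))))"
  have [measurable]: "w \<in> borel_measurable borel" unfolding w_def by measurable
  have w_le: "\<bar>w x\<bar> \<le> 1" for x by (auto simp: w_def)
  have v_lim: "AE x in lborel. (\<lambda>j. v j x) \<longlonglongrightarrow> w x"
    using conv
  proof eventually_elim
    case (elim x)
    then have lim: "(\<lambda>j. v j x) \<longlonglongrightarrow> lim (\<lambda>j. v j x)" by (simp add: convergent_LIMSEQ_iff)
    have "\<bar>lim (\<lambda>j. v j x)\<bar> \<le> 1"
      by (rule LIMSEQ_le_const2[OF tendsto_rabs[OF lim]]) (use midpoint_hull_abs_le[OF v(1) u_le] in auto)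
    then have "w x = lim (\<lambda>j. v j x)" by (simp add: w_def)
    then show ?case using lim by simp
  qed
  have weak: "(LINT x|lborel. f x * frechet_derivative \<phi> (at x) b) = - (LINT x|lborel. 2 * g x * w x * \<phi> x)"
    if \<phi>: "test_function \<phi>" for \<phi>
  proof -
    define l where "l = - (LINT x|lborel. f x * frechet_derivative \<phi> (at x) b)"
    have [measurable]: "\<phi> \<in> borel_measurable borel"
      using test_function_continuous[OF \<phi>] by (rule borel_measurable_continuous_onI)
    obtain R C where RC: "0 \<le> R" "0 \<le> C" "\<And>z. \<phi> z \<noteq> 0 \<Longrightarrow> z \<in> cball 0 R" "\<And>z. \<bar>\<phi> z\<bar> \<le> C"
      using test_function_support[OF \<phi>] by blast
    have g\<phi>: "integrable lborel (\<lambda>x. g x * \<phi> x)"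
      by (rule integrable_mult_bounded_support[OF g _ RC(4) RC(3)]) measurable
    then have h: "integrable lborel (\<lambda>x. 2 * (g x * \<phi> x))" by (rule integrable_mult_right)
    have u_int: "integrable lborel (\<lambda>x. u k x * (2 * (g x * \<phi> x)))" for k
      by (rule Bochner_Integration.integrable_bound[OF h])
        (use u_le in \<open>auto intro!: mult_left_le_one_le simp: abs_mult\<close>)
    define G where "G = (\<lambda>x. indicat_real (cball 0 (R + 1)) x * g x)"
    have G: "integrable lborel G" using g by (simp add: G_def locally_integrable_borel_def)
    then have [measurable]: "G \<in> borel_measurable borel" by (auto dest: borel_measurable_integrable)
    have "(\<lambda>k. t k *\<^sub>R b) \<longlonglongrightarrow> 0" using tendsto_scaleR[OF t_lim tendsto_const[of b]] by simp
    then have G_lim: "(\<lambda>k. \<integral>\<^sup>+x. ennreal \<bar>G (x + t k *\<^sub>R b) - G x\<bar> \<partial>lborel) \<longlonglongrightarrow> 0"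
      using L1_translation_continuous[OF G] by (simp add: translation_continuous_def)
    have D_int: "integrable lborel (\<lambda>x. D k x * \<phi> x)" for k
    proof -
      have i1: "integrable lborel (\<lambda>x. f x * \<phi> (x - t k *\<^sub>R b))"
      proof (rule integrable_mult_bounded_support[OF f])
        show "x \<in> cball (t k *\<^sub>R b) R" if "\<phi> (x - t k *\<^sub>R b) \<noteq> 0" for x
          using RC(3)[OF that] by (simp add: dist_norm norm_minus_commute)
        show "\<bar>\<phi> (x - t k *\<^sub>R b)\<bar> \<le> C" for x by (rule RC(4))
      qed measurable
      have i2: "integrable lborel (\<lambda>x. f x * \<phi> x)"
        by (rule integrable_mult_bounded_support[OF f _ RC(4) RC(3)]) measurable
      have "integrable lborel (\<lambda>x. (f (x + t k *\<^sub>R b) * \<phi> x - f x * \<phi> x) / t k)"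
        using integrable_lborel_translate(1)[OF i1, of "t k *\<^sub>R b"] i2 by simp
      then show ?thesis by (simp add: D_def left_diff_distrib)
    qed
    have err: "ennreal \<bar>(LINT x|lborel. D k x * \<phi> x) - (LINT x|lborel. u k x * (2 * (g x * \<phi> x)))\<bar>
        \<le> ennreal C * (\<integral>\<^sup>+x. ennreal \<bar>G (x + t k *\<^sub>R b) - G x\<bar> \<partial>lborel)" for k
    proof -
      have int: "integrable lborel (\<lambda>x. D k x * \<phi> x - u k x * (2 * (g x * \<phi> x)))"
        by (intro Bochner_Integration.integrable_diff D_int u_int)
      have "(LINT x|lborel. D k x * \<phi> x) - (LINT x|lborel. u k x * (2 * (g x * \<phi> x)))
          = (LINT x|lborel. D k x * \<phi> x - u k x * (2 * (g x * \<phi> x)))"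
        by (intro Bochner_Integration.integral_diff[symmetric] D_int u_int)
      also have "ennreal \<bar>\<dots>\<bar> \<le> (\<integral>\<^sup>+x. ennreal (norm (D k x * \<phi> x - u k x * (2 * (g x * \<phi> x)))) \<partial>lborel)"
        using integral_norm_bound_ennreal[OF int] by simp
      also have "\<dots> \<le> (\<integral>\<^sup>+x. ennreal C * ennreal \<bar>G (x + t k *\<^sub>R b) - G x\<bar> \<partial>lborel)"
      proof (rule nn_integral_mono_AE, use close[of k] in eventually_elim)
        case (elim x)
        have "D k x * \<phi> x - u k x * (2 * (g x * \<phi> x)) = (D k x - 2 * g x * u k x) * \<phi> x"
          by (simp add: algebra_simps)
        moreover have "\<bar>(D k x - 2 * g x * u k x) * \<phi> x\<bar> \<le> C * \<bar>G (x + t k *\<^sub>R b) - G x\<bar>"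
        proof (cases "\<phi> x = 0")
          case False
          then have x: "norm x \<le> R" using RC(3) by fastforce
          have "norm (x + t k *\<^sub>R b) \<le> norm x + t k"
            using norm_triangle_ineq[of x "t k *\<^sub>R b"] b t(1)[of k] by simp
          then have "G (x + t k *\<^sub>R b) = g (x + t k *\<^sub>R b)" "G x = g x"
            using x t(2)[of k] by (auto simp: G_def)
          then show ?thesis
            using mult_mono[OF elim RC(4)[of x]] RC(2) by (simp add: abs_mult mult.commute)
        qed (use RC(2) in simp)
        ultimately show ?case using RC(2) by (simp add: ennreal_leI flip: ennreal_mult)
      qed
      also have "\<dots> = ennreal C * (\<integral>\<^sup>+x. ennreal \<bar>G (x + t k *\<^sub>R b) - G x\<bar> \<partial>lborel)"
        by (rule nn_integral_cmult) measurable
      finally show ?thesis .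
    qed
    have "(\<lambda>k. ennreal C * (\<integral>\<^sup>+x. ennreal \<bar>G (x + t k *\<^sub>R b) - G x\<bar> \<partial>lborel)) \<longlonglongrightarrow> ennreal C * 0"
      by (intro ennreal_tendsto_cmult G_lim) simp
    then have zero: "(\<lambda>k. ennreal C * (\<integral>\<^sup>+x. ennreal \<bar>G (x + t k *\<^sub>R b) - G x\<bar> \<partial>lborel)) \<longlonglongrightarrow> ennreal 0"
      by simp
    have "(\<lambda>k. ennreal \<bar>(LINT x|lborel. D k x * \<phi> x) - (LINT x|lborel. u k x * (2 * (g x * \<phi> x)))\<bar>) \<longlonglongrightarrow> ennreal 0"
    proof (rule tendsto_sandwich[OF _ _ tendsto_const zero])
      show "\<forall>\<^sub>F k in sequentially. ennreal \<bar>(LINT x|lborel. D k x * \<phi> x) - (LINT x|lborel. u k x * (2 * (g x * \<phi> x)))\<bar>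
          \<le> ennreal C * (\<integral>\<^sup>+x. ennreal \<bar>G (x + t k *\<^sub>R b) - G x\<bar> \<partial>lborel)"
        by (intro always_eventually allI err)
    qed simp
    then have err_lim: "(\<lambda>k. (LINT x|lborel. D k x * \<phi> x) - (LINT x|lborel. u k x * (2 * (g x * \<phi> x)))) \<longlonglongrightarrow> 0"
      by (simp add: tendsto_ennreal_iff tendsto_rabs_zero_iff del: ennreal_0)
    have D_lim: "(\<lambda>k. LINT x|lborel. D k x * \<phi> x) \<longlonglongrightarrow> l"
      unfolding D_def l_def by (rule difference_quotient_tendsto[OF f \<phi> b t t_lim])
    have u_lim: "(\<lambda>k. LINT x|lborel. u k x * (2 * (g x * \<phi> x))) \<longlonglongrightarrow> l"
      using tendsto_diff[OF D_lim err_lim] by simp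
    have "(\<lambda>j. LINT x|lborel. v j x * (2 * (g x * \<phi> x))) \<longlonglongrightarrow> l"
      unfolding LIMSEQ_iff
    proof (intro allI impI)
      fix e :: real assume e: "0 < e"
      obtain N where N: "\<And>k. N \<le> k \<Longrightarrow> \<bar>(LINT x|lborel. u k x * (2 * (g x * \<phi> x))) - l\<bar> \<le> e / 2"
        using u_lim[unfolded LIMSEQ_iff, rule_format, of "e / 2"] e by (auto intro: less_imp_le)
      have "\<bar>(LINT x|lborel. v j x * (2 * (g x * \<phi> x))) - l\<bar> \<le> e / 2" if "N \<le> j" for j
        using midpoint_hull_antimono[OF v(1) that]
        by (rule midpoint_hull_integral[OF _ _ u_le h N]) measurable
      then show "\<exists>no. \<forall>n\<ge>no. norm ((LINT x|lborel. v n x * (2 * (g x * \<phi> x))) - l) < e"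
        using e by (intro exI[of _ N]) (force intro: le_less_trans)
    qed
    moreover have "(\<lambda>j. LINT x|lborel. v j x * (2 * (g x * \<phi> x))) \<longlonglongrightarrow> (LINT x|lborel. w x * (2 * (g x * \<phi> x)))"
    proof (rule integral_dominated_convergence[where w = "\<lambda>x. \<bar>2 * (g x * \<phi> x)\<bar>"])
      show "AE x in lborel. (\<lambda>j. v j x * (2 * (g x * \<phi> x))) \<longlonglongrightarrow> w x * (2 * (g x * \<phi> x))"
        using v_lim by eventually_elim (intro tendsto_mult tendsto_const)
      show "AE x in lborel. norm (v j x * (2 * (g x * \<phi> x))) \<le> \<bar>2 * (g x * \<phi> x)\<bar>" for j
        using midpoint_hull_abs_le[OF v(1) u_le]
        by (intro AE_I2) (simp add: abs_mult mult_left_le_one_le)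
    qed (use h in auto)
    ultimately have "l = (LINT x|lborel. w x * (2 * (g x * \<phi> x)))" by (rule LIMSEQ_unique)
    then have "l = (LINT x|lborel. 2 * g x * w x * \<phi> x)" by (simp add: mult_ac)
    then show ?thesis by (simp add: l_def)
  qed
  have "\<bar>2 * g x * w x\<bar> \<le> 2 * g x" for x
    using mult_left_mono[OF w_le[of x], of "2 * g x"] g_nonneg[of x] by (simp add: abs_mult)
  then show ?thesis using weak by (intro exI[of _ "\<lambda>x. 2 * g x * w x"]) auto
qed

lemma locally_integrableI:
  fixes f :: "'a::euclidean_space \<Rightarrow> 'b::euclidean_space"
  assumes f: "f \<in> borel_measurable lebesgue" and g: "locally_integrable_borel g"
    and dom: "AE x in lborel. norm (f x) \<le> C * \<bar>g x\<bar>"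
  shows "locally_integrable f"
  unfolding locally_integrable_def set_integrable_def
proof (intro allI impI)
  fix S :: "'a set" assume S: "compact S"
  then obtain R where R: "\<And>z. z \<in> S \<Longrightarrow> norm z \<le> R"
    using compact_imp_bounded[OF S] unfolding bounded_iff by blast
  have "integrable lborel (\<lambda>x. C * \<bar>indicat_real (cball 0 R) x * g x\<bar>)"
    using g by (intro integrable_mult_right integrable_abs) (simp add: locally_integrable_borel_def)
  then have int: "integrable lebesgue (\<lambda>x. C * \<bar>indicat_real (cball 0 R) x * g x\<bar>)"
    by (subst integrable_completion) (auto dest: borel_measurable_integrable)
  show "integrable lebesgue (\<lambda>x. indicat_real S x *\<^sub>R f x)"
  proof (rule Bochner_Integration.integrable_bound[OF int])
    have [measurable]: "S \<in> sets lebesgue" using S by (simp add: compact_imp_closed lmeasurable_compact fmeasurableD)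
    show "(\<lambda>x. indicat_real S x *\<^sub>R f x) \<in> borel_measurable lebesgue" using f by measurable
    show "AE x in lebesgue. norm (indicat_real S x *\<^sub>R f x) \<le> norm (C * \<bar>indicat_real (cball 0 R) x * g x\<bar>)"
      using AE_completion[OF dom]
    proof eventually_elim
      case (elim x)
      show ?case
      proof (cases "x \<in> S")
        case True
        have "norm (f x) \<le> \<bar>C * \<bar>g x\<bar>\<bar>" using elim by linarith
        then show ?thesis using True R[OF True] by simp
      qed simp
    qed
  qed
qed

text \<open>The weak derivatives of a Borel representative in the coordinate directions are the components of
  the weak gradient; each of them is dominated by \<open>2 * g\<close>.\<close>

theorem pointwise_imp_sobolev_orlicz:
  fixes f g :: "'a::euclidean_space \<Rightarrow> real"
  assumes A: "young_function A" and f: "f \<in> orlicz_space A" and g: "g \<in> orlicz_space A" "\<And>x. 0 \<le> g x"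
    and S: "S \<in> null_sets lebesgue"
    and ineq: "\<And>x y. x \<notin> S \<Longrightarrow> y \<notin> S \<Longrightarrow> \<bar>f x - f y\<bar> \<le> dist x y * (g x + g y)"
  shows "f \<in> sobolev_orlicz_space A"
proof -
  obtain f' where f': "f' \<in> borel_measurable borel" "AE x in lborel. f x = f' x"
    "f' \<in> orlicz_space A" "locally_integrable_borel f'"
    using orlicz_borel_representative[OF A f] .
  obtain g0 where g0: "g0 \<in> borel_measurable borel" "AE x in lborel. g x = g0 x"
    "g0 \<in> orlicz_space A" "locally_integrable_borel g0"
    using orlicz_borel_representative[OF A g(1)] .
  define g' where "g' = (\<lambda>x. \<bar>g0 x\<bar>)"
  have g': "locally_integrable_borel g'"
    unfolding locally_integrable_borel_def
  proof (intro conjI allI)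
    show "g' \<in> borel_measurable borel" unfolding g'_def using g0(1) by measurable
    fix R
    have "integrable lborel (\<lambda>z. \<bar>indicat_real (cball 0 R) z * g0 z\<bar>)"
      using g0(4) by (intro integrable_abs) (simp add: locally_integrable_borel_def)
    then show "integrable lborel (\<lambda>z. indicat_real (cball 0 R) z * g' z)"
      by (simp add: g'_def abs_mult)
  qed
  have f_leb [measurable]: "f \<in> borel_measurable lebesgue" and f'_leb [measurable]: "f' \<in> borel_measurable lebesgue"
    using f f'(3) by (auto simp: orlicz_space_def)
  have "AE x in lborel. x \<notin> S"
    using AE_not_in[OF S] by (simp add: AE_completion_iff)
  then have "AE x in lborel. x \<notin> S \<and> f x = f' x \<and> g x = g0 x"
    using f'(2) g0(2) by eventually_elim simp
  then obtain N where N: "N \<in> null_sets lborel" "\<And>x. x \<notin> N \<Longrightarrow> x \<notin> S \<and> f x = f' x \<and> g x = g0 x"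
    by (rule AE_null_setE) blast
  have ineq': "\<bar>f' x - f' y\<bar> \<le> dist x y * (g' x + g' y)" if "x \<notin> N" "y \<notin> N" for x y
    using N(2)[OF that(1)] N(2)[OF that(2)] ineq[of x y] g(2)[of x] g(2)[of y] by (simp add: g'_def)
  define P where "P = (\<lambda>b h. h \<in> borel_measurable borel \<and> (\<forall>x. \<bar>h x\<bar> \<le> 2 * g' x) \<and>
      (\<forall>\<phi>. test_function \<phi> \<longrightarrow> (LINT x|lborel. f' x * frechet_derivative \<phi> (at x) b) = - (LINT x|lborel. h x * \<phi> x)))"
  have "\<exists>h. P b h" if "b \<in> Basis" for b
    unfolding P_def
    by (rule pointwise_imp_weak_derivative[OF f'(4) g' _ N(1) ineq' that]) (simp_all add: g'_def)
  then obtain h where P: "\<And>b. b \<in> Basis \<Longrightarrow> P b (h b)"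
    using bchoice[of Basis P] by blast
  have h: "h b \<in> borel_measurable borel" "\<bar>h b x\<bar> \<le> 2 * g' x"
      "test_function \<phi> \<Longrightarrow>
        (LINT x|lborel. f' x * frechet_derivative \<phi> (at x) b) = - (LINT x|lborel. h b x * \<phi> x)"
    if "b \<in> Basis" for b x \<phi>
    using P[OF that] unfolding P_def by blast+
  define G where "G = (\<lambda>x. \<Sum>b\<in>Basis. h b x *\<^sub>R b)"
  have G_borel: "G \<in> borel_measurable borel"
    unfolding G_def using h(1) by measurable
  have G_leb [measurable]: "G \<in> borel_measurable lebesgue"
    by (rule measurable_completion) (simp add: G_borel)
  have G_inner: "G x \<bullet> b = h b x" if "b \<in> Basis" for x b
    using that by (simp add: G_def)
  have G_le: "norm (G x) \<le> (2 * real DIM('a)) * \<bar>g0 x\<bar>" for x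
  proof -
    have "norm (G x) \<le> (\<Sum>b\<in>Basis. \<bar>G x \<bullet> b\<bar>)" by (rule norm_le_l1)
    also have "\<dots> \<le> of_nat DIM('a) * (2 * g' x)"
      using h(2) by (intro sum_bounded_above) (simp add: G_inner)
    finally show ?thesis by (simp add: g'_def mult_ac)
  qed
  have "weak_gradient f G"
    unfolding weak_gradient_def
  proof (intro conjI allI impI ballI)
    show "locally_integrable f"
      by (rule locally_integrableI[OF f_leb f'(4), where C = 1]) (use f'(2) in \<open>eventually_elim, simp\<close>)
    show "locally_integrable G"
      by (rule locally_integrableI[OF G_leb g0(4) AE_I2[OF G_le]])
  next
    fix \<phi> :: "'a \<Rightarrow> real" and b :: 'a assume \<phi>: "test_function \<phi>" and b: "b \<in> Basis"
    have D: "(\<lambda>z. frechet_derivative \<phi> (at z) b) \<in> borel_measurable borel"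
      using test_function_derivative_continuous[OF \<phi> b] by (rule borel_measurable_continuous_onI)
    have \<phi>_borel: "\<phi> \<in> borel_measurable borel"
      using test_function_continuous[OF \<phi>] by (rule borel_measurable_continuous_onI)
    have [measurable]: "(\<lambda>z. frechet_derivative \<phi> (at z) b) \<in> borel_measurable lebesgue"
      by (rule measurable_completion) (simp add: D)
    have "(LINT x|lebesgue. f x * frechet_derivative \<phi> (at x) b) = (LINT x|lebesgue. f' x * frechet_derivative \<phi> (at x) b)"
    proof (rule integral_cong_AE)
      show "AE z in lebesgue. f z * frechet_derivative \<phi> (at z) b = f' z * frechet_derivative \<phi> (at z) b"
        using AE_completion[OF f'(2)] by eventually_elim simp
    qed measurable
    also have "\<dots> = (LINT x|lborel. f' x * frechet_derivative \<phi> (at x) b)"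
      using D f'(1) by (intro integral_completion) simp
    also have "\<dots> = - (LINT x|lborel. h b x * \<phi> x)" by (rule h(3)[OF b \<phi>])
    also have "(LINT x|lborel. h b x * \<phi> x) = (LINT x|lebesgue. h b x * \<phi> x)"
      using h(1)[OF b] \<phi>_borel by (intro integral_completion[symmetric]) simp
    finally show "(LINT x|lebesgue. f x * frechet_derivative \<phi> (at x) b) = - (LINT x|lebesgue. (G x \<bullet> b) * \<phi> x)"
      by (simp add: G_inner[OF b])
  qed
  moreover have "(\<lambda>x. norm (G x)) \<in> orlicz_space A"
    by (rule orlicz_space_dominated[OF A g0(3), where C = "2 * real DIM('a)"]) (use G_le in auto)
  ultimately show ?thesis using f by (auto simp: sobolev_orlicz_space_def)
qed

theorem corollary3p5:
  fixes A :: "real \<Rightarrow> ennreal" and f :: "real ^ 'n \<Rightarrow> real"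
  assumes "young_function A"
    and "\<exists>c>0. \<forall>t>0. (\<integral>\<^sup>+ s\<in>{0<..<t}. (A s / ennreal (s\<^sup>2)) \<partial>lborel) \<le> A (c * t) / ennreal t"
  shows "f \<in> sobolev_orlicz_space A \<longleftrightarrow>
    f \<in> orlicz_space A \<and>
    (\<exists>g \<in> orlicz_space A. (\<forall>x. 0 \<le> g x) \<and>
      (\<exists>S \<in> null_sets lebesgue. \<forall>x y. x \<notin> S \<longrightarrow> y \<notin> S \<longrightarrow>
         \<bar>f x - f y\<bar> \<le> dist x y * (g x + g y)))"
    (is "_ \<longleftrightarrow> ?pointwise")
proof
  assume f: "f \<in> sobolev_orlicz_space A"
  then have "f \<in> orlicz_space A" by (simp add: sobolev_orlicz_space_def)
  moreover obtain c where "0 < c"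
    "\<And>t. 0 < t \<Longrightarrow> (\<integral>\<^sup>+ s\<in>{0<..<t}. (A s / ennreal (s\<^sup>2)) \<partial>lborel) \<le> A (c * t) / ennreal t"
    using assms(2) by blast
  note sobolev_orlicz_imp_pointwise[OF assms(1) this f]
  ultimately show ?pointwise by (rule conjI)
next
  assume ?pointwise
  then obtain g S where f: "f \<in> orlicz_space A" and g: "g \<in> orlicz_space A" "\<And>x. 0 \<le> g x"
    and S: "S \<in> null_sets lebesgue"
    and ineq: "\<And>x y. x \<notin> S \<Longrightarrow> y \<notin> S \<Longrightarrow> \<bar>f x - f y\<bar> \<le> dist x y * (g x + g y)"
    by auto
  show "f \<in> sobolev_orlicz_space A"
    by (rule pointwise_imp_sobolev_orlicz[OF assms(1) f g S ineq])
qed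

end
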